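(* Let $\{X_t:t\in\mathbb{Z}\}$ be a strictly stationary process taking values in $\mathbb{R}^d$ with true mean $\mathrm{E}X_t=\mu_0\in\mathbb{R}^d$, and suppose assumptions (A.1) and (A.2) of the context hold, with $\Sigma=\sum_{j=-\infty}^{\infty}\mathrm{Cov}(X_0,X_j)$. Let $R_n(\mu_0)$ be the expansive block empirical likelihood ratio for the mean based on $X_1,\ldots,X_n$ and weight function $w$, and let $\lambda_{n,\mu_0}$ be its Lagrange multiplier at $\mu_0$ (both defined in the context). Then, as $n\to\infty$: (i) $n^{1/2}\Sigma^{1/2}\lambda_{n,\mu_0}\stackrel{d}{\rightarrow}Y_d$; (ii) $-\frac{1}{n}\log R_n(\mu_0)\stackrel{d}{\rightarrow}-g_d(Y_d)$, where $B(t)=(B_1(t),\ldots,B_d(t))^\prime$, $0\le t\le 1$, is a vector of i.i.d. copies of standard Brownian motion on $[0,1]$, $f(t)=w(t)B(t)$, $g_d(a)=-\int_0^1\log(1+a^\prime f(t))\,dt$ for $a\in\overline{K}_d=\{y\in\mathbb{R}^d:\min_{0\le t\le 1}(1+y^\prime f(t))\ge 0\}$, and $Y_d$ is the (with probability 1 unique) minimizer of $g_d$ over $\overline{K}_d$.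
   Context: Assumptions. (A.1) The weight function $w:[0,1]\to[0,\infty)$ is continuous on $[0,1]$ and strictly positive on an interval $(0,c)$ for some $c\in(0,1]$. (A.2) The $d\times d$ matrix $\Sigma=\sum_{j=-\infty}^{\infty}\mathrm{Cov}(X_0,X_j)$ is positive definite. Let $S_n(t)$, $t\in[0,1]$, be the process defined by linear interpolation of $\{S_n(i/n)=\sum_{j=1}^i(X_j-\mu_0):i=0,\ldots,n\}$ with $S_n(0)=0$. Then $S_n(\cdot)/n^{1/2}\stackrel{d}{\rightarrow}\Sigma^{1/2}B(\cdot)$ in $\mathcal{C}_d[0,1]$, the space of $\mathbb{R}^d$-valued continuous functions on $[0,1]$ with the supremum metric, where $B$ is a vector of $d$ i.i.d. standard Brownian motions on $[0,1]$. Expansive block empirical likelihood (EBEL). For $\mu\in\mathbb{R}^d$ set $T_{i,\mu}=w(i/n)\sum_{j=1}^i(X_j-\mu)$, $i=1,\ldots,n$, and $$L_n(\mu)=\sup\Big\{\prod_{i=1}^n p_i:\ p_i\ge 0,\ \sum_{i=1}^n p_i=1,\ \sum_{i=1}^n p_iT_{i,\mu}=0_d\Big\},\qquad R_n(\mu)=n^nL_n(\mu),$$ with $L_n(\mu)=0$ if the constraint set is empty. When $0_d$ lies in the interior of the convex hull of $\{T_{i,\mu}:i=1,\ldots,n\}$, the supremum is uniquely attained at $p_i=1/[n(1+\lambda_{n,\mu}^\prime T_{i,\mu})]>0$, where the Lagrange multiplier $\lambda_{n,\mu}\in\mathbb{R}^d$ satisfies $\sum_{i=1}^n\frac{T_{i,\mu}}{n(1+\lambda_{n,\mu}^\prime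 T_{i,\mu})}=0_d$. When $0_d$ is not in this interior, $\lambda_{n,\mu}$ may be defined arbitrarily, and $-\log 0=+\infty$. Here $0_d$ is the zero vector of $\mathbb{R}^d$, $^\prime$ is transpose, and $\log 0=-\infty$ in the definition of $g_d$. *)

theory Defs
  imports "HOL-Probability.Probability"
begin

text \<open>
  Convergence in distribution of random elements of a topological space, by
  bounded continuous test functions. The limit may live on another probability
  space. Measurability of all random elements involved is part of the notion.
\<close>

definition conv_in_distr ::
  "'a measure \<Rightarrow> (nat \<Rightarrow> 'a \<Rightarrow> 'c::topological_space) \<Rightarrow> 'b measure \<Rightarrow> ('b \<Rightarrow> 'c) \<Rightarrow> bool"
where
  "conv_in_distr M Z N Y \<longleftrightarrow>
     (\<forall>n. Z n \<in> borel_measurable M) \<and> Y \<in> borel_measurable N \<and>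
     (\<forall>\<phi>::'c \<Rightarrow> real. continuous_on UNIV \<phi> \<longrightarrow> bounded (range \<phi>) \<longrightarrow>
        (\<lambda>n. \<integral>\<omega>. \<phi> (Z n \<omega>) \<partial>M) \<longlonglongrightarrow> (\<integral>\<omega>. \<phi> (Y \<omega>) \<partial>N))"

text \<open>
  The space of continuous functions on [0,1] with the supremum metric is
  represented by its isometric image in the library type of bounded continuous
  functions on the real line: \<open>path01 f\<close> agrees with \<open>f\<close> on [0,1] and is constant
  outside. The image is a closed subspace, so by restriction and Tietze extension
  of the test functions convergence in distribution is the same in either space.
\<close>

definition path01 :: "(real \<Rightarrow> 'c::metric_space) \<Rightarrow> real \<Rightarrow>\<^sub>C 'c" where
  "path01 f = Bcontfun (ext_cont f 0 1)"

lemma clamp_unit_interval: "clamp 0 1 t \<in> {0..1}" for t :: real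
  using clamp_in_interval[of "0::real" 1 t] by (simp add: cbox_interval)

lemma apply_path01:
  assumes "continuous_on {0..1} f"
  shows "apply_bcontfun (path01 f) t = f (clamp 0 1 t)"
proof -
  have "continuous_on UNIV (ext_cont f 0 1)"
    using assms by (intro continuous_on_ext_cont) (simp add: cbox_interval)
  moreover have "range (ext_cont f 0 1) \<subseteq> f ` {0..1}"
    using clamp_unit_interval by (auto simp: ext_cont_def)
  then have "bounded (range (ext_cont f 0 1))"
    using assms by (meson bounded_subset compact_Icc compact_continuous_image compact_imp_bounded)
  ultimately have "ext_cont f 0 1 \<in> bcontfun"
    by (simp add: bcontfun_def)
  then show ?thesis
    by (simp add: path01_def Bcontfun_inverse ext_cont_def)
qed

lemma dist_path01_le_iff:
  assumes f: "continuous_on {0..1} f" and g: "continuous_on {0..1} g"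
  shows "dist (path01 f) (path01 g) \<le> e \<longleftrightarrow> (\<forall>t\<in>{0..1}. dist (f t) (g t) \<le> e)"
proof
  assume le: "dist (path01 f) (path01 g) \<le> e"
  show "\<forall>t\<in>{0..1}. dist (f t) (g t) \<le> e"
  proof
    fix t :: real assume "t \<in> {0..1}"
    then have "clamp 0 1 t = t"
      by (intro clamp_cancel_cbox) (simp add: cbox_interval)
    then show "dist (f t) (g t) \<le> e"
      using order_trans[OF dist_bounded le, of t] by (simp add: apply_path01 f g)
  qed
next
  assume le: "\<forall>t\<in>{0..1}. dist (f t) (g t) \<le> e"
  show "dist (path01 f) (path01 g) \<le> e"
    using le clamp_unit_interval by (intro dist_bound) (simp add: apply_path01 f g del: atLeastAtMost_iff)
qed

definition pos_def :: "real^'n^'n \<Rightarrow> bool" where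
  "pos_def A \<longleftrightarrow> transpose A = A \<and> (\<forall>x. x \<noteq> 0 \<longrightarrow> x \<bullet> (A *v x) > 0)"

definition mat_sqrt :: "real^'n^'n \<Rightarrow> real^'n^'n" where
  "mat_sqrt A = (THE S. pos_def S \<and> S ** S = A)"

definition strictly_stationary ::
  "'a measure \<Rightarrow> (int \<Rightarrow> 'a \<Rightarrow> 'c::topological_space) \<Rightarrow> bool"
where
  "strictly_stationary M X \<longleftrightarrow>
     (\<forall>t. X t \<in> borel_measurable M) \<and>
     (\<forall>J h. finite J \<longrightarrow>
        distr M (Pi\<^sub>M J (\<lambda>_. borel)) (\<lambda>\<omega>. \<lambda>j\<in>J. X (j + h) \<omega>) =
        distr M (Pi\<^sub>M J (\<lambda>_. borel)) (\<lambda>\<omega>. \<lambda>j\<in>J. X j \<omega>))"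

definition cov_matrix :: "'a measure \<Rightarrow> ('a \<Rightarrow> real^'n) \<Rightarrow> ('a \<Rightarrow> real^'n) \<Rightarrow> real^'n^'n" where
  "cov_matrix M U V =
     (\<chi> a b. \<integral>\<omega>. (U \<omega> $ a - (\<integral>\<xi>. U \<xi> $ a \<partial>M)) * (V \<omega> $ b - (\<integral>\<xi>. V \<xi> $ b \<partial>M)) \<partial>M)"

text \<open>
  Standard Brownian motion on [0,1]. Sample paths are continuous for every outcome,
  so that the process is a random element of the path space; values at times outside
  [0,1] are irrelevant.
\<close>

definition standard_bm :: "'b measure \<Rightarrow> (real \<Rightarrow> 'b \<Rightarrow> real) \<Rightarrow> bool" where
  "standard_bm N W \<longleftrightarrow>
     (\<forall>t\<in>{0..1}. W t \<in> borel_measurable N) \<and>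
     (\<forall>\<omega>\<in>space N. continuous_on {0..1} (\<lambda>t. W t \<omega>)) \<and>
     (AE \<omega> in N. W 0 \<omega> = 0) \<and>
     (\<forall>s t. 0 \<le> s \<longrightarrow> s < t \<longrightarrow> t \<le> 1 \<longrightarrow>
        distributed N lborel (\<lambda>\<omega>. W t \<omega> - W s \<omega>) (normal_density 0 (sqrt (t - s)))) \<and>
     (\<forall>k (\<tau>::nat \<Rightarrow> real). 0 \<le> \<tau> 0 \<longrightarrow> (\<forall>i<k. \<tau> i \<le> \<tau> (Suc i)) \<longrightarrow> \<tau> k \<le> 1 \<longrightarrow>
        prob_space.indep_vars N (\<lambda>_. borel) (\<lambda>i \<omega>. W (\<tau> (Suc i)) \<omega> - W (\<tau> i) \<omega>) {..<k})"

definition standard_bm_vector :: "'b measure \<Rightarrow> (real \<Rightarrow> 'b \<Rightarrow> real^'n) \<Rightarrow> bool" where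
  "standard_bm_vector N B \<longleftrightarrow>
     (\<forall>k. standard_bm N (\<lambda>t \<omega>. B t \<omega> $ k)) \<and>
     prob_space.indep_vars N (\<lambda>_. Pi\<^sub>M {0..1} (\<lambda>_. borel)) (\<lambda>k \<omega>. \<lambda>t\<in>{0..1}. B t \<omega> $ k) UNIV"

definition weight_function :: "(real \<Rightarrow> real) \<Rightarrow> bool" where
  "weight_function w \<longleftrightarrow>
     continuous_on {0..1} w \<and> (\<forall>t\<in>{0..1}. 0 \<le> w t) \<and>
     (\<exists>c. 0 < c \<and> c \<le> 1 \<and> (\<forall>t\<in>{0<..<c}. 0 < w t))"

text \<open>Linear interpolation of the points \<open>(i/n, \<Sum>j=1..i. x j - \<mu>)\<close>, \<open>i = 0,\<dots>,n\<close>.\<close>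

definition partial_sum_path ::
  "nat \<Rightarrow> (nat \<Rightarrow> 'c::real_vector) \<Rightarrow> 'c \<Rightarrow> real \<Rightarrow> 'c"
where
  "partial_sum_path n x \<mu> t =
     (let k = nat \<lfloor>real n * t\<rfloor>
      in (\<Sum>j=1..k. x j - \<mu>) + (real n * t - real k) *\<^sub>R (x (Suc k) - \<mu>))"

definition ebel_T ::
  "(real \<Rightarrow> real) \<Rightarrow> nat \<Rightarrow> (nat \<Rightarrow> real^'n) \<Rightarrow> real^'n \<Rightarrow> nat \<Rightarrow> real^'n"
where
  "ebel_T w n x \<mu> i = w (real i / real n) *\<^sub>R (\<Sum>j=1..i. x j - \<mu>)"

definition ebel_weights ::
  "(real \<Rightarrow> real) \<Rightarrow> nat \<Rightarrow> (nat \<Rightarrow> real^'n) \<Rightarrow> real^'n \<Rightarrow> (nat \<Rightarrow> real) set"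
where
  "ebel_weights w n x \<mu> =
     {p. (\<forall>i\<in>{1..n}. 0 \<le> p i) \<and> (\<Sum>i=1..n. p i) = 1 \<and>
         (\<Sum>i=1..n. p i *\<^sub>R ebel_T w n x \<mu> i) = 0}"

definition ebel_L ::
  "(real \<Rightarrow> real) \<Rightarrow> nat \<Rightarrow> (nat \<Rightarrow> real^'n) \<Rightarrow> real^'n \<Rightarrow> real"
where
  "ebel_L w n x \<mu> =
     (if ebel_weights w n x \<mu> = {} then 0
      else (SUP p\<in>ebel_weights w n x \<mu>. \<Prod>i=1..n. p i))"

definition ebel_R ::
  "(real \<Rightarrow> real) \<Rightarrow> nat \<Rightarrow> (nat \<Rightarrow> real^'n) \<Rightarrow> real^'n \<Rightarrow> real"
where
  "ebel_R w n x \<mu> = real n ^ n * ebel_L w n x \<mu>"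

text \<open>
  \<open>l\<close> is admissible as Lagrange multiplier: if 0 is not interior to the convex hull,
  any vector is.
\<close>

definition ebel_multiplier ::
  "(real \<Rightarrow> real) \<Rightarrow> nat \<Rightarrow> (nat \<Rightarrow> real^'n) \<Rightarrow> real^'n \<Rightarrow> real^'n \<Rightarrow> bool"
where
  "ebel_multiplier w n x \<mu> l \<longleftrightarrow>
     (0 \<in> interior (convex hull (ebel_T w n x \<mu> ` {1..n})) \<longrightarrow>
        (\<forall>i\<in>{1..n}. 0 < 1 / (real n * (1 + l \<bullet> ebel_T w n x \<mu> i))) \<and>
        (\<Sum>i=1..n. (1 / (real n * (1 + l \<bullet> ebel_T w n x \<mu> i))) *\<^sub>R ebel_T w n x \<mu> i) = 0)"

definition elog :: "real \<Rightarrow> ereal" where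
  "elog x = (if x \<le> 0 then -\<infinity> else ereal (ln x))"

text \<open>
  \<open>g_fun f a\<close> is minus the integral over [0,1] of \<open>log (1 + a'f(t))\<close>, as the integral
  of the negative part minus the integral of the positive part of the logarithm;
  \<open>e2ennreal\<close> truncates at 0. The positive part is bounded for continuous \<open>f\<close>, so the
  difference is never of the form \<open>\<infinity> - \<infinity>\<close>.
\<close>

definition g_fun :: "(real \<Rightarrow> real^'n) \<Rightarrow> real^'n \<Rightarrow> ereal" where
  "g_fun f a =
     enn2ereal (\<integral>\<^sup>+t\<in>{0..1}. e2ennreal (- elog (1 + a \<bullet> f t)) \<partial>lborel) -
     enn2ereal (\<integral>\<^sup>+t\<in>{0..1}. e2ennreal (elog (1 + a \<bullet> f t)) \<partial>lborel)"

definition K_bar :: "(real \<Rightarrow> real^'n) \<Rightarrow> (real^'n) set" where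
  "K_bar f = {y. \<forall>t\<in>{0..1}. 0 \<le> 1 + y \<bullet> f t}"

definition is_g_minimizer :: "(real \<Rightarrow> real^'n) \<Rightarrow> real^'n \<Rightarrow> bool" where
  "is_g_minimizer f y \<longleftrightarrow> is_arg_min (g_fun f) (\<lambda>a. a \<in> K_bar f) y"

end

theory Submission
  imports Defs "HOL-Real_Asymp.Real_Asymp"
begin

text \<open>
  The multiplier and the log likelihood ratio depend only on the path of normalised partial sums,
  so the theorem reduces to a mapping theorem for functionals that converge continuously at almost
  every path of the limit. Write \<open>f = w B\<close>. Almost surely the path of \<open>B\<close> meets every open orthant
  arbitrarily early, so \<open>0\<close> is interior to the convex hull of the values of \<open>f\<close>, \<open>K_bar f\<close> is
  compact, and the convex function \<open>g_fun f\<close> has a unique minimiser on it. In the coordinates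
  \<open>a = sqrt n *\<^sub>R (mat_sqrt \<Sigma> *v lam)\<close> the multiplier minimises the discrete convex functions
  \<open>- (1/n) (\<Sum>i\<le>n. ln (1 + a \<bullet> f\<^sub>n (i/n)))\<close> with \<open>f\<^sub>n\<close> uniformly close to \<open>f\<close>. These epi-converge
  to \<open>g_fun f\<close>, which is the increasing limit of its continuous regularisations
  \<open>- (\<integral>t. ln (1 + \<eta> + a \<bullet> f t))\<close> as \<open>\<eta>\<close> decreases to 0; hence minimisers and minimal values converge
  even when the minimiser lies on the boundary of \<open>K_bar f\<close>.
\<close>

section \<open>Convergence in distribution and continuous convergence\<close>

text \<open>The multiplier may be any vector when 0 is not interior to the convex hull, so it need
  not be a function of the path, and the usual continuous mapping theorem does not cover it. The
  mapping theorem used here is about maps of the outcome: whenever indices tend to infinity and the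
  paths of the chosen outcomes converge to a limit path, the values must converge as well. What
  remains to be shown is deterministic, about one convergent sequence of paths.

  The second obstacle is the singularity of the logarithm. \<open>g_fun f\<close> may be infinite on
  the boundary of \<open>K_bar f\<close>, where its minimiser may also lie. Adding \<eta> inside the
  logarithm keeps its argument at least \<eta> on all of \<open>K_bar f\<close>. For the minimiser
  \<open>y\<close>, the point \<open>y / (1 + \<eta>)\<close> realises this shift exactly, up to the
  additive cost \<open>ln (1 + \<eta>) \<le> \<eta>\<close>, and it satisfies the strict
  inequalities of the discrete problem.

  Brownian motion has to visit the orthants early because the weight is only known to be positive on
  an initial interval, and scaling by a positive weight preserves orthants.\<close>

lemma abs_min_diff_le: "\<bar>min 1 (a::real) - min 1 b\<bar> \<le> \<bar>a - b\<bar>"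
  by (auto simp: min_def abs_if)

text \<open>For \<open>n \<ge> m\<close> the variable \<open>u n\<close> is dominated by an envelope
  \<open>U m\<close> evaluated at \<open>Z n\<close>. The envelope is a supremum of uniformly
  Lipschitz functions of the point \<open>z\<close>, hence itself bounded and Lipschitz, so weak
  convergence applies to it. As \<open>m\<close> grows, continuous convergence forces
  \<open>U m (Zl \<omega>')\<close> below \<open>ul \<omega>' + e\<close> for every
  \<open>e > 0\<close>. The two probability spaces are never coupled, and the path space may be
  nonseparable.\<close>

lemma conv_in_distr_limsup:
  fixes Z :: "nat \<Rightarrow> 'a \<Rightarrow> 'c::metric_space" and u :: "nat \<Rightarrow> 'a \<Rightarrow> real"
  assumes M: "prob_space M" and N: "prob_space N"
    and conv: "conv_in_distr M Z N Zl"
    and u: "\<And>n. u n \<in> borel_measurable M" and ul: "ul \<in> borel_measurable N"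
    and C: "\<And>n \<omega>. \<bar>u n \<omega>\<bar> \<le> C" and Cl: "\<And>\<omega>. \<bar>ul \<omega>\<bar> \<le> C"
    and lim: "AE \<omega>' in N. \<forall>k \<omega>. filterlim k at_top sequentially \<longrightarrow> (\<forall>i::nat. \<omega> i \<in> space M) \<longrightarrow>
        (\<lambda>i. Z (k i) (\<omega> i)) \<longlonglongrightarrow> Zl \<omega>' \<longrightarrow> (\<lambda>i. u (k i) (\<omega> i)) \<longlonglongrightarrow> ul \<omega>'"
    and e: "e > 0"
  shows "\<forall>\<^sub>F n in sequentially. (\<integral>\<omega>. u n \<omega> \<partial>M) < (\<integral>\<omega>. ul \<omega> \<partial>N) + e"
proof -
  interpret M: prob_space M by fact
  interpret N: prob_space N by fact
  have C0: "C \<ge> 0" using C[of 0 undefined] by linarith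
  define I where "I m = {m::nat..} \<times> space M" for m
  \<comment> \<open>The factor \<open>2 * C\<close> makes a saturated penalty decisive: a pair at
    distance at least \<open>1 / m\<close> from \<open>z\<close> contributes at most
    \<open>C - 2 * C = - C\<close>, which cannot exceed the limit value.\<close>
  define t where "t m z p = u (fst p) (snd p) - 2 * C * min 1 (real m * dist (Z (fst p) (snd p)) z)"
    for m z p
  define U where "U m z = (SUP p\<in>I m. t m z p)" for m z
  have I_ne: "I m \<noteq> {}" for m using M.not_empty by (auto simp: I_def)
  have mm: "0 \<le> min 1 (real m * dist x y)" "min 1 (real m * dist x y) \<le> 1" for m and x y :: 'c
    by auto
  have t_ub: "t m z p \<le> C" for m z p
  proof -
    have "0 \<le> 2 * C * min 1 (real m * dist (Z (fst p) (snd p)) z)"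
      using C0 mm(1) by (intro mult_nonneg_nonneg) auto
    then show ?thesis
      using C[of "fst p" "snd p"] unfolding t_def abs_le_iff by linarith
  qed
  have t_lb: "- (3 * C) \<le> t m z p" for m z p
  proof -
    have "2 * C * min 1 (real m * dist (Z (fst p) (snd p)) z) \<le> 2 * C * 1"
      using C0 mm(2) by (intro mult_left_mono) auto
    then show ?thesis
      using C[of "fst p" "snd p"] unfolding t_def abs_le_iff by linarith
  qed
  have bdd: "bdd_above (t m z ` I m)" for m z
    by (rule bdd_aboveI2[where M=C]) (rule t_ub)
  have U_ge: "p \<in> I m \<Longrightarrow> t m z p \<le> U m z" for m z p
    unfolding U_def by (rule cSUP_upper[OF _ bdd])
  have U_ub: "U m z \<le> C" for m z
    unfolding U_def by (rule cSUP_least[OF I_ne t_ub])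
  have U_lb: "- (3 * C) \<le> U m z" for m z
    using I_ne[of m] t_lb U_ge by (meson ex_in_conv order_trans)
  have U_lip1: "U m z \<le> U m z' + 2 * C * real m * dist z z'" for m z z'
  proof -
    have "t m z p \<le> U m z' + 2 * C * real m * dist z z'" if "p \<in> I m" for p
    proof -
      let ?a = "real m * dist (Z (fst p) (snd p)) z" and ?b = "real m * dist (Z (fst p) (snd p)) z'"
      have "\<bar>?a - ?b\<bar> \<le> real m * dist z z'"
      proof -
        have "\<bar>?a - ?b\<bar> = real m * \<bar>dist (Z (fst p) (snd p)) z - dist (Z (fst p) (snd p)) z'\<bar>"
          by (simp add: abs_mult flip: right_diff_distrib)
        also have "\<dots> \<le> real m * dist z z'"
          using abs_dist_diff_le[of z "Z (fst p) (snd p)" z'] by (intro mult_left_mono) (auto simp: dist_commute)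
        finally show ?thesis .
      qed
      then have "\<bar>min 1 ?a - min 1 ?b\<bar> \<le> real m * dist z z'"
        using abs_min_diff_le[of ?a ?b] by linarith
      then have "2 * C * (min 1 ?b - min 1 ?a) \<le> 2 * C * (real m * dist z z')"
        using C0 by (intro mult_left_mono) auto
      then have "t m z p \<le> t m z' p + 2 * C * real m * dist z z'"
        by (simp add: t_def algebra_simps)
      then show ?thesis using U_ge[OF that, of z'] by linarith
    qed
    then show ?thesis unfolding U_def[of m z] by (rule cSUP_least[OF I_ne])
  qed
  have U_cont: "continuous_on UNIV (U m)" for m
  proof (rule continuous_onI)
    fix z :: 'c and e :: real assume "e > 0"
    let ?L = "2 * C * real m + 1"
    have L: "?L > 0" using C0 by (simp add: add_nonneg_pos)
    show "\<exists>d>0. \<forall>x'\<in>UNIV. dist x' z < d \<longrightarrow> dist (U m x') (U m z) \<le> e"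
    proof (intro exI[of _ "e / ?L"] conjI ballI impI)
      show "e / ?L > 0" using L \<open>e > 0\<close> by simp
      fix x' assume "dist x' z < e / ?L"
      then have "?L * dist x' z < e" using L by (simp add: field_simps)
      moreover have "2 * C * real m * dist x' z \<le> ?L * dist x' z" by (simp add: distrib_right)
      ultimately show "dist (U m x') (U m z) \<le> e"
        using U_lip1[of m x' z] U_lip1[of m z x'] by (simp add: dist_real_def dist_commute abs_le_iff)
    qed
  qed
  have U_bdd: "bounded (range (U m))" for m
  proof -
    have "range (U m) \<subseteq> {- (3 * C)..C}" using U_ub U_lb by auto
    then show ?thesis by (rule bounded_subset[OF bounded_closed_interval[of "- (3 * C)" C, unfolded cbox_interval]])
  qed
  have Zl: "Zl \<in> borel_measurable N" and Z: "\<And>n. Z n \<in> borel_measurable M"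
    and U_conv: "\<And>m. (\<lambda>n. \<integral>\<omega>. U m (Z n \<omega>) \<partial>M) \<longlonglongrightarrow> (\<integral>\<omega>. U m (Zl \<omega>) \<partial>N)"
    using conv U_cont U_bdd unfolding conv_in_distr_def by simp_all
  have U_meas: "(\<lambda>\<omega>. U m (Zl \<omega>)) \<in> borel_measurable N" "(\<lambda>\<omega>. U m (Z n \<omega>)) \<in> borel_measurable M" for m n
    using Zl Z U_cont[of m] by (auto intro: measurable_compose borel_measurable_continuous_onI)
  have abs3: "\<bar>U m z\<bar> \<le> 3 * C" for m z using U_ub[of m z] U_lb[of m z] C0 by linarith
  have absmax: "\<bar>max (U m z) (ul \<omega>)\<bar> \<le> 3 * C" for m z \<omega>
    using abs3[of m z] Cl[of \<omega>] C0 by linarith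
  \<comment> \<open>\<open>U m (Zl \<omega>)\<close> is controlled only from above and may stay
    below \<open>ul \<omega>\<close>. The maximum turns this one-sided control into convergence, so
    that dominated convergence applies.\<close>
  have "(\<lambda>m. \<integral>\<omega>. max (U m (Zl \<omega>)) (ul \<omega>) \<partial>N) \<longlonglongrightarrow> (\<integral>\<omega>. ul \<omega> \<partial>N)"
  proof (rule integral_dominated_convergence[where w = "\<lambda>_. 3 * C"])
    show "AE \<omega> in N. (\<lambda>m. max (U m (Zl \<omega>)) (ul \<omega>)) \<longlonglongrightarrow> ul \<omega>"
      using lim
    proof eventually_elim
      case (elim \<omega>')
      \<comment> \<open>If the envelope stayed above, nearly maximising pairs would give indices
        tending to infinity and outcomes whose \<open>Z\<close> values converge to
        \<open>Zl \<omega>'\<close>, which contradicts continuous convergence.\<close>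
      have ev: "\<exists>m0. \<forall>m\<ge>m0. U m (Zl \<omega>') < ul \<omega>' + e" if "e > 0" for e
      proof (rule ccontr)
        assume "\<not> ?thesis"
        then have "\<forall>k. \<exists>m\<ge>Suc k. ul \<omega>' + e \<le> U m (Zl \<omega>')" by (meson not_less)
        then obtain m where m: "\<And>k. m k \<ge> Suc k" "\<And>k. ul \<omega>' + e \<le> U (m k) (Zl \<omega>')" by metis
        have "\<exists>p\<in>I (m k). ul \<omega>' + e / 2 < t (m k) (Zl \<omega>') p" for k
        proof -
          have "ul \<omega>' + e / 2 < U (m k) (Zl \<omega>')" using m(2)[of k] \<open>e > 0\<close> by linarith
          then show ?thesis unfolding U_def by (simp add: less_cSUP_iff[OF I_ne bdd])
        qed
        then obtain p where p: "\<And>k. p k \<in> I (m k)" "\<And>k. ul \<omega>' + e / 2 < t (m k) (Zl \<omega>') (p k)" by metis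
        have lt: "real (m k) * dist (Z (fst (p k)) (snd (p k))) (Zl \<omega>') < 1" for k
        proof (rule ccontr)
          assume "\<not> ?thesis"
          then have "t (m k) (Zl \<omega>') (p k) \<le> - C" using C[of "fst (p k)" "snd (p k)"] by (simp add: t_def)
          then show False using p(2)[of k] Cl[of \<omega>'] \<open>e > 0\<close> by (simp add: abs_le_iff)
        qed
        have d: "dist (Z (fst (p k)) (snd (p k))) (Zl \<omega>') < 1 / real (Suc k)" for k
        proof -
          have "real (Suc k) * dist (Z (fst (p k)) (snd (p k))) (Zl \<omega>') \<le> real (m k) * dist (Z (fst (p k)) (snd (p k))) (Zl \<omega>')"
            using m(1)[of k] by (intro mult_right_mono) auto
          then show ?thesis using lt[of k] by (simp add: field_simps)
        qed
        have "(\<lambda>k. Z (fst (p k)) (snd (p k))) \<longlonglongrightarrow> Zl \<omega>'"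
          by (rule metric_tendsto_imp_tendsto[OF LIMSEQ_inverse_real_of_nat])
             (use d in \<open>auto intro!: always_eventually less_imp_le simp: inverse_eq_divide\<close>)
        moreover have "k \<le> fst (p k)" for k
          using p(1)[of k] m(1)[of k] by (auto simp: I_def)
        then have "filterlim (\<lambda>k. fst (p k)) at_top sequentially"
          by (intro filterlim_at_top_mono[OF filterlim_ident]) auto
        moreover have "\<forall>k. snd (p k) \<in> space M" using p(1) by (simp add: I_def mem_Times_iff)
        ultimately have "(\<lambda>k. u (fst (p k)) (snd (p k))) \<longlonglongrightarrow> ul \<omega>'" 
          using elim[THEN spec, THEN spec, of "\<lambda>k. fst (p k)" "\<lambda>k. snd (p k)"] by simp
        then have "\<forall>\<^sub>F k in sequentially. u (fst (p k)) (snd (p k)) < ul \<omega>' + e / 2"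
          by (rule order_tendstoD) (use \<open>e > 0\<close> in simp)
        then obtain k where "u (fst (p k)) (snd (p k)) < ul \<omega>' + e / 2"
          by (auto simp: eventually_sequentially)
        moreover have "t (m k) (Zl \<omega>') (p k) \<le> u (fst (p k)) (snd (p k))"
          using mult_nonneg_nonneg[of "2*C", OF _ mm(1)] C0 by (simp add: t_def)
        ultimately show False using p(2)[of k] by linarith
      qed
      show ?case
      proof (rule LIMSEQ_I)
        fix r :: real assume "r > 0"
        from ev[OF this] obtain m0 where "\<And>m. m \<ge> m0 \<Longrightarrow> U m (Zl \<omega>') < ul \<omega>' + r" by blast
        then show "\<exists>no. \<forall>n\<ge>no. norm (max (U n (Zl \<omega>')) (ul \<omega>') - ul \<omega>') < r"
          using \<open>r > 0\<close> by (intro exI[of _ m0]) (simp add: max_def diff_less_eq add.commute)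
      qed
    qed
    show "AE \<omega> in N. norm (max (U m (Zl \<omega>)) (ul \<omega>)) \<le> 3 * C" for m using absmax by simp
  qed (simp_all add: U_meas ul borel_measurable_max)
  then have "\<forall>\<^sub>F m in sequentially. (\<integral>\<omega>. max (U m (Zl \<omega>)) (ul \<omega>) \<partial>N) < (\<integral>\<omega>. ul \<omega> \<partial>N) + e / 2"
    by (rule order_tendstoD) (use e in simp)
  then obtain m where m: "(\<integral>\<omega>. max (U m (Zl \<omega>)) (ul \<omega>) \<partial>N) < (\<integral>\<omega>. ul \<omega> \<partial>N) + e / 2"
    by (auto simp: eventually_sequentially)
  have intU: "integrable N (\<lambda>\<omega>. U m (Zl \<omega>))" "integrable M (\<lambda>\<omega>. U m (Z n \<omega>))" for n
    using U_meas abs3 by (auto intro!: N.integrable_const_bound[where B="3*C"] M.integrable_const_bound[where B="3*C"])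
  have intu: "integrable M (u n)" "integrable N ul" for n
    using u ul C Cl by (auto intro!: N.integrable_const_bound[where B="C"] M.integrable_const_bound[where B="C"])
  have "(\<integral>\<omega>. U m (Zl \<omega>) \<partial>N) \<le> (\<integral>\<omega>. max (U m (Zl \<omega>)) (ul \<omega>) \<partial>N)"
    by (rule integral_mono[OF intU(1) integrable_max[OF intU(1) intu(2)]]) simp
  then have "(\<integral>\<omega>. U m (Zl \<omega>) \<partial>N) < (\<integral>\<omega>. ul \<omega> \<partial>N) + e" using m e by linarith
  from order_tendstoD(2)[OF U_conv this]
  have "\<forall>\<^sub>F n in sequentially. (\<integral>\<omega>. U m (Z n \<omega>) \<partial>M) < (\<integral>\<omega>. ul \<omega> \<partial>N) + e" .
  with eventually_ge_at_top[of m] show ?thesis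
  proof eventually_elim
    case (elim n)
    have "(\<integral>\<omega>. u n \<omega> \<partial>M) \<le> (\<integral>\<omega>. U m (Z n \<omega>) \<partial>M)"
    proof (rule integral_mono[OF intu(1) intU(2)])
      fix \<omega> assume "\<omega> \<in> space M"
      then have "(n, \<omega>) \<in> I m" using elim by (simp add: I_def)
      from U_ge[OF this, of "Z n \<omega>"] show "u n \<omega> \<le> U m (Z n \<omega>)" by (simp add: t_def)
    qed
    then show ?case using elim by linarith
  qed
qed

text \<open>The one-sided estimate is applied to \<open>\<phi>\<close> and to
  \<open>- \<phi>\<close>. The hypothesis admits arbitrary index sequences \<open>k\<close> because
  the nearly maximising pairs come with indices that cannot be prescribed. The target is a general
  topological space, so the same statement serves vectors and extended reals.\<close>

lemma conv_in_distr_mapping: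
  fixes Z :: "nat \<Rightarrow> 'a \<Rightarrow> 'c::metric_space" and h :: "nat \<Rightarrow> 'a \<Rightarrow> 'e::topological_space"
  assumes M: "prob_space M" and N: "prob_space N"
    and conv: "conv_in_distr M Z N Zl"
    and h: "\<And>n. h n \<in> borel_measurable M" and hl: "hl \<in> borel_measurable N"
    and lim: "AE \<omega>' in N. \<forall>k \<omega>. filterlim k at_top sequentially \<longrightarrow> (\<forall>i::nat. \<omega> i \<in> space M) \<longrightarrow>
        (\<lambda>i. Z (k i) (\<omega> i)) \<longlonglongrightarrow> Zl \<omega>' \<longrightarrow> (\<lambda>i. h (k i) (\<omega> i)) \<longlonglongrightarrow> hl \<omega>'"
  shows "conv_in_distr M h N hl"
  unfolding conv_in_distr_def
proof (intro conjI allI impI h hl)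
  fix \<phi> :: "'e \<Rightarrow> real" assume \<phi>: "continuous_on UNIV \<phi>" "bounded (range \<phi>)"
  then obtain C where C: "\<And>x. \<bar>\<phi> x\<bar> \<le> C" by (auto simp: bounded_iff)
  have \<phi>m: "\<phi> \<in> borel_measurable borel" using \<phi>(1) by (rule borel_measurable_continuous_onI)
  have \<phi>t: "(\<lambda>i. \<phi> (x i)) \<longlonglongrightarrow> \<phi> l" if "x \<longlonglongrightarrow> l" for x :: "nat \<Rightarrow> 'e" and l
    using continuous_on_tendsto_compose[OF \<phi>(1) that] by simp
  have 1: "\<forall>\<^sub>F n in sequentially. (\<integral>\<omega>. s * \<phi> (h n \<omega>) \<partial>M) < (\<integral>\<omega>. s * \<phi> (hl \<omega>) \<partial>N) + e"
    if "e > 0" "\<bar>s\<bar> = 1" for e s :: real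
  proof (rule conv_in_distr_limsup[where C=C and Z=Z and Zl=Zl and u="\<lambda>n \<omega>. s * \<phi> (h n \<omega>)"
        and ul="\<lambda>\<omega>. s * \<phi> (hl \<omega>)"])
    show "AE \<omega>' in N. \<forall>k \<omega>. filterlim k at_top sequentially \<longrightarrow> (\<forall>i::nat. \<omega> i \<in> space M) \<longrightarrow>
        (\<lambda>i. Z (k i) (\<omega> i)) \<longlonglongrightarrow> Zl \<omega>' \<longrightarrow> (\<lambda>i. s * \<phi> (h (k i) (\<omega> i))) \<longlonglongrightarrow> s * \<phi> (hl \<omega>')"
      using lim
    proof eventually_elim
      case (elim \<omega>')
      show ?case
      proof (intro allI impI tendsto_mult_left)
        fix k \<omega>
        assume "filterlim k at_top sequentially" "\<forall>i::nat. \<omega> i \<in> space M"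
          and "(\<lambda>i. Z (k i) (\<omega> i)) \<longlonglongrightarrow> Zl \<omega>'"
        with elim have "(\<lambda>i. h (k i) (\<omega> i)) \<longlonglongrightarrow> hl \<omega>'" by simp
        then show "(\<lambda>i. \<phi> (h (k i) (\<omega> i))) \<longlonglongrightarrow> \<phi> (hl \<omega>')" by (rule \<phi>t)
      qed
    qed
    show "(\<lambda>\<omega>. s * \<phi> (h n \<omega>)) \<in> borel_measurable M" for n
      by (intro borel_measurable_times borel_measurable_const measurable_compose[OF h \<phi>m])
    show "(\<lambda>\<omega>. s * \<phi> (hl \<omega>)) \<in> borel_measurable N"
      by (intro borel_measurable_times borel_measurable_const measurable_compose[OF hl \<phi>m])
  qed (use M N conv that in \<open>simp_all add: abs_mult C\<close>)
  show "(\<lambda>n. \<integral>\<omega>. \<phi> (h n \<omega>) \<partial>M) \<longlonglongrightarrow> (\<integral>\<omega>. \<phi> (hl \<omega>) \<partial>N)"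
  proof (rule order_tendstoI)
    fix a :: real assume "a < (\<integral>\<omega>. \<phi> (hl \<omega>) \<partial>N)"
    then show "\<forall>\<^sub>F n in sequentially. a < (\<integral>\<omega>. \<phi> (h n \<omega>) \<partial>M)"
      using 1[of "(\<integral>\<omega>. \<phi> (hl \<omega>) \<partial>N) - a" "-1"] by (auto elim!: eventually_mono)
  next
    fix a assume "(\<integral>\<omega>. \<phi> (hl \<omega>) \<partial>N) < a"
    then show "\<forall>\<^sub>F n in sequentially. (\<integral>\<omega>. \<phi> (h n \<omega>) \<partial>M) < a"
      using 1[of "a - (\<integral>\<omega>. \<phi> (hl \<omega>) \<partial>N)" "1"] by (auto elim!: eventually_mono)
  qed
qed

section \<open>The positive definite square root\<close>

lemma symmetric_matrix_inner:
  fixes A :: "real^'n^'n"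
  assumes "transpose A = A"
  shows "(A *v x) \<bullet> y = x \<bullet> (A *v y)"
  by (metis assms dot_lmul_matrix transpose_matrix_vector)

lemma trace_conv_inner_axis: "trace (A :: real^'n^'n) = (\<Sum>i\<in>UNIV. axis i 1 \<bullet> (A *v axis i 1))"
  by (simp add: trace_def inner_axis' matrix_vector_mult_basis column_def)

lemma pos_def_nonneg: "pos_def A \<Longrightarrow> 0 \<le> x \<bullet> (A *v x)"
  by (cases "x = 0") (auto simp: pos_def_def less_imp_le)

text \<open>
  With \<open>D = S - T\<close> one has \<open>S D + D T = 0\<close>, so \<open>tr (D S D) + tr (D T D) = 0\<close>, and both traces
  are sums of nonnegative values of quadratic forms.
\<close>

lemma pos_def_sqrt_unique:
  fixes S T :: "real^'n^'n"
  assumes S: "pos_def S" and T: "pos_def T" and eq: "S ** S = T ** T"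
  shows "S = T"
proof -
  define D where "D = S - T"
  have sD: "transpose D = D"
    using S T by (simp add: D_def pos_def_def transpose_def vec_eq_iff)
  have "S ** D + D ** T = 0"
    using eq by (simp add: D_def matrix_matrix_mult_def vec_eq_iff left_diff_distrib right_diff_distrib sum_subtractf)
  then have "D ** (S ** D) + D ** (D ** T) = 0"
    by (metis matrix_add_ldistrib times0_right)
  then have "trace (D ** (S ** D)) + trace (D ** (T ** D)) = 0"
    using trace_mul_sym[of D "D ** T"] trace_add[of "D ** (S ** D)" "D ** (D ** T)"]
    by (simp add: matrix_mul_assoc) (simp add: trace_def)
  moreover have "trace (D ** (R ** D)) = (\<Sum>i\<in>UNIV. (D *v axis i 1) \<bullet> (R *v (D *v axis i 1)))" for R :: "real^'n^'n"
    by (simp add: trace_conv_inner_axis symmetric_matrix_inner[OF sD] flip: matrix_vector_mul_assoc)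
  ultimately have "(\<Sum>i\<in>UNIV. (D *v axis i 1) \<bullet> (S *v (D *v axis i 1)) + (D *v axis i 1) \<bullet> (T *v (D *v axis i 1))) = 0"
    by (simp add: sum.distrib)
  then have 0: "(D *v axis i 1) \<bullet> (S *v (D *v axis i 1)) + (D *v axis i 1) \<bullet> (T *v (D *v axis i 1)) = 0" for i
    by (subst (asm) sum_nonneg_eq_0_iff) (auto intro!: add_nonneg_nonneg pos_def_nonneg S T)
  have "D *v axis i 1 = 0" for i
  proof (rule ccontr)
    assume "D *v axis i 1 \<noteq> 0"
    then have "0 < (D *v axis i 1) \<bullet> (S *v (D *v axis i 1))"
      using S by (simp add: pos_def_def)
    then show False using 0[of i] pos_def_nonneg[OF T, of "D *v axis i 1"] by linarith
  qed
  then have "D = 0"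
    by (simp add: matrix_vector_mult_basis column_def vec_eq_iff)
  then show ?thesis by (simp add: D_def)
qed

lemma pos_def_coercive:
  fixes A :: "real^'n^'n"
  assumes "pos_def A"
  obtains m where "m > 0" "\<And>x. m * (norm x)\<^sup>2 \<le> x \<bullet> (A *v x)"
proof -
  have "sphere 0 1 \<noteq> ({} :: (real^'n) set)" 
    using norm_axis_1 by (metis empty_iff mem_sphere_0)
  moreover have "continuous_on (sphere 0 1) (\<lambda>x. x \<bullet> (A *v x))"
    by (intro continuous_intros linear_continuous_on matrix_vector_mul_bounded_linear)
  ultimately obtain x0 where x0: "x0 \<in> sphere 0 1" "\<And>x. x \<in> sphere 0 1 \<Longrightarrow> x0 \<bullet> (A *v x0) \<le> x \<bullet> (A *v x)"
    using continuous_attains_inf[OF compact_sphere[of "0 :: real^'n" 1]] by metis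
  show thesis
  proof
    show "x0 \<bullet> (A *v x0) > 0" using assms x0(1) by (auto simp: pos_def_def dest!: spec[of _ x0])
    show "(x0 \<bullet> (A *v x0)) * (norm x)\<^sup>2 \<le> x \<bullet> (A *v x)" for x
    proof (cases "x = 0")
      case False
      have "x0 \<bullet> (A *v x0) \<le> sgn x \<bullet> (A *v sgn x)"
        using False by (intro x0(2)) (simp add: norm_sgn)
      also have "\<dots> = (x \<bullet> (A *v x)) / (norm x)\<^sup>2"
        by (simp add: sgn_div_norm matrix_vector_mult_scaleR power2_eq_square divide_simps)
      finally show ?thesis using False by (simp add: pos_le_divide_eq)
    qed simp
  qed
qed

text \<open>
  After scaling, \<open>A = I - E\<close> with a symmetric \<open>E\<close> of operator norm less than 1, and \<open>I - Y\<close> is a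
  square root of \<open>A\<close> iff \<open>Y\<close> is a fixed point of the contraction \<open>Y \<mapsto> (E + Y\<^sup>2) / 2\<close>.
\<close>

lemma pos_def_sqrt_exists:
  fixes A :: "real^'n^'n"
  assumes A: "pos_def A"
  shows "\<exists>S. pos_def S \<and> S ** S = A"
proof -
  obtain m where m: "m > 0" "\<And>x. m * (norm x)\<^sup>2 \<le> x \<bullet> (A *v x)"
    using pos_def_coercive[OF A] by metis
  obtain L where L: "L > 0" "\<And>x. norm (A *v x) \<le> norm x * L"
    using bounded_linear.pos_bounded[OF matrix_vector_mul_bounded_linear[of A]] by metis
  \<comment> \<open>This value minimises the bound
    \<open>1 - 2 * c * m + c\<^sup>2 * L\<^sup>2\<close> for the squared norm of
    \<open>I - c A\<close>. The minimum is \<open>r\<^sup>2\<close>; the \<open>max 0\<close> in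
    \<open>r\<close> saves a comparison of \<open>m\<close> with \<open>L\<close>.\<close>
  define c where "c = m / L\<^sup>2"
  define r where "r = sqrt (max 0 (1 - m\<^sup>2 / L\<^sup>2))"
  have c0: "c > 0" using m L by (simp add: c_def)
  have r: "0 \<le> r" "r < 1" using m L by (auto simp: r_def)
  have lin: "bounded_linear (\<lambda>x. x - c *\<^sub>R (A *v x))"
    by (intro bounded_linear_sub bounded_linear_ident bounded_linear_scaleR_right[THEN bounded_linear_compose]
      matrix_vector_mul_bounded_linear)
  define E where "E = Blinfun (\<lambda>x. x - c *\<^sub>R (A *v x))"
  have E: "blinfun_apply E x = x - c *\<^sub>R (A *v x)" for x
    by (simp add: E_def bounded_linear_Blinfun_apply[OF lin])
  have symA: "(A *v x) \<bullet> y = x \<bullet> (A *v y)" for x y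
    using A by (simp add: symmetric_matrix_inner pos_def_def)
  have E_norm: "norm E \<le> r"
  proof (rule norm_blinfun_bound[OF r(1)])
    fix x
    have "(norm (blinfun_apply E x))\<^sup>2 = (norm x)\<^sup>2 - 2 * c * (x \<bullet> (A *v x)) + c\<^sup>2 * (norm (A *v x))\<^sup>2"
      unfolding E power2_norm_eq_inner
      by (simp add: inner_diff_left inner_diff_right inner_commute power2_eq_square algebra_simps)
    also have "\<dots> \<le> (norm x)\<^sup>2 - 2 * c * (m * (norm x)\<^sup>2) + c\<^sup>2 * (norm x * L)\<^sup>2"
      using c0 m L(2)[of x] by (intro add_mono diff_mono mult_left_mono power_mono) auto
    also have "\<dots> = (1 - m\<^sup>2 / L\<^sup>2) * (norm x)\<^sup>2"
      using L(1) by (simp add: c_def power2_eq_square field_simps)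
    also have "\<dots> \<le> (r * norm x)\<^sup>2"
      unfolding power_mult_distrib r_def by (intro mult_right_mono) auto
    finally show "norm (blinfun_apply E x) \<le> r * norm x"
      by (rule power2_le_imp_le) (simp add: r(1))
  qed
  \<comment> \<open>Symmetry is part of the closed set, so the fixed point inherits it. The radius
    \<open>r < 1\<close> later makes \<open>I - Y\<close> positive definite and also bounds the
    contraction factor by \<open>(r + r) / 2\<close>.\<close>
  define \<S> where "\<S> = {Y :: (real^'n) \<Rightarrow>\<^sub>L (real^'n). norm Y \<le> r \<and> (\<forall>x y. blinfun_apply Y x \<bullet> y = x \<bullet> blinfun_apply Y y)}"
  define F where "F Y = (1/2) *\<^sub>R (E + (Y o\<^sub>L Y))" for Y :: "(real^'n) \<Rightarrow>\<^sub>L (real^'n)"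
  have "closed \<S>"
    unfolding \<S>_def by (intro closed_Collect_conj closed_Collect_all closed_Collect_le closed_Collect_eq continuous_intros)
  then have complete: "Topological_Spaces.complete \<S>" by (simp add: complete_eq_closed)
  have "0 \<in> \<S>" using r by (simp add: \<S>_def)
  then have ne: "\<S> \<noteq> {}" by blast
  have maps: "F ` \<S> \<subseteq> \<S>"
  proof (rule image_subsetI)
    fix Y assume Y: "Y \<in> \<S>"
    have "norm (F Y) \<le> (1/2) * (norm E + norm Y * norm Y)"
      using norm_triangle_ineq[of E "Y o\<^sub>L Y"] norm_blinfun_compose[of Y Y] by (simp add: F_def)
    also have "\<dots> \<le> (1/2) * (r + 1 * r)"
      using Y r E_norm by (intro mult_left_mono add_mono mult_mono) (auto simp: \<S>_def)
    finally have "norm (F Y) \<le> r" by simp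
    moreover have "blinfun_apply (F Y) x \<bullet> y = x \<bullet> blinfun_apply (F Y) y" for x y
      using Y by (simp add: F_def \<S>_def E blinfun.add_left blinfun.scaleR_left inner_add_left inner_add_right
          inner_diff_left inner_diff_right symA)
    ultimately show "F Y \<in> \<S>" by (simp add: \<S>_def)
  qed
  have lip: "dist (F Y) (F Z) \<le> r * dist Y Z" if "Y \<in> \<S>" "Z \<in> \<S>" for Y Z
  proof -
    \<comment> \<open>\<open>Y\<close> and \<open>Z\<close> need not commute, hence this splitting
      instead of a product of sum and difference.\<close>
    have "(Y o\<^sub>L Y) - (Z o\<^sub>L Z) = (Y o\<^sub>L (Y - Z)) + ((Y - Z) o\<^sub>L Z)"
      by (rule blinfun_eqI) (simp add: blinfun.diff_left blinfun.diff_right blinfun.add_left)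
    then have "norm ((Y o\<^sub>L Y) - (Z o\<^sub>L Z)) \<le> norm Y * norm (Y - Z) + norm (Y - Z) * norm Z"
      by (simp only:) (intro norm_triangle_le add_mono norm_blinfun_compose)
    also have "\<dots> \<le> r * norm (Y - Z) + norm (Y - Z) * r"
      using that by (intro add_mono mult_mono) (auto simp: \<S>_def r)
    finally show ?thesis
      by (simp add: dist_norm F_def flip: scaleR_diff_right)
  qed
  obtain Y where Y: "Y \<in> \<S>" "F Y = Y"
    using Banach_fix[OF complete ne r maps lip] by blast
  have FY: "2 *\<^sub>R blinfun_apply Y x = blinfun_apply E x + blinfun_apply Y (blinfun_apply Y x)" for x
  proof -
    have "2 *\<^sub>R Y = E + (Y o\<^sub>L Y)" using arg_cong[OF Y(2), of "scaleR 2"] by (simp add: F_def)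
    then have "blinfun_apply (2 *\<^sub>R Y) x = blinfun_apply (E + (Y o\<^sub>L Y)) x" by simp
    then show ?thesis by (simp add: blinfun.scaleR_left blinfun.add_left)
  qed
  define R where "R x = (1 / sqrt c) *\<^sub>R (x - blinfun_apply Y x)" for x
  have "bounded_linear R"
    unfolding R_def
    by (intro bounded_linear_sub bounded_linear_ident bounded_linear_scaleR_right[THEN bounded_linear_compose]
      blinfun.bounded_linear_right)
  then have "linear R" by (rule bounded_linear.linear)
  then have R: "matrix R *v x = R x" for x by (simp add: matrix_works)
  have RR: "R (R x) = A *v x" for x
  proof -
    have "c *\<^sub>R R (R x) = x - blinfun_apply Y x - blinfun_apply Y (x - blinfun_apply Y x)"
      using c0 by (simp add: R_def blinfun.scaleR_right scaleR_diff_right[symmetric])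
    also have "\<dots> = x - 2 *\<^sub>R blinfun_apply Y x + blinfun_apply Y (blinfun_apply Y x)"
      by (simp add: blinfun.diff_right scaleR_2)
    also have "\<dots> = c *\<^sub>R (A *v x)" by (simp add: FY E)
    finally show ?thesis using c0 by simp
  qed
  have "matrix R ** matrix R = A"
    by (subst matrix_eq) (simp add: R RR flip: matrix_vector_mul_assoc)
  moreover have "pos_def (matrix R)"
    unfolding pos_def_def
  proof (intro conjI allI impI)
    have "R x \<bullet> y = x \<bullet> R y" for x y
      using Y(1) by (simp add: R_def \<S>_def inner_diff_left inner_diff_right)
    then have "adjoint R = R" by (intro adjoint_unique) auto
    then show "transpose (matrix R) = matrix R"
      using matrix_adjoint[OF \<open>linear R\<close>] by simp
    fix x :: "real^'n" assume "x \<noteq> 0"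
    have "x \<bullet> blinfun_apply Y x \<le> norm x * (norm Y * norm x)"
      by (rule order_trans[OF norm_cauchy_schwarz mult_left_mono[OF norm_blinfun norm_ge_zero]])
    also have "\<dots> \<le> norm x * (r * norm x)"
      using Y(1) by (intro mult_left_mono mult_right_mono) (auto simp: \<S>_def)
    also have "\<dots> = r * (x \<bullet> x)" by (simp add: power2_eq_square flip: power2_norm_eq_inner)
    also have "\<dots> < 1 * (x \<bullet> x)" using r \<open>x \<noteq> 0\<close> by (intro mult_strict_right_mono) auto
    finally show "0 < x \<bullet> (matrix R *v x)"
      using c0 by (simp add: R R_def inner_diff_right)
  qed
  ultimately show ?thesis by blast
qed

lemma
  fixes A :: "real^'n^'n"
  assumes "pos_def A"
  shows pos_def_mat_sqrt: "pos_def (mat_sqrt A)" and mat_sqrt_mult_self: "mat_sqrt A ** mat_sqrt A = A"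
proof -
  have "\<exists>!S. pos_def S \<and> S ** S = A"
    using pos_def_sqrt_exists[OF assms] pos_def_sqrt_unique by metis
  from theI'[OF this] show "pos_def (mat_sqrt A)" "mat_sqrt A ** mat_sqrt A = A"
    by (simp_all add: mat_sqrt_def)
qed

section \<open>Brownian motion visits every orthant\<close>

text \<open>The probability that a centred Gaussian exceeds its own standard deviation. It is
  independent of the scale, so the success probability of the trials below is the same at all
  times.\<close>

definition normal_tail :: real where
  "normal_tail = measure (density lborel (\<lambda>x. ennreal (std_normal_density x))) {1<..}"

lemma normal_tail_pos: "0 < normal_tail" and normal_tail_le_1: "normal_tail \<le> 1"
proof -
  interpret prob_space "density lborel (\<lambda>x. ennreal (std_normal_density x))"
    by (rule prob_space_normal_density) simp
  show "normal_tail \<le> 1" unfolding normal_tail_def by (rule prob_le_1)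
  have "emeasure (density lborel (\<lambda>x. ennreal (std_normal_density x))) {1<..} \<noteq> 0"
  proof
    assume "emeasure (density lborel (\<lambda>x. ennreal (std_normal_density x))) {1<..} = 0"
    then have "AE x in lborel. ennreal (std_normal_density x) * indicator {1<..} x = 0"
      by (subst (asm) emeasure_density) (auto simp: nn_integral_0_iff_AE)
    then have "AE x in lborel. x \<notin> {1::real<..}"
      by eventually_elim
        (use normal_density_pos[of 1 0] in \<open>auto simp: indicator_def not_le less_imp_neq[symmetric] split: if_splits\<close>)
    then have "emeasure lborel {1::real<..} = 0" by (subst (asm) AE_iff_measurable) auto
    then have "emeasure lborel {1<..<2::real} = 0"
      using emeasure_mono[of "{1<..<2::real}" "{1<..}" lborel] greaterThanLessThan_eq[of 1 "2::real"] by simp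
    then show False by simp
  qed
  then show "0 < normal_tail" unfolding normal_tail_def
    by (simp add: emeasure_eq_measure zero_less_measure_iff)
qed

context prob_space begin

lemma prob_normal_tail:
  assumes X: "distributed M lborel X (normal_density 0 s)" and s: "0 < s" and \<sigma>: "\<bar>\<sigma>\<bar> = 1"
  shows "prob {\<omega>\<in>space M. s < \<sigma> * X \<omega>} = normal_tail"
proof -
  have "distributed M lborel (\<lambda>\<omega>. 0 + (\<sigma> / s) * X \<omega>) (normal_density (0 + (\<sigma> / s) * 0) (\<bar>\<sigma> / s\<bar> * s))"
    using s \<sigma> by (intro normal_density_affine[OF X]) auto
  then have D: "distributed M lborel (\<lambda>\<omega>. (\<sigma> / s) * X \<omega>) (\<lambda>x. ennreal (std_normal_density x))"
    using s \<sigma> by simp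
  have "{\<omega>\<in>space M. s < \<sigma> * X \<omega>} = (\<lambda>\<omega>. (\<sigma> / s) * X \<omega>) -` {1<..} \<inter> space M"
    using s by (auto simp: field_simps)
  also have "prob \<dots> = measure (distr M lborel (\<lambda>\<omega>. (\<sigma> / s) * X \<omega>)) {1<..}"
    by (rule measure_distr[symmetric]) (use D in \<open>auto simp: distributed_def\<close>)
  finally show ?thesis unfolding normal_tail_def distributed_distr_eq_density[OF D] .
qed

lemma prob_normal_ge:
  assumes X: "distributed M lborel X (normal_density 0 s)" and s: "0 < s" and a: "0 < a"
  shows "prob {\<omega>\<in>space M. a \<le> \<bar>X \<omega>\<bar>} \<le> s\<^sup>2 / a\<^sup>2"
proof -
  have E: "expectation X = 0"
    by (rule normal_distributed_expectation[OF s X])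
  have V: "expectation (\<lambda>\<omega>. (X \<omega>)\<^sup>2) = s\<^sup>2"
    using normal_distributed_variance[OF s X] by (simp add: E)
  have "integrable M (\<lambda>\<omega>. (X \<omega>)\<^sup>2)"
    using V s not_integrable_integral_eq by force
  moreover have "random_variable borel X" using X by (auto simp: distributed_def)
  ultimately show ?thesis using Chebyshev_inequality[of X a] a by (simp add: E) (simp add: V)
qed

text \<open>Independence passes from single events to the sigma-algebras they generate, and these
  contain the complements. The factor \<open>space M\<close> gives the empty index set its correct
  probability 1.\<close>

lemma prob_INT_compl_indep_events:
  assumes ind: "indep_events F I" and J: "J \<subseteq> I" "finite J"
  shows "prob (space M \<inter> (\<Inter>j\<in>J. space M - F j)) = (\<Prod>j\<in>J. 1 - prob (F j))"
proof (cases "J = {}")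
  case False
  have ev: "F j \<in> events" if "j \<in> J" for j
    using ind J that by (auto simp: indep_events_def)
  have "indep_sets (\<lambda>i. sigma_sets (space M) {F i}) I"
    using ind unfolding indep_events_def_alt by (rule indep_sets_sigma) (simp add: Int_stable_def)
  then have "prob (\<Inter>j\<in>J. space M - F j) = (\<Prod>j\<in>J. prob (space M - F j))"
    using J False by (intro indep_setsD) (auto intro: sigma_sets.Compl sigma_sets.Basic)
  also have "\<dots> = (\<Prod>j\<in>J. 1 - prob (F j))"
    by (intro prod.cong refl prob_compl ev)
  also have "(\<Inter>j\<in>J. space M - F j) = space M \<inter> (\<Inter>j\<in>J. space M - F j)"
    using False by auto
  finally show ?thesis .
qed (simp add: prob_space)

end

text \<open>
  Along a rapidly decreasing sequence of times the increments dominate the earlier values of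
  the path, and they are independent; hence every orthant is visited arbitrarily early.
\<close>

lemma standard_bm_vector_visits_orthant:
  fixes B :: "real \<Rightarrow> 'b \<Rightarrow> real^'d" and \<sigma> :: "'d \<Rightarrow> real"
  assumes N: "prob_space N" and B: "standard_bm_vector N B"
    and c: "0 < c" "c \<le> 1" and \<sigma>: "\<And>k. \<bar>\<sigma> k\<bar> = 1"
  shows "AE \<omega> in N. \<exists>t\<in>{0<..<c}. \<forall>k. 0 < \<sigma> k * (B t \<omega> $ k)"
proof -
  interpret prob_space N by fact
  \<comment> \<open>The path starts at 0 only almost surely. Subtracting the initial value makes
    \<open>W t\<close> an increment, with a known Gaussian law; the null set is removed at the very
    end.\<close>
  define W where "W t k \<omega> = B t \<omega> $ k - B 0 \<omega> $ k" for t k \<omega>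
  have bm: "standard_bm N (\<lambda>t \<omega>. B t \<omega> $ k)" for k
    using B by (simp add: standard_bm_vector_def)
  have incr: "distributed N lborel (\<lambda>\<omega>. B t \<omega> $ k - B s \<omega> $ k) (normal_density 0 (sqrt (t - s)))"
    if "0 \<le> s" "s < t" "t \<le> 1" for s t k
    using bm[of k] that by (auto simp: standard_bm_def)
  have Bm: "(\<lambda>\<omega>. B t \<omega> $ k) \<in> borel_measurable N" if "0 \<le> t" "t \<le> 1" for t k
    using bm[of k] that by (auto simp: standard_bm_def)
  define u where "u i = c * (1/2) ^ Suc i" for i
  have u: "0 < u i" "u i < c" "u i \<le> 1" for i
  proof -
    show "0 < u i" using c by (simp add: u_def)
    have "(1/2::real) ^ Suc i < 1" by (rule power_Suc_less_one) auto
    then show "u i < c" using c by (simp add: u_def)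
    then show "u i \<le> 1" using c by simp
  qed
  have Wm [measurable]: "W (u i) k \<in> borel_measurable N" for i k
    unfolding W_def using u[of i] by (intro borel_measurable_diff Bm) (auto simp: less_imp_le)
  define E where "E = {\<omega>\<in>space N. \<exists>i. \<forall>k. 0 < \<sigma> k * W (u i) k \<omega>}"
  have E [measurable]: "E \<in> events" unfolding E_def by measurable
  define p where "p = normal_tail ^ CARD('d)"
  have p: "0 < p" "p \<le> 1"
    using normal_tail_pos normal_tail_le_1 by (auto simp: p_def power_le_one)
  \<comment> \<open>There are \<open>m\<close> independent trials, at times whose consecutive ratio
    is \<open>2 ^ l\<close>. Trial \<open>j\<close> succeeds when every signed increment exceeds its
    standard deviation \<open>s j\<close>. Success puts the path into the orthant unless some
    coordinate already had modulus at least \<open>s j\<close> before. By Chebyshev this has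
    probability at most \<open>\<tau> j / (\<tau> (Suc j) - \<tau> j) = 1 / (2 ^ l - 1)\<close> for
    each coordinate.\<close>
  have bound: "prob (space N - E) \<le> (1 - p) ^ m + real m * real CARD('d) * (1 / (2 ^ l - 1))"
    if l: "l \<ge> 1" for m l
  proof -
    \<comment> \<open>The indices run backwards because \<open>u\<close> decreases, whereas
      independence of increments is stated for increasing times. From \<open>j = m\<close> on the
      subtraction truncates and the times are constant, hence the guards
      \<open>j < m\<close>.\<close>
    define ix where "ix j = l * (m - j)" for j
    define \<tau> where "\<tau> j = u (ix j)" for j
    have \<tau>_Suc: "\<tau> (Suc j) = 2 ^ l * \<tau> j" if "j < m" for j
    proof -
      have "ix j = l + ix (Suc j)"
        using that by (simp add: ix_def Suc_diff_Suc flip: mult_Suc_right)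
      then show ?thesis by (simp add: \<tau>_def u_def power_add power_divide)
    qed
    have two: "(2::real) ^ l > 1" using l by (simp add: one_less_power)
    have \<tau>_less: "\<tau> j < \<tau> (Suc j)" if "j < m" for j
      using \<tau>_Suc[OF that] two u(1)[of "ix j"] by (simp add: \<tau>_def)
    have \<tau>: "0 \<le> \<tau> j" "\<tau> j \<le> 1" for j using u[of "ix j"] by (auto simp: \<tau>_def)
    define s where "s j = sqrt (\<tau> (Suc j) - \<tau> j)" for j
    have s: "0 < s j" if "j < m" for j using \<tau>_less[OF that] by (simp add: s_def)
    define A where "A j k = {\<omega>\<in>space N. s j < \<sigma> k * (B (\<tau> (Suc j)) \<omega> $ k - B (\<tau> j) \<omega> $ k)}" for j k
    define F where "F j = (\<Inter>k. A j k)" for j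
    define G where "G j k = {\<omega>\<in>space N. s j \<le> \<bar>W (\<tau> j) k \<omega>\<bar>}" for j k
    have A_ev: "A j k \<in> events" for j k
      unfolding A_def using \<tau> Bm by measurable
    have prob_A: "prob (A j k) = normal_tail" if "j < m" for j k
      unfolding A_def using that \<tau> \<tau>_less s \<sigma>
      by (intro prob_normal_tail) (auto simp: s_def intro!: incr)
    have G_ev: "G j k \<in> events" for j k
      unfolding G_def \<tau>_def by measurable
    have prob_G: "prob (G j k) \<le> 1 / (2 ^ l - 1)" if "j < m" for j k
    proof -
      have "distributed N lborel (W (\<tau> j) k) (normal_density 0 (sqrt (\<tau> j - 0)))"
        unfolding W_def using u[of "ix j"] by (intro incr) (auto simp: \<tau>_def)
      then have "prob (G j k) \<le> (sqrt (\<tau> j - 0))\<^sup>2 / (s j)\<^sup>2"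
        unfolding G_def using u(1)[of "ix j"] s[OF that] by (intro prob_normal_ge) (auto simp: \<tau>_def)
      also have "\<dots> = \<tau> j / (\<tau> (Suc j) - \<tau> j)"
        using \<tau>[of j] \<tau>_less[OF that] by (simp add: s_def)
      also have "\<dots> = 1 / (2 ^ l - 1)"
        using u(1)[of "ix j"] two unfolding \<tau>_Suc[OF that] by (simp add: \<tau>_def field_simps)
      finally show ?thesis .
    qed
    have prob_F: "prob (\<Inter>j\<in>J. F j) = p ^ card J" if J: "J \<subseteq> {..<m}" "J \<noteq> {}" "finite J" for J
    proof -
      have comp [measurable]: "(\<lambda>x. x (\<tau> j)) \<in> borel_measurable (Pi\<^sub>M {0..1} (\<lambda>_. borel :: real measure))" for j
        using \<tau>[of j] by (intro measurable_component_singleton) simp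
      \<comment> \<open>All events of coordinate \<open>k\<close> are collected into one set of
        paths, so that independence of the coordinate processes applies first and independence of
        the increments within a coordinate second.\<close>
      define P where "P k = {x \<in> space (Pi\<^sub>M {0..1} (\<lambda>_. borel :: real measure)).
          \<forall>j\<in>J. s j < \<sigma> k * (x (\<tau> (Suc j)) - x (\<tau> j))}" for k
      have P: "P k \<in> sets (Pi\<^sub>M {0..1} (\<lambda>_. borel))" for k
        unfolding P_def using J(3) by measurable
      have vim: "(\<lambda>\<omega>. \<lambda>t\<in>{0..1}. B t \<omega> $ k) -` P k \<inter> space N = (\<Inter>j\<in>J. A j k)" for k
        using J \<tau> by (auto simp: P_def A_def space_PiM)
      have "(\<Inter>j\<in>J. F j) = (\<Inter>k. (\<lambda>\<omega>. \<lambda>t\<in>{0..1}. B t \<omega> $ k) -` P k \<inter> space N)"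
        unfolding vim F_def by auto
      also have "prob \<dots> = (\<Prod>k\<in>UNIV. prob ((\<lambda>\<omega>. \<lambda>t\<in>{0..1}. B t \<omega> $ k) -` P k \<inter> space N))"
        using B P unfolding standard_bm_vector_def by (intro indep_varsD) auto
      also have "\<dots> = (\<Prod>k\<in>(UNIV::'d set). \<Prod>j\<in>J. prob (A j k))"
      proof (rule prod.cong[OF refl], unfold vim)
        fix k :: 'd
        have ind: "indep_vars (\<lambda>_. borel) (\<lambda>j \<omega>. B (\<tau> (Suc j)) \<omega> $ k - B (\<tau> j) \<omega> $ k) {..<m}"
          using bm[of k] \<tau> \<tau>_less unfolding standard_bm_def by (auto simp: less_imp_le)
        have A': "A j k = (\<lambda>\<omega>. B (\<tau> (Suc j)) \<omega> $ k - B (\<tau> j) \<omega> $ k) -` {x. s j < \<sigma> k * x} \<inter> space N" for j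
          by (auto simp: A_def)
        show "prob (\<Inter>j\<in>J. A j k) = (\<Prod>j\<in>J. prob (A j k))"
          unfolding A' by (rule indep_varsD[OF ind]) (use J in auto)
      qed
      also have "\<dots> = (\<Prod>k\<in>(UNIV::'d set). \<Prod>j\<in>J. normal_tail)"
        using J prob_A by (intro prod.cong refl) auto
      also have "\<dots> = p ^ card J" by (simp add: p_def mult.commute flip: power_mult)
      finally show ?thesis .
    qed
    have F_ev: "F j \<in> events" for j using A_ev by (auto simp: F_def)
    have prob_F1: "prob (F j) = p" if "j < m" for j using prob_F[of "{j}"] that by simp
    have "indep_events F {..<m}"
      unfolding indep_events_def
    proof (intro conjI allI impI)
      fix J assume "J \<subseteq> {..<m}" "J \<noteq> {}" "finite J"
      moreover from this have "(\<Prod>j\<in>J. prob (F j)) = (\<Prod>j\<in>J. p)"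
        using prob_F1 by (intro prod.cong) auto
      ultimately show "prob (\<Inter>j\<in>J. F j) = (\<Prod>j\<in>J. prob (F j))" by (simp add: prob_F)
    qed (use F_ev in auto)
    from prob_INT_compl_indep_events[OF this, of "{..<m}"]
    have compl: "prob (space N \<inter> (\<Inter>j\<in>{..<m}. space N - F j)) = (1 - p) ^ m" 
      using prob_F1 by simp
    have compl_ev: "space N \<inter> (\<Inter>j\<in>{..<m}. space N - F j) \<in> events"
      using F_ev by (cases "m = 0") (auto intro!: sets.Int sets.finite_INT simp del: INT_simps)
    have "space N - E \<subseteq> (space N \<inter> (\<Inter>j\<in>{..<m}. space N - F j)) \<union> (\<Union>j\<in>{..<m}. \<Union>k. G j k)"
    proof (rule subsetI, rule ccontr)
      fix \<omega> assume \<omega>: "\<omega> \<in> space N - E"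
        and "\<omega> \<notin> (space N \<inter> (\<Inter>j\<in>{..<m}. space N - F j)) \<union> (\<Union>j\<in>{..<m}. \<Union>k. G j k)"
      then obtain j where j: "j < m" "\<omega> \<in> F j" "\<And>k. \<omega> \<notin> G j k"
        by (auto simp del: INT_simps)
      have "0 < \<sigma> k * W (\<tau> (Suc j)) k \<omega>" for k
      proof -
        have 1: "s j < \<sigma> k * (B (\<tau> (Suc j)) \<omega> $ k - B (\<tau> j) \<omega> $ k)" using j(2) by (simp add: F_def A_def)
        have "\<bar>\<sigma> k * W (\<tau> j) k \<omega>\<bar> < s j" using j(3)[of k] \<omega> \<sigma>[of k] by (simp add: G_def abs_mult)
        with 1 show ?thesis by (simp add: W_def algebra_simps)
      qed
      then show False using \<omega> by (auto simp: E_def \<tau>_def)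
    qed
    then have "prob (space N - E) \<le> prob ((space N \<inter> (\<Inter>j\<in>{..<m}. space N - F j)) \<union> (\<Union>j\<in>{..<m}. \<Union>k. G j k))"
      by (rule finite_measure_mono) (use compl_ev G_ev in auto)
    also have "\<dots> \<le> prob (space N \<inter> (\<Inter>j\<in>{..<m}. space N - F j)) + prob (\<Union>j\<in>{..<m}. \<Union>k. G j k)"
      by (rule measure_Un_le[OF compl_ev]) (use G_ev in auto)
    also have "prob (\<Union>j\<in>{..<m}. \<Union>k. G j k) \<le> (\<Sum>j<m. prob (\<Union>k. G j k))"
      using G_ev by (intro finite_measure_subadditive_finite) auto
    also have "\<dots> \<le> (\<Sum>j<m. \<Sum>k\<in>UNIV. prob (G j k))"
      using G_ev by (intro sum_mono finite_measure_subadditive_finite) auto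
    also have "\<dots> \<le> (\<Sum>j<m. \<Sum>k\<in>(UNIV::'d set). 1 / (2 ^ l - 1))"
      using prob_G by (intro sum_mono) auto
    also have "\<dots> = real m * real CARD('d) * (1 / (2 ^ l - 1))" by simp
    finally show ?thesis unfolding compl by simp
  qed
  have "prob (space N - E) \<le> 0"
  proof (rule field_le_epsilon)
    fix e :: real assume e: "e > 0"
    \<comment> \<open>The number \<open>m\<close> of trials is fixed first; the time ratio given by
      \<open>l\<close> is then taken large in terms of \<open>m\<close>.\<close>
    have "(\<lambda>m. (1 - p) ^ m) \<longlonglongrightarrow> 0" using p by (intro LIMSEQ_power_zero) auto
    from order_tendstoD(2)[OF this, of "e / 2"] e obtain m where m: "(1 - p) ^ m < e / 2"
      by (auto simp: eventually_sequentially)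
    have "(\<lambda>l. real m * real CARD('d) * (1 / (2 ^ l - 1))) \<longlonglongrightarrow> 0" by real_asymp
    from order_tendstoD(2)[OF this, of "e / 2"] e have "\<forall>\<^sub>F l in sequentially. real m * real CARD('d) * (1 / (2 ^ l - 1)) < e / 2"
      by simp
    from eventually_conj[OF this eventually_ge_at_top[of 1]]
    obtain l where l: "real m * real CARD('d) * (1 / (2 ^ l - 1)) < e / 2" "l \<ge> 1"
      by (auto simp: eventually_sequentially)
    show "prob (space N - E) \<le> 0 + e" using bound[OF l(2), of m] m l(1) by linarith
  qed
  then have "prob E = 1" using prob_compl[OF E] measure_nonneg[of N "space N - E"] by linarith
  then have "AE \<omega> in N. \<omega> \<in> E" using E prob_eq_1 by blast
  moreover have "AE \<omega> in N. \<forall>k. B 0 \<omega> $ k = 0"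
    using bm by (simp add: AE_all_countable standard_bm_def)
  ultimately show ?thesis
  proof eventually_elim
    case (elim \<omega>)
    then show ?case using u by (auto simp: E_def W_def)
  qed
qed

section \<open>The limit objective\<close>

lemma measurable_elog [measurable]: "elog \<in> borel_measurable borel"
  unfolding elog_def[abs_def] by measurable

lemma elog_pos: "0 < x \<Longrightarrow> elog x = ereal (ln x)"
  by (simp add: elog_def)

lemma tendsto_elog_add:
  assumes "0 \<le> x"
  shows "(\<lambda>n. ereal (ln (x + inverse (real (Suc n))))) \<longlonglongrightarrow> elog x"
proof (cases "x = 0")
  case True
  have "filterlim (\<lambda>n. ln (inverse (real (Suc n)))) at_bot sequentially"
    by (rule filterlim_compose[OF ln_at_0])
       (auto intro!: filterlim_atI LIMSEQ_inverse_real_of_nat simp: at_within_def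
         filterlim_inf filterlim_principal eventually_sequentially simp del: of_nat_Suc)
  then show ?thesis
    using True by (simp add: elog_def ereal_tendsto_simps(2)[symmetric] tendsto_MInfty filterlim_at_bot_dense del: of_nat_Suc)
next
  case False
  then have "(\<lambda>n. ln (x + inverse (real (Suc n)))) \<longlonglongrightarrow> ln (x + 0)"
    using assms by (intro tendsto_intros LIMSEQ_inverse_real_of_nat) auto
  then show ?thesis using False assms by (simp add: elog_pos del: of_nat_Suc)
qed

text \<open>Monotone convergence for the negative part, dominated convergence for the positive part.\<close>

lemma log_integral_limit:
  fixes u :: "real \<Rightarrow> real"
  assumes u: "continuous_on {0..1} u" "\<And>t. t \<in> {0..1} \<Longrightarrow> 0 \<le> u t"
  shows "(\<lambda>n. ereal (- integral {0..1} (\<lambda>t. ln (u t + inverse (real (Suc n)))))) \<longlonglongrightarrow>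
    enn2ereal (\<integral>\<^sup>+t\<in>{0..1}. e2ennreal (- elog (u t)) \<partial>lborel) -
    enn2ereal (\<integral>\<^sup>+t\<in>{0..1}. e2ennreal (elog (u t)) \<partial>lborel)"
proof -
  define \<eta> where "\<eta> n = inverse (real (Suc n))" for n
  have \<eta>: "0 < \<eta> n" "\<eta> n \<le> 1" for n by (auto simp: \<eta>_def divide_simps)
  have \<eta>_mono: "m \<le> n \<Longrightarrow> \<eta> n \<le> \<eta> m" for m n by (simp add: \<eta>_def)
  obtain C where C: "\<And>t. t \<in> {0..1} \<Longrightarrow> u t \<le> C"
    using continuous_attains_sup[OF compact_Icc _ u(1)] by fastforce
  \<comment> \<open>The value 1 outside the interval keeps \<open>u'\<close> nonnegative and
    measurable on the whole line; the indicator hides it from all integrals.\<close>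
  define u' where "u' t = (if t \<in> {0..1} then u t else 1)" for t
  have [measurable]: "u' \<in> borel_measurable borel"
    unfolding u'_def[abs_def] by (rule borel_measurable_continuous_on_if) (use u in auto)
  have u'0: "0 \<le> u' t" for t using u(2) by (simp add: u'_def)
  have u'C: "u' t \<le> max C 1" for t using C[of t] by (auto simp: u'_def)
  define p where "p n = (\<integral>\<^sup>+t. ennreal (ln (u' t + \<eta> n)) * indicator {0..1} t \<partial>lborel)" for n
  define q where "q n = (\<integral>\<^sup>+t. ennreal (- ln (u' t + \<eta> n)) * indicator {0..1} t \<partial>lborel)" for n
  define P where "P = (\<integral>\<^sup>+t. e2ennreal (elog (u' t)) * indicator {0..1} t \<partial>lborel)"
  define Q where "Q = (\<integral>\<^sup>+t. e2ennreal (- elog (u' t)) * indicator {0..1} t \<partial>lborel)"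
  have lim_elog: "(\<lambda>n. ereal (ln (u' t + \<eta> n))) \<longlonglongrightarrow> elog (u' t)" for t
    unfolding \<eta>_def by (rule tendsto_elog_add[OF u'0])
  have qQ: "q \<longlonglongrightarrow> Q"
    unfolding q_def Q_def
  proof (rule nn_integral_LIMSEQ)
    show "incseq (\<lambda>n t. ennreal (- ln (u' t + \<eta> n)) * indicator {0..1} t)"
      using \<eta> \<eta>_mono u'0 by (intro incseq_SucI le_funI mult_right_mono ennreal_leI) (auto simp: add_nonneg_pos)
    show "(\<lambda>n. ennreal (- ln (u' t + \<eta> n)) * indicator {0..1} t) \<longlonglongrightarrow> e2ennreal (- elog (u' t)) * indicator {0..1} t" for t
    proof -
      have "(\<lambda>n. e2ennreal (- ereal (ln (u' t + \<eta> n)))) \<longlonglongrightarrow> e2ennreal (- elog (u' t))"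
        by (intro tendsto_e2ennrealI tendsto_uminus_ereal lim_elog)
      then show ?thesis by (cases "t \<in> {0..1}") auto
    qed
  qed measurable
  have p_bound: "ennreal (ln (u' t + \<eta> n)) * indicator {0..1} t \<le> ennreal (ln (max C 1 + 1)) * indicator {0..1} t" for t n
    using u'0[of t] u'C[of t] \<eta>[of n] by (intro mult_right_mono ennreal_leI) (auto simp: add_nonneg_pos)
  have w: "(\<integral>\<^sup>+t. ennreal (ln (max C 1 + 1)) * indicator {0..1} t \<partial>(lborel :: real measure)) < \<infinity>"
    by (simp add: nn_integral_cmult_indicator)
  have pP: "p \<longlonglongrightarrow> P"
    unfolding p_def P_def
  proof (rule nn_integral_dominated_convergence[OF _ _ _ _ w])
    show "AE t in lborel. (\<lambda>n. ennreal (ln (u' t + \<eta> n)) * indicator {0..1} t) \<longlonglongrightarrow> e2ennreal (elog (u' t)) * indicator {0..1} t"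
    proof (rule AE_I2)
      fix t
      have "(\<lambda>n. e2ennreal (ereal (ln (u' t + \<eta> n)))) \<longlonglongrightarrow> e2ennreal (elog (u' t))"
        by (intro tendsto_e2ennrealI lim_elog)
      then show "(\<lambda>n. ennreal (ln (u' t + \<eta> n)) * indicator {0..1} t) \<longlonglongrightarrow> e2ennreal (elog (u' t)) * indicator {0..1} t"
        by (cases "t \<in> {0..1}") auto
    qed
  qed (use p_bound in auto)
  have p_le: "p n \<le> (\<integral>\<^sup>+t. ennreal (ln (max C 1 + 1)) * indicator {0..1} t \<partial>(lborel :: real measure))" for n
    unfolding p_def by (intro nn_integral_mono p_bound)
  then have p_fin: "p n < \<infinity>" for n using w by (rule le_less_trans)
  have "P \<le> (\<integral>\<^sup>+t. ennreal (ln (max C 1 + 1)) * indicator {0..1} t \<partial>(lborel :: real measure))"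
    by (rule LIMSEQ_le_const2[OF pP]) (use p_le in auto)
  then have P_fin: "P < \<infinity>" using w by (rule le_less_trans)
  have q_fin: "q n < \<infinity>" for n
  proof -
    have "q n \<le> (\<integral>\<^sup>+t. ennreal (- ln (\<eta> n)) * indicator {0..1} t \<partial>(lborel :: real measure))"
      unfolding q_def
      by (intro nn_integral_mono mult_right_mono ennreal_leI) (use u'0 \<eta>(1)[of n] in \<open>auto simp: add_nonneg_pos\<close>)
    also have "\<dots> < \<infinity>" by (simp add: nn_integral_cmult_indicator)
    finally show ?thesis .
  qed
  have eq: "ereal (- integral {0..1} (\<lambda>t. ln (u t + \<eta> n))) = enn2ereal (q n) - enn2ereal (p n)" for n
  proof -
    have "continuous_on {0..1} (\<lambda>t. ln (u t + \<eta> n))"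
      using u(1) by (intro continuous_intros) (use u(2) \<eta>(1)[of n] in \<open>auto simp: add_nonneg_eq_0_iff less_imp_le\<close>)
    then have int: "set_integrable lborel {0..1} (\<lambda>t. ln (u t + \<eta> n))"
      by (rule borel_integrable_atLeastAtMost')
    have "integral {0..1} (\<lambda>t. ln (u t + \<eta> n)) = (\<integral>t. indicator {0..1} t *\<^sub>R ln (u t + \<eta> n) \<partial>lborel)"
      using set_borel_integral_eq_integral(2)[OF int] by (simp add: set_lebesgue_integral_def)
    also have "\<dots> = enn2real (\<integral>\<^sup>+t. ennreal (indicator {0..1} t *\<^sub>R ln (u t + \<eta> n)) \<partial>lborel)
        - enn2real (\<integral>\<^sup>+t. ennreal (- (indicator {0..1} t *\<^sub>R ln (u t + \<eta> n))) \<partial>lborel)"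
      using int by (intro real_lebesgue_integral_def) (simp add: set_integrable_def)
    also have "(\<integral>\<^sup>+t. ennreal (indicator {0..1} t *\<^sub>R ln (u t + \<eta> n)) \<partial>lborel) = p n"
      unfolding p_def by (intro nn_integral_cong) (auto simp: u'_def indicator_def)
    also have "(\<integral>\<^sup>+t. ennreal (- (indicator {0..1} t *\<^sub>R ln (u t + \<eta> n))) \<partial>lborel) = q n"
      unfolding q_def by (intro nn_integral_cong) (auto simp: u'_def indicator_def)
    finally show ?thesis using p_fin[of n] q_fin[of n] 
      by (cases "p n"; cases "q n") (auto simp: enn2ereal_ennreal)
  qed
  \<comment> \<open>Only \<open>Q\<close> can be infinite. Finiteness of \<open>P\<close> rules out
    the form \<infinity> - \<infinity> in the limit of the differences.\<close>
  have "(\<lambda>n. enn2ereal (q n) - enn2ereal (p n)) \<longlonglongrightarrow> enn2ereal Q - enn2ereal P"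
    using P_fin by (intro tendsto_diff_ereal_general tendsto_enn2erealI qQ pP) (cases P; auto simp: enn2ereal_ennreal)
  moreover have "Q = (\<integral>\<^sup>+t\<in>{0..1}. e2ennreal (- elog (u t)) \<partial>lborel)" "P = (\<integral>\<^sup>+t\<in>{0..1}. e2ennreal (elog (u t)) \<partial>lborel)"
    unfolding P_def Q_def by (intro nn_integral_cong; simp add: u'_def indicator_def)+
  ultimately show ?thesis unfolding eq[symmetric] by (simp add: \<eta>_def)
qed

definition g_reg :: "(real \<Rightarrow> real^'n) \<Rightarrow> real \<Rightarrow> real^'n \<Rightarrow> real" where
  "g_reg f \<eta> a = - integral {0..1} (\<lambda>t. ln (1 + \<eta> + a \<bullet> f t))"

lemma g_reg_tendsto_g_fun:
  fixes f :: "real \<Rightarrow> real^'n"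
  assumes "continuous_on {0..1} f" "a \<in> K_bar f"
  shows "(\<lambda>n. ereal (g_reg f (inverse (real (Suc n))) a)) \<longlonglongrightarrow> g_fun f a"
proof -
  have "continuous_on {0..1} (\<lambda>t. 1 + a \<bullet> f t)" "\<And>t. t \<in> {0..1} \<Longrightarrow> 0 \<le> 1 + a \<bullet> f t"
    using assms by (auto intro!: continuous_intros simp: K_bar_def)
  from log_integral_limit[OF this] show ?thesis
    by (simp add: g_reg_def g_fun_def algebra_simps del: of_nat_Suc)
qed

lemma K_barD: "a \<in> K_bar f \<Longrightarrow> t \<in> {0..1} \<Longrightarrow> 0 \<le> 1 + a \<bullet> f t"
  by (simp add: K_bar_def)

lemma K_bar_reg_pos: "a \<in> K_bar f \<Longrightarrow> t \<in> {0..1} \<Longrightarrow> 0 < \<eta> \<Longrightarrow> 0 < 1 + \<eta> + a \<bullet> f t"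
  using K_barD[of a f t] by linarith

lemma continuous_on_ln_reg:
  assumes "continuous_on {0..1} f" "a \<in> K_bar f" "\<eta> > 0"
  shows "continuous_on {0..1} (\<lambda>t. ln (1 + \<eta> + a \<bullet> f t))"
proof -
  have "1 + \<eta> + a \<bullet> f t \<noteq> 0" if "t \<in> {0..1}" for t
    using K_bar_reg_pos[OF assms(2) that assms(3)] by simp
  then show ?thesis using assms(1) by (intro continuous_intros) auto
qed

lemma g_reg_antimono:
  assumes f: "continuous_on {0..1} f" and a: "a \<in> K_bar f" and \<eta>: "0 < \<eta>" "\<eta> \<le> \<eta>'"
  shows "g_reg f \<eta>' a \<le> g_reg f \<eta> a"
proof -
  have "integral {0..1} (\<lambda>t. ln (1 + \<eta> + a \<bullet> f t)) \<le> integral {0..1} (\<lambda>t. ln (1 + \<eta>' + a \<bullet> f t))"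
  proof (rule integral_le)
    fix t :: real assume "t \<in> {0..1}"
    then have "0 \<le> 1 + a \<bullet> f t" using a by (simp add: K_bar_def)
    then show "ln (1 + \<eta> + a \<bullet> f t) \<le> ln (1 + \<eta>' + a \<bullet> f t)" using \<eta> by simp
  qed (use assms in \<open>auto intro!: integrable_continuous_interval continuous_on_ln_reg\<close>)
  then show ?thesis by (simp add: g_reg_def)
qed

lemma g_reg_le_g_fun:
  assumes f: "continuous_on {0..1} f" and a: "a \<in> K_bar f" and \<eta>: "0 < \<eta>"
  shows "ereal (g_reg f \<eta> a) \<le> g_fun f a"
proof (rule LIMSEQ_le_const[OF g_reg_tendsto_g_fun[OF f a]])
  obtain n0 where "inverse (real (Suc n0)) < \<eta>" using \<eta> reals_Archimedean by blast
  have "g_reg f \<eta> a \<le> g_reg f (inverse (real (Suc n))) a" if "n \<ge> n0" for n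
  proof (rule g_reg_antimono[OF f a])
    show "inverse (real (Suc n)) \<le> \<eta>"
      using that \<open>inverse (real (Suc n0)) < \<eta>\<close> le_imp_inverse_le[of "real (Suc n0)" "real (Suc n)"]
      by linarith
  qed simp
  then show "\<exists>N. \<forall>n\<ge>N. ereal (g_reg f \<eta> a) \<le> ereal (g_reg f (inverse (real (Suc n))) a)"
    by (auto simp del: of_nat_Suc)
qed

text \<open>\<open>g_fun f\<close> is the supremum of its regularisations. This reduces upper bounds
  on an extended-valued function to real inequalities that survive limits.\<close>

lemma g_fun_le_iff:
  assumes f: "continuous_on {0..1} f" and a: "a \<in> K_bar f"
  shows "g_fun f a \<le> ereal r \<longleftrightarrow> (\<forall>\<eta>>0. g_reg f \<eta> a \<le> r)"
proof
  show "\<forall>\<eta>>0. g_reg f \<eta> a \<le> r" if "g_fun f a \<le> ereal r"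
    using g_reg_le_g_fun[OF f a] that by (metis ereal_less_eq(3) order_trans)
  show "g_fun f a \<le> ereal r" if "\<forall>\<eta>>0. g_reg f \<eta> a \<le> r"
    by (rule LIMSEQ_le_const2[OF g_reg_tendsto_g_fun[OF f a]]) (use that in auto)
qed

section \<open>The feasible set and existence of minimisers\<close>

lemma zero_in_K_bar: "0 \<in> K_bar f"
  by (simp add: K_bar_def)

lemma g_fun_zero_le:
  assumes "continuous_on {0..1} f" shows "g_fun f 0 \<le> 0"
proof -
  have "g_fun f 0 \<le> ereal 0" unfolding g_fun_le_iff[OF assms zero_in_K_bar] by (simp add: g_reg_def)
  then show ?thesis by (simp add: zero_ereal_def)
qed

lemma closed_K_bar: "closed (K_bar f)"
proof -
  have "K_bar f = (\<Inter>t\<in>{0..1}. {y. 0 \<le> 1 + y \<bullet> f t})" by (auto simp: K_bar_def)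
  then show ?thesis by (simp only:) (intro closed_INT ballI closed_Collect_le continuous_intros)
qed

text \<open>Compactness of the unit sphere: unit directions with margins tending to 0 would
  accumulate at a direction that has no negative inner product with \<open>P\<close>.\<close>

lemma negative_direction_uniform:
  fixes P :: "'a::euclidean_space set"
  assumes "\<And>a. a \<noteq> 0 \<Longrightarrow> \<exists>p\<in>P. a \<bullet> p < 0"
  obtains \<epsilon> where "\<epsilon> > 0" "\<And>a. a \<noteq> 0 \<Longrightarrow> \<exists>p\<in>P. a \<bullet> p < - \<epsilon> * norm a"
proof -
  have "\<exists>\<epsilon>>0. \<forall>a\<in>sphere 0 1. \<exists>p\<in>P. a \<bullet> p < - \<epsilon>"
  proof (rule ccontr)
    assume "\<not> ?thesis"
    then have "\<forall>n. \<exists>a\<in>sphere 0 1. \<forall>p\<in>P. - inverse (real (Suc n)) \<le> a \<bullet> p"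
      by (metis inverse_positive_iff_positive not_less of_nat_0_less_iff zero_less_Suc)
    then obtain a where a: "\<And>n. a n \<in> sphere 0 1" "\<And>n p. p \<in> P \<Longrightarrow> - inverse (real (Suc n)) \<le> a n \<bullet> p"
      by metis
    obtain l r where l: "l \<in> sphere 0 1" "strict_mono r" "(a \<circ> r) \<longlonglongrightarrow> l"
      using compact_sphere[of "0::'a" 1] a(1) unfolding compact_def by metis
    have "0 \<le> l \<bullet> p" if "p \<in> P" for p
    proof (rule LIMSEQ_le)
      show "(\<lambda>n. (a \<circ> r) n \<bullet> p) \<longlonglongrightarrow> l \<bullet> p" by (intro tendsto_intros l)
      have "((\<lambda>n. - inverse (real (Suc n))) \<circ> r) \<longlonglongrightarrow> - 0"
        by (intro LIMSEQ_subseq_LIMSEQ tendsto_minus LIMSEQ_inverse_real_of_nat l(2))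
      then show "((\<lambda>n. - inverse (real (Suc n))) \<circ> r) \<longlonglongrightarrow> 0" by simp
    qed (use a(2) that in auto)
    moreover have "l \<noteq> 0" using l(1) by auto
    ultimately show False using assms by (meson not_less)
  qed
  then obtain \<epsilon> where \<epsilon>: "\<epsilon> > 0" "\<And>a. a \<in> sphere 0 1 \<Longrightarrow> \<exists>p\<in>P. a \<bullet> p < - \<epsilon>" by blast
  show thesis
  proof
    fix a :: 'a assume "a \<noteq> 0"
    then obtain p where "p \<in> P" "sgn a \<bullet> p < - \<epsilon>" using \<epsilon>(2)[of "sgn a"] by (auto simp: norm_sgn)
    then show "\<exists>p\<in>P. a \<bullet> p < - \<epsilon> * norm a"
      using \<open>a \<noteq> 0\<close> by (intro bexI[of _ p]) (auto simp: sgn_div_norm divide_simps)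
  qed (fact \<epsilon>(1))
qed

text \<open>Equivalent, by separation, to 0 being interior to the convex hull of the values on the
  unit interval. The half-space form bounds \<open>K_bar f\<close> directly and is stable under
  small perturbations of the points.\<close>

definition spans_all_directions :: "(real \<Rightarrow> 'a::euclidean_space) \<Rightarrow> bool" where
  "spans_all_directions f \<longleftrightarrow> (\<forall>a. a \<noteq> 0 \<longrightarrow> (\<exists>t\<in>{0..1}. a \<bullet> f t < 0))"

lemma compact_K_bar:
  assumes "spans_all_directions f"
  shows "compact (K_bar f)"
proof -
  obtain \<epsilon> where \<epsilon>: "\<epsilon> > 0" "\<And>a. a \<noteq> 0 \<Longrightarrow> \<exists>p\<in>f ` {0..1}. a \<bullet> p < - \<epsilon> * norm a"
    using negative_direction_uniform[of "f ` {0..1}"] assms by (auto simp: spans_all_directions_def)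
  have "norm a \<le> 1 / \<epsilon>" if a: "a \<in> K_bar f" for a
  proof (cases "a = 0")
    case False
    then obtain t where "t \<in> {0..1}" "a \<bullet> f t < - \<epsilon> * norm a" using \<epsilon>(2) by blast
    then have "\<epsilon> * norm a \<le> 1" using K_barD[OF a, of t] by linarith
    then show ?thesis using \<epsilon>(1) by (simp add: field_simps)
  qed (use \<epsilon> in simp)
  then show ?thesis using closed_K_bar by (auto simp: compact_eq_bounded_closed bounded_iff)
qed

lemma continuous_on_g_reg:
  assumes f: "continuous_on {0..1} f" and \<eta>: "\<eta> > 0"
  shows "continuous_on (K_bar f) (g_reg f \<eta>)"
proof -
  have "continuous_on (K_bar f) (\<lambda>a. integral (cbox 0 1) (\<lambda>t. ln (1 + \<eta> + a \<bullet> f t)))"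
  proof (rule integral_continuous_on_param)
    have "1 + \<eta> + fst x \<bullet> f (snd x) \<noteq> 0" if "x \<in> K_bar f \<times> cbox 0 1" for x
      using K_bar_reg_pos[of "fst x" f "snd x" \<eta>] that \<eta> by (auto simp: cbox_interval)
    moreover have "continuous_on (K_bar f \<times> cbox 0 1) (\<lambda>x. f (snd x))"
      by (rule continuous_on_compose2[OF f continuous_on_snd]) auto
    ultimately show "continuous_on (K_bar f \<times> cbox 0 1) (\<lambda>(a, t). ln (1 + \<eta> + a \<bullet> f t))"
      unfolding split_beta by (intro continuous_intros) auto
  qed
  then show ?thesis unfolding g_reg_def[abs_def] cbox_interval by (intro continuous_intros)
qed

text \<open>As a supremum of continuous functions, \<open>g_fun f\<close> is lower semicontinuous on
  the compact set \<open>K_bar f\<close>. A limit point of a minimising sequence is therefore a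
  minimiser, even on the boundary.\<close>

lemma g_minimizer_exists:
  assumes f: "continuous_on {0..1} f" and span: "spans_all_directions f"
  shows "\<exists>y. is_g_minimizer f y"
proof -
  obtain m where m: "\<And>n. m n \<in> g_fun f ` K_bar f" "m \<longlonglongrightarrow> Inf (g_fun f ` K_bar f)"
    using Inf_as_limit[of "g_fun f ` K_bar f"] zero_in_K_bar by blast
  have "\<forall>n. \<exists>x. x \<in> K_bar f \<and> m n = g_fun f x" using m(1) by blast
  then obtain a where a: "\<And>n. a n \<in> K_bar f" "\<And>n. m n = g_fun f (a n)" by metis
  obtain l r where l: "l \<in> K_bar f" "strict_mono r" "(a \<circ> r) \<longlonglongrightarrow> l"
    using compact_K_bar[OF span] a(1) unfolding compact_def by metis
  have "g_fun f l \<le> Inf (g_fun f ` K_bar f)"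
  proof (rule LIMSEQ_le_const2[OF g_reg_tendsto_g_fun[OF f l(1)]], intro exI allI impI)
    fix n
    have "(\<lambda>k. ereal (g_reg f (inverse (real (Suc n))) ((a \<circ> r) k))) \<longlonglongrightarrow> ereal (g_reg f (inverse (real (Suc n))) l)"
      using continuous_on_tendsto_compose[OF continuous_on_g_reg[OF f] l(3) l(1), of "inverse (real (Suc n))"] a(1)
      by (auto simp del: of_nat_Suc)
    moreover have "(\<lambda>k. (m \<circ> r) k) \<longlonglongrightarrow> Inf (g_fun f ` K_bar f)"
      using LIMSEQ_subseq_LIMSEQ[OF m(2) l(2)] by (simp add: o_def)
    ultimately show "ereal (g_reg f (inverse (real (Suc n))) l) \<le> Inf (g_fun f ` K_bar f)"
      by (rule LIMSEQ_le) (use g_reg_le_g_fun[OF f a(1)] a(2) in \<open>auto simp del: of_nat_Suc\<close>)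
  qed
  then have "g_fun f l \<le> g_fun f x" if "x \<in> K_bar f" for x
    using INF_lower[OF that, of "g_fun f"] by (rule order_trans)
  then show ?thesis using l(1)
    by (auto simp: is_g_minimizer_def is_arg_min_def not_less)
qed

section \<open>Finiteness and uniqueness of the minimiser\<close>

lemma is_g_minimizerD:
  assumes "is_g_minimizer f y"
  shows "y \<in> K_bar f" "\<And>x. x \<in> K_bar f \<Longrightarrow> g_fun f y \<le> g_fun f x"
  using assms by (auto simp: is_g_minimizer_def is_arg_min_def not_less)

lemma g_minimizer_finite:
  assumes f: "continuous_on {0..1} f" and y: "is_g_minimizer f y"
  obtains r where "g_fun f y = ereal r"
proof -
  have "g_fun f y \<le> 0"
    using is_g_minimizerD(2)[OF y zero_in_K_bar] g_fun_zero_le[OF f] by (rule order_trans)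
  moreover have "ereal (g_reg f 1 y) \<le> g_fun f y"
    by (rule g_reg_le_g_fun[OF f is_g_minimizerD(1)[OF y]]) simp
  ultimately show thesis by (cases "g_fun f y") (auto intro: that)
qed

text \<open>A quantitative form of strict concavity. It follows from \<open>ln s \<le> s - 1\<close>
  at the squared ratio of geometric and arithmetic mean, and its constant depends only on an upper
  bound for the arguments.\<close>

lemma ln_midpoint_gap:
  fixes p q C :: real
  assumes "0 < p" "p \<le> C" "0 < q" "q \<le> C"
  shows "(ln p + ln q) / 2 + (p - q)\<^sup>2 / (8 * C\<^sup>2) \<le> ln ((p + q) / 2)"
proof -
  have pq: "0 < p + q" "p + q \<le> 2 * C" using assms by auto
  have "ln p + ln q - 2 * ln ((p + q) / 2) = ln (p * q / ((p + q) / 2)\<^sup>2)"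
    using assms pq by (simp add: ln_mult ln_div ln_realpow)
  also have "\<dots> \<le> p * q / ((p + q) / 2)\<^sup>2 - 1"
    using assms pq by (intro ln_le_minus_one) auto
  also have "\<dots> = - ((p - q)\<^sup>2 / (p + q)\<^sup>2)"
    using pq by (simp add: divide_simps) (simp add: power2_eq_square algebra_simps)
  also have "\<dots> \<le> - ((p - q)\<^sup>2 / (2 * C)\<^sup>2)"
    using pq by (simp only: neg_le_iff_le) (intro divide_left_mono power_mono mult_pos_pos zero_less_power; linarith?; simp)
  finally show ?thesis by (simp add: power_mult_distrib field_simps)
qed

text \<open>Plain strict inequalities could be lost as \<eta> tends to 0, whereas the gap
  \<open>I / (8 * C\<^sup>2)\<close> at the midpoint does not depend on \<eta>. Two minimisers thus
  force \<open>I = 0\<close>, so \<open>(a - b) \<bullet> f t\<close> vanishes on the interval, and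
  spanning gives \<open>a = b\<close>.\<close>

lemma g_minimizer_unique:
  fixes f :: "real \<Rightarrow> real^'n"
  assumes f: "continuous_on {0..1} f" and span: "spans_all_directions f"
    and a: "is_g_minimizer f a" and b: "is_g_minimizer f b"
  shows "a = b"
proof -
  note aK = is_g_minimizerD(1)[OF a] and bK = is_g_minimizerD(1)[OF b]
  define c where "c = (1/2) *\<^sub>R (a + b)"
  have cf: "c \<bullet> f t = (a \<bullet> f t + b \<bullet> f t) / 2" for t
    by (simp add: c_def inner_add_left)
  have cK: "c \<in> K_bar f" 
    unfolding K_bar_def
  proof (intro CollectI ballI)
    fix t :: real assume t: "t \<in> {0..1}"
    show "0 \<le> 1 + c \<bullet> f t" using K_barD[OF aK t] K_barD[OF bK t] by (simp add: cf field_simps)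
  qed
  obtain r where r: "g_fun f a = ereal r" using g_minimizer_finite[OF f a] by metis
  then have rb: "g_fun f b = ereal r" using antisym[OF is_g_minimizerD(2)[OF a bK] is_g_minimizerD(2)[OF b aK]] by metis
  have bdd: "\<exists>A. \<forall>t\<in>{0..1}. x \<bullet> f t \<le> A" for x
  proof -
    have "continuous_on {0..1} (\<lambda>t. x \<bullet> f t)" using f by (intro continuous_intros)
    then obtain s where "\<forall>t\<in>{0..1}. x \<bullet> f t \<le> x \<bullet> f s"
      using continuous_attains_sup[of "{0..1::real}" "\<lambda>t. x \<bullet> f t"] by auto
    then show ?thesis by blast
  qed
  obtain A A' where A: "\<And>t. t \<in> {0..1} \<Longrightarrow> a \<bullet> f t \<le> A" and A': "\<And>t. t \<in> {0..1} \<Longrightarrow> b \<bullet> f t \<le> A'"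
    using bdd[of a] bdd[of b] by blast
  \<comment> \<open>The summand 2 covers \<open>1 + \<eta>\<close> for all \<eta> up to 1, so one
    \<open>C\<close> bounds every argument of the logarithm.\<close>
  define C where "C = 2 + \<bar>A\<bar> + \<bar>A'\<bar>"
  have C0: "C > 0" by (simp add: C_def)
  define I where "I = integral {0..1} (\<lambda>t. ((a - b) \<bullet> f t)\<^sup>2)"
  have cont_I: "continuous_on {0..1} (\<lambda>t. ((a - b) \<bullet> f t)\<^sup>2)" using f by (intro continuous_intros)
  have gap: "g_reg f \<eta> c \<le> r - I / (8 * C\<^sup>2)" if \<eta>: "0 < \<eta>" "\<eta> \<le> 1" for \<eta>
  proof -
    note int = integrable_continuous_interval[OF continuous_on_ln_reg[OF f aK \<eta>(1)]]
      integrable_continuous_interval[OF continuous_on_ln_reg[OF f bK \<eta>(1)]]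
      integrable_continuous_interval[OF continuous_on_ln_reg[OF f cK \<eta>(1)]]
      integrable_continuous_interval[OF cont_I]
    have "(integral {0..1} (\<lambda>t. ln (1 + \<eta> + a \<bullet> f t)) + integral {0..1} (\<lambda>t. ln (1 + \<eta> + b \<bullet> f t))) / 2 + I / (8 * C\<^sup>2)
        = integral {0..1} (\<lambda>t. (ln (1 + \<eta> + a \<bullet> f t) + ln (1 + \<eta> + b \<bullet> f t)) / 2 + ((a - b) \<bullet> f t)\<^sup>2 / (8 * C\<^sup>2))"
      unfolding I_def using int
      by (simp only: integral_add integral_divide integrable_add integrable_on_divide)
    also have "\<dots> \<le> integral {0..1} (\<lambda>t. ln (1 + \<eta> + c \<bullet> f t))"
    proof (rule integral_le)
      show "(\<lambda>t. (ln (1 + \<eta> + a \<bullet> f t) + ln (1 + \<eta> + b \<bullet> f t)) / 2 + ((a - b) \<bullet> f t)\<^sup>2 / (8 * C\<^sup>2)) integrable_on {0..1}"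
        using int by (intro integrable_add integrable_on_divide)
      fix t :: real assume t: "t \<in> {0..1}"
      have pos: "0 < 1 + \<eta> + a \<bullet> f t" "0 < 1 + \<eta> + b \<bullet> f t"
        by (rule K_bar_reg_pos[OF aK t \<eta>(1)] K_bar_reg_pos[OF bK t \<eta>(1)])+
      have ub: "1 + \<eta> + a \<bullet> f t \<le> C" "1 + \<eta> + b \<bullet> f t \<le> C"
        using A[OF t] A'[OF t] \<eta> by (auto simp: C_def)
      show "(ln (1 + \<eta> + a \<bullet> f t) + ln (1 + \<eta> + b \<bullet> f t)) / 2 + ((a - b) \<bullet> f t)\<^sup>2 / (8 * C\<^sup>2)
          \<le> ln (1 + \<eta> + c \<bullet> f t)"
      proof -
        have "1 + \<eta> + c \<bullet> f t = ((1 + \<eta> + a \<bullet> f t) + (1 + \<eta> + b \<bullet> f t)) / 2"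
          by (simp add: cf field_simps)
        moreover have "(a - b) \<bullet> f t = (1 + \<eta> + a \<bullet> f t) - (1 + \<eta> + b \<bullet> f t)"
          by (simp add: inner_diff_left)
        ultimately show ?thesis
          using ln_midpoint_gap[OF pos(1) ub(1) pos(2) ub(2)] by (simp only:)
      qed
    qed (fact int(3))
    finally have "g_reg f \<eta> c \<le> (g_reg f \<eta> a + g_reg f \<eta> b) / 2 - I / (8 * C\<^sup>2)"
      by (simp add: g_reg_def add_divide_distrib diff_divide_distrib)
    moreover have "g_reg f \<eta> a \<le> r" "g_reg f \<eta> b \<le> r"
      using g_reg_le_g_fun[OF f aK \<eta>(1)] g_reg_le_g_fun[OF f bK \<eta>(1)] by (simp_all add: r rb)
    ultimately show ?thesis by (simp add: add_divide_distrib)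
  qed
  have "g_fun f c \<le> ereal (r - I / (8 * C\<^sup>2))"
  proof (rule LIMSEQ_le_const2[OF g_reg_tendsto_g_fun[OF f cK]], intro exI allI impI)
    fix n :: nat
    have "inverse (real (Suc n)) \<le> 1" by (simp add: divide_simps)
    then show "ereal (g_reg f (inverse (real (Suc n))) c) \<le> ereal (r - I / (8 * C\<^sup>2))"
      by (intro ereal_less_eq(3)[THEN iffD2] gap) auto
  qed
  moreover have "ereal r \<le> g_fun f c" using is_g_minimizerD(2)[OF a cK] r by simp
  ultimately have "ereal r \<le> ereal (r - I / (8 * C\<^sup>2))" by (rule order_trans[rotated])
  then have "I \<le> 0" using C0 by (simp add: divide_le_0_iff)
  moreover have "0 \<le> I" unfolding I_def by (intro integral_nonneg integrable_continuous_interval cont_I) auto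
  ultimately have "\<forall>t\<in>{0..1}. ((a - b) \<bullet> f t)\<^sup>2 = 0"
    using integral_eq_0_iff[OF cont_I] by (simp add: I_def)
  then have "\<forall>t\<in>{0..1}. \<not> (a - b) \<bullet> f t < 0" by force
  then have "a - b = 0" using span unfolding spans_all_directions_def by blast
  then show ?thesis by simp
qed

section \<open>Convergence of the discrete objectives\<close>

lemma riemann_sum_tendsto:
  fixes \<phi> :: "real \<Rightarrow> real"
  assumes cont: "continuous_on {0..1} \<phi>"
  shows "(\<lambda>n. (\<Sum>i=1..n. \<phi> (real i / real n)) / real n) \<longlonglongrightarrow> integral {0..1} \<phi>"
proof (rule LIMSEQ_I)
  fix e :: real assume e: "e > 0"
  have "uniformly_continuous_on {0..1} \<phi>" by (rule compact_uniformly_continuous[OF cont compact_Icc])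
  then obtain d where d: "d > 0" "\<And>s t. s \<in> {0..1} \<Longrightarrow> t \<in> {0..1} \<Longrightarrow> dist s t < d \<Longrightarrow> dist (\<phi> s) (\<phi> t) < e / 2"
    unfolding uniformly_continuous_on_def using e by (metis half_gt_zero)
  obtain n0 where n0: "inverse (real (Suc n0)) < d" using reals_Archimedean[OF d(1)] by blast
  show "\<exists>no. \<forall>n\<ge>no. norm ((\<Sum>i=1..n. \<phi> (real i / real n)) / real n - integral {0..1} \<phi>) < e"
  proof (intro exI[of _ "Suc n0"] allI impI)
    fix n assume n: "Suc n0 \<le> n"
    then have n1: "0 < real n" by simp
    have nd: "1 / real n < d"
      using le_imp_inverse_le[of "real (Suc n0)" "real n"] n n0 by (simp add: inverse_eq_divide del: of_nat_Suc)
    \<comment> \<open>Induction over the cells, with an error budget proportional to the length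
      covered so far.\<close>
    have "\<bar>(\<Sum>i=1..m. \<phi> (real i / real n)) / real n - integral {0..real m / real n} \<phi>\<bar> \<le> e / 2 * (real m / real n)" if "m \<le> n" for m
      using that
    proof (induction m)
      case (Suc m)
      let ?a = "real m / real n" and ?b = "real (Suc m) / real n"
      have ab: "0 \<le> ?a" "?a \<le> ?b" "?b \<le> 1" "?b - ?a = 1 / real n" using Suc.prems n1 by (auto simp: divide_simps)
      have sub: "{0..?b} \<subseteq> {0..1}" "{?a..?b} \<subseteq> {0..1}" using ab by auto
      have "norm (integral {?a..?b} (\<lambda>t. \<phi> ?b - \<phi> t)) \<le> e / 2 * (?b - ?a)"
      proof (rule integral_bound)
        show "continuous_on {?a..?b} (\<lambda>t. \<phi> ?b - \<phi> t)"
          using continuous_on_subset[OF cont sub(2)] by (intro continuous_intros)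
        fix t assume t: "t \<in> {?a..?b}"
        then have "dist ?b t < d" using ab nd by (auto simp: dist_real_def)
        then show "norm (\<phi> ?b - \<phi> t) \<le> e / 2"
          using d(2)[of ?b t] ab t sub(2) by (auto simp: dist_real_def subset_iff intro: less_imp_le)
      qed (fact ab)
      also have "integral {?a..?b} (\<lambda>t. \<phi> ?b - \<phi> t) = \<phi> ?b * (1 / real n) - integral {?a..?b} \<phi>"
        using ab integrable_continuous_interval[OF continuous_on_subset[OF cont sub(2)]]
        by (subst integral_diff) (auto simp: mult.commute)
      finally have 1: "\<bar>\<phi> ?b / real n - integral {?a..?b} \<phi>\<bar> \<le> e / 2 * (1 / real n)" using ab by simp
      have 2: "integral {0..?b} \<phi> = integral {0..?a} \<phi> + integral {?a..?b} \<phi>"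
        using Henstock_Kurzweil_Integration.integral_combine[OF ab(1,2) integrable_continuous_interval[OF continuous_on_subset[OF cont sub(1)]]] by simp
      have 3: "(\<Sum>i=1..Suc m. \<phi> (real i / real n)) / real n = (\<Sum>i=1..m. \<phi> (real i / real n)) / real n + \<phi> ?b / real n"
        by (simp add: add_divide_distrib)
      have 4: "e / 2 * ?b = e / 2 * ?a + e / 2 * (1 / real n)"
        by (simp add: add_divide_distrib distrib_left)
      have IH: "\<bar>(\<Sum>i=1..m. \<phi> (real i / real n)) / real n - integral {0..?a} \<phi>\<bar> \<le> e / 2 * ?a"
        using Suc by simp
      show ?case using IH 1 unfolding 2 3 4 by linarith
    qed simp
    from this[of n] show "norm ((\<Sum>i=1..n. \<phi> (real i / real n)) / real n - integral {0..1} \<phi>) < e"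
      using n1 e by simp
  qed
qed

lemma abs_ln_diff_le:
  fixes x y m :: real
  assumes "0 < m" "m \<le> x" "m \<le> y"
  shows "\<bar>ln x - ln y\<bar> \<le> \<bar>x - y\<bar> / m"
proof -
  have *: "ln x - ln y \<le> \<bar>x - y\<bar> / m" if "m \<le> x" "m \<le> y" for x y
  proof -
    have "ln x - ln y = ln (x / y)" using that assms(1) by (simp add: ln_div)
    also have "\<dots> \<le> x / y - 1" using that assms(1) by (intro ln_le_minus_one) auto
    also have "\<dots> = (x - y) / y" using that assms(1) by (simp add: diff_divide_distrib)
    also have "\<dots> \<le> \<bar>x - y\<bar> / y" using that assms(1) by (intro divide_right_mono) auto
    also have "\<dots> \<le> \<bar>x - y\<bar> / m" using that assms(1) by (intro divide_left_mono) auto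
    finally show ?thesis .
  qed
  show ?thesis using *[of x y] *[of y x] assms by (simp add: abs_minus_commute abs_le_iff)
qed

lemma grid_point_near:
  assumes "n \<ge> 1" "t \<in> {0..1}"
  obtains i where "i \<in> {1..n}" "\<bar>real i / real n - t\<bar> \<le> 1 / real n"
proof -
  define j where "j = nat \<lceil>real n * t\<rceil>"
  have t: "0 \<le> real n * t" "real n * t \<le> real n" using assms by (auto simp: mult_left_le)
  have jb: "real n * t \<le> real j" "real j < real n * t + 1" using t unfolding j_def by linarith+
  have jn: "j \<le> n" using t unfolding j_def by linarith
  show thesis
  proof
    \<comment> \<open>At \<open>t = 0\<close> the ceiling is 0, which is not a grid index; index 1
      is still within one step.\<close>
    show "max 1 j \<in> {1..n}" using jn assms by auto
    have "\<bar>real (max 1 j) - real n * t\<bar> \<le> 1" 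
      using jb t by (cases "j = 0") (auto simp: max_def abs_le_iff)
    then have "\<bar>real (max 1 j) - real n * t\<bar> / real n \<le> 1 / real n" by (intro divide_right_mono) auto
    moreover have "real (max 1 j) / real n - t = (real (max 1 j) - real n * t) / real n"
      using assms(1) by (simp add: diff_divide_distrib)
    ultimately show "\<bar>real (max 1 j) / real n - t\<bar> \<le> 1 / real n" by (simp only: abs_divide abs_of_nat)
  qed
qed

text \<open>The stationarity condition of the concave function
  \<open>\<Sum>i. ln (1 + a \<bullet> v i)\<close> on its open domain, with the factors
  \<open>1 / n\<close> of the multiplier equation removed.\<close>

definition lagrange_solution :: "nat \<Rightarrow> (nat \<Rightarrow> 'a::real_inner) \<Rightarrow> 'a \<Rightarrow> bool" where
  "lagrange_solution n v a \<longleftrightarrow> (\<forall>i\<in>{1..n}. 0 < 1 + a \<bullet> v i) \<and> (\<Sum>i=1..n. (1 / (1 + a \<bullet> v i)) *\<^sub>R v i) = 0"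

text \<open>The bound \<open>ln s \<le> s - 1\<close> at the ratio of the two arguments is the
  tangent inequality at \<open>a\<close>; by stationarity the linear terms sum to 0.\<close>

lemma lagrange_solution_maximal:
  assumes a: "lagrange_solution n v a" and b: "\<And>i. i \<in> {1..n} \<Longrightarrow> 0 < 1 + b \<bullet> v i"
  shows "(\<Sum>i=1..n. ln (1 + b \<bullet> v i)) \<le> (\<Sum>i=1..n. ln (1 + a \<bullet> v i))"
proof -
  have pos: "0 < 1 + a \<bullet> v i" if "i \<in> {1..n}" for i using a that by (simp add: lagrange_solution_def)
  have "(\<Sum>i=1..n. ln (1 + b \<bullet> v i) - ln (1 + a \<bullet> v i)) \<le> (\<Sum>i=1..n. (b - a) \<bullet> ((1 / (1 + a \<bullet> v i)) *\<^sub>R v i))"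
  proof (rule sum_mono)
    fix i assume i: "i \<in> {1..n}"
    have "ln (1 + b \<bullet> v i) - ln (1 + a \<bullet> v i) = ln ((1 + b \<bullet> v i) / (1 + a \<bullet> v i))"
      using b[OF i] pos[OF i] by (simp add: ln_div)
    also have "\<dots> \<le> (1 + b \<bullet> v i) / (1 + a \<bullet> v i) - 1"
      using b[OF i] pos[OF i] by (intro ln_le_minus_one) auto
    also have "\<dots> = (b - a) \<bullet> ((1 / (1 + a \<bullet> v i)) *\<^sub>R v i)"
      using pos[OF i] by (simp add: inner_diff_left divide_simps)
    finally show "ln (1 + b \<bullet> v i) - ln (1 + a \<bullet> v i) \<le> (b - a) \<bullet> ((1 / (1 + a \<bullet> v i)) *\<^sub>R v i)" .
  qed
  also have "\<dots> = (b - a) \<bullet> (\<Sum>i=1..n. (1 / (1 + a \<bullet> v i)) *\<^sub>R v i)" by (simp add: inner_sum_right)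
  also have "\<dots> = 0" using a by (simp add: lagrange_solution_def)
  finally show ?thesis by (simp add: sum_subtractf)
qed

text \<open>The sample size is \<open>N k\<close> rather than \<open>k\<close> because the mapping
  theorem supplies arbitrary index sequences, and because the assumptions then pass to
  subsequences.\<close>

locale approximating_points =
  fixes f :: "real \<Rightarrow> real^'n" and N :: "nat \<Rightarrow> nat" and v :: "nat \<Rightarrow> nat \<Rightarrow> real^'n" and e :: "nat \<Rightarrow> real"
  assumes cont: "continuous_on {0..1} f" and span: "spans_all_directions f"
    and N: "filterlim N at_top sequentially" and e: "e \<longlonglongrightarrow> 0"
    and close: "\<And>k i. i \<in> {1..N k} \<Longrightarrow> norm (v k i - f (real i / real (N k))) \<le> e k"
begin

lemma subseq:
  assumes "strict_mono r"
  shows "approximating_points f (N \<circ> r) (v \<circ> r) (e \<circ> r)"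
proof
  show "filterlim (N \<circ> r) at_top sequentially"
    unfolding o_def by (rule filterlim_compose[OF N filterlim_subseq[OF assms]])
  show "(e \<circ> r) \<longlonglongrightarrow> 0" by (rule LIMSEQ_subseq_LIMSEQ[OF e assms])
qed (use cont span close in auto)

lemma eventually_N_ge: "\<forall>\<^sub>F k in sequentially. m \<le> N k"
  using N by (simp add: filterlim_at_top)

lemma bounded_f: obtains F where "F > 0" "\<And>t. t \<in> {0..1} \<Longrightarrow> norm (f t) \<le> F"
proof -
  have "bounded (f ` {0..1})" by (intro compact_imp_bounded compact_continuous_image cont compact_Icc)
  then show thesis using that unfolding bounded_pos by auto
qed

lemma eventually_close:
  assumes "\<epsilon> > 0"
  shows "\<forall>\<^sub>F k in sequentially. \<forall>t\<in>{0..1}. \<exists>i\<in>{1..N k}. norm (v k i - f t) < \<epsilon>"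
proof -
  have "uniformly_continuous_on {0..1} f" by (rule compact_uniformly_continuous[OF cont compact_Icc])
  then obtain d where d: "d > 0" "\<And>s t. s \<in> {0..1} \<Longrightarrow> t \<in> {0..1} \<Longrightarrow> dist s t < d \<Longrightarrow> dist (f s) (f t) < \<epsilon> / 2"
    unfolding uniformly_continuous_on_def using assms by (metis half_gt_zero)
  obtain n0 where n0: "inverse (real (Suc n0)) < d" using reals_Archimedean[OF d(1)] by blast
  have "\<forall>\<^sub>F k in sequentially. e k < \<epsilon> / 2" using order_tendstoD(2)[OF e, of "\<epsilon> / 2"] assms by simp
  with eventually_N_ge[of "Suc n0"] show ?thesis
  proof eventually_elim
    case (elim k)
    show ?case
    proof
      fix t :: real assume t: "t \<in> {0..1}"
      obtain i where i: "i \<in> {1..N k}" "\<bar>real i / real (N k) - t\<bar> \<le> 1 / real (N k)"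
        using grid_point_near[of "N k" t] t elim(1) by auto
      have "1 / real (N k) < d"
        using le_imp_inverse_le[of "real (Suc n0)" "real (N k)"] elim(1) n0 by (simp add: inverse_eq_divide del: of_nat_Suc)
      then have "dist (real i / real (N k)) t < d" using i(2) by (simp add: dist_real_def)
      moreover have "real i / real (N k) \<in> {0..1}" using i(1) by (auto simp: divide_simps)
      ultimately have "norm (f (real i / real (N k)) - f t) < \<epsilon> / 2" using d(2) t by (simp add: dist_norm)
      then have "norm (v k i - f t) < \<epsilon>"
        using close[OF i(1)] elim(2) norm_triangle_ineq[of "v k i - f (real i / real (N k))" "f (real i / real (N k)) - f t"] by simp
      then show "\<exists>i\<in>{1..N k}. norm (v k i - f t) < \<epsilon>" using i(1) by blast
    qed
  qed
qed

text \<open>Half of the margin of \<open>f\<close> pays for replacing \<open>f t\<close> by a nearby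
  \<open>v k i\<close>, uniformly in the direction. This serves both to bound the multipliers and to
  place 0 inside the convex hull of the data.\<close>

lemma eventually_negative_direction:
  obtains \<epsilon> where "\<epsilon> > 0"
    "\<forall>\<^sub>F k in sequentially. \<forall>a. a \<noteq> 0 \<longrightarrow> (\<exists>i\<in>{1..N k}. a \<bullet> v k i < - \<epsilon> * norm a)"
proof -
  obtain \<epsilon> where \<epsilon>: "\<epsilon> > 0" "\<And>a. a \<noteq> 0 \<Longrightarrow> \<exists>p\<in>f ` {0..1}. a \<bullet> p < - \<epsilon> * norm a"
    using negative_direction_uniform[of "f ` {0..1}"] span by (auto simp: spans_all_directions_def)
  show thesis
  proof (rule that)
    show "\<epsilon> / 2 > 0" using \<epsilon>(1) by simp
    show "\<forall>\<^sub>F k in sequentially. \<forall>a. a \<noteq> 0 \<longrightarrow> (\<exists>i\<in>{1..N k}. a \<bullet> v k i < - (\<epsilon> / 2) * norm a)"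
      using eventually_close[OF \<open>\<epsilon> / 2 > 0\<close>]
    proof eventually_elim
      case (elim k)
      show ?case
      proof (intro allI impI)
        fix a :: "real^'n" assume "a \<noteq> 0"
        then obtain t where t: "t \<in> {0..1}" "a \<bullet> f t < - \<epsilon> * norm a" using \<epsilon>(2) by blast
        then obtain i where i: "i \<in> {1..N k}" "norm (v k i - f t) < \<epsilon> / 2" using elim by blast
        have "a \<bullet> v k i = a \<bullet> f t + a \<bullet> (v k i - f t)" by (simp add: inner_diff_right)
        also have "a \<bullet> (v k i - f t) \<le> norm a * (\<epsilon> / 2)"
          using norm_cauchy_schwarz[of a "v k i - f t"] mult_left_mono[OF less_imp_le[OF i(2)], of "norm a"] by simp
        finally have "a \<bullet> v k i < - (\<epsilon> / 2) * norm a" using t(2) by (simp add: field_simps)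
        then show "\<exists>i\<in>{1..N k}. a \<bullet> v k i < - (\<epsilon> / 2) * norm a" using i(1) by blast
      qed
    qed
  qed
qed

text \<open>The limiting arguments are at least \<eta>, so the perturbed ones are eventually at
  least \<open>\<eta> / 2\<close>. There the logarithm has Lipschitz constant
  \<open>2 / \<eta>\<close>, and the sum differs little from a Riemann sum of a continuous
  function.\<close>

lemma log_sum_tendsto:
  assumes c: "c \<longlonglongrightarrow> c0" and c0: "c0 \<in> K_bar f" and \<eta>: "\<eta> > 0"
  shows "\<forall>\<^sub>F k in sequentially. \<forall>i\<in>{1..N k}. 0 < 1 + \<eta> + c k \<bullet> v k i"
    and "(\<lambda>k. - (\<Sum>i=1..N k. ln (1 + \<eta> + c k \<bullet> v k i)) / real (N k)) \<longlonglongrightarrow> g_reg f \<eta> c0"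
proof -
  obtain F where F: "F > 0" "\<And>t. t \<in> {0..1} \<Longrightarrow> norm (f t) \<le> F" using bounded_f by metis
  define D where "D k = norm (c k) * e k + norm (c k - c0) * F" for k
  have "D \<longlonglongrightarrow> norm c0 * 0 + norm (c0 - c0) * F"
    unfolding D_def by (intro tendsto_intros c e)
  then have D0: "D \<longlonglongrightarrow> 0" by simp
  have in01: "real i / real (N k) \<in> {0..1}" if "i \<in> {1..N k}" for i k
    using that by (auto simp: divide_simps)
  have diff: "\<bar>c k \<bullet> v k i - c0 \<bullet> f (real i / real (N k))\<bar> \<le> D k" if i: "i \<in> {1..N k}" for i k
  proof -
    let ?f = "f (real i / real (N k))"
    have "c k \<bullet> v k i - c0 \<bullet> ?f = c k \<bullet> (v k i - ?f) + (c k - c0) \<bullet> ?f"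
      by (simp add: inner_diff_left inner_diff_right)
    moreover have "\<bar>c k \<bullet> (v k i - ?f)\<bar> \<le> norm (c k) * e k"
      using Cauchy_Schwarz_ineq2[of "c k" "v k i - ?f"] mult_left_mono[OF close[OF i], of "norm (c k)"] by simp
    moreover have "\<bar>(c k - c0) \<bullet> ?f\<bar> \<le> norm (c k - c0) * F"
      using Cauchy_Schwarz_ineq2[of "c k - c0" ?f] mult_left_mono[OF F(2)[OF in01[OF i]], of "norm (c k - c0)"] by simp
    ultimately show ?thesis unfolding D_def by linarith
  qed
  have lim_ge: "\<eta> \<le> 1 + \<eta> + c0 \<bullet> f (real i / real (N k))" if "i \<in> {1..N k}" for i k
    using K_barD[OF c0 in01[OF that]] by simp
  have ev: "\<forall>\<^sub>F k in sequentially. D k < \<eta> / 2" using order_tendstoD(2)[OF D0, of "\<eta> / 2"] \<eta> by simp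
  have ge: "\<eta> / 2 \<le> 1 + \<eta> + c k \<bullet> v k i" if "i \<in> {1..N k}" "D k < \<eta> / 2" for i k
    using lim_ge[OF that(1)] diff[OF that(1)] that(2) by linarith
  show "\<forall>\<^sub>F k in sequentially. \<forall>i\<in>{1..N k}. 0 < 1 + \<eta> + c k \<bullet> v k i"
    using ev by eventually_elim (use ge \<eta> in \<open>auto intro: less_le_trans[of _ "\<eta> / 2"]\<close>)
  define \<phi> where "\<phi> t = ln (1 + \<eta> + c0 \<bullet> f t)" for t
  have "continuous_on {0..1} \<phi>" unfolding \<phi>_def by (rule continuous_on_ln_reg[OF cont c0 \<eta>])
  from filterlim_compose[OF riemann_sum_tendsto[OF this] N]
  have lim: "(\<lambda>k. (\<Sum>i=1..N k. \<phi> (real i / real (N k))) / real (N k)) \<longlonglongrightarrow> integral {0..1} \<phi>" .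
  have "(\<lambda>k. (\<Sum>i=1..N k. ln (1 + \<eta> + c k \<bullet> v k i)) / real (N k) - (\<Sum>i=1..N k. \<phi> (real i / real (N k))) / real (N k)) \<longlonglongrightarrow> 0"
  proof (rule tendsto_0_le[OF D0, where K = "2 / \<eta>"])
    show "\<forall>\<^sub>F k in sequentially. norm ((\<Sum>i=1..N k. ln (1 + \<eta> + c k \<bullet> v k i)) / real (N k) - (\<Sum>i=1..N k. \<phi> (real i / real (N k))) / real (N k)) \<le> norm (D k) * (2 / \<eta>)"
      using ev eventually_N_ge[of 1]
    proof eventually_elim
      case (elim k)
      have "norm (\<Sum>i=1..N k. ln (1 + \<eta> + c k \<bullet> v k i) - \<phi> (real i / real (N k))) \<le> (\<Sum>i=1..N k. D k * (2 / \<eta>))"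
      proof (rule sum_norm_le)
        fix i assume i: "i \<in> {1..N k}"
        have "\<eta> / 2 \<le> 1 + \<eta> + c0 \<bullet> f (real i / real (N k))" using lim_ge[OF i] \<eta> by linarith
        from abs_ln_diff_le[OF _ ge[OF i elim(1)] this] \<eta>
        have "\<bar>ln (1 + \<eta> + c k \<bullet> v k i) - \<phi> (real i / real (N k))\<bar> \<le> \<bar>c k \<bullet> v k i - c0 \<bullet> f (real i / real (N k))\<bar> / (\<eta> / 2)"
          by (simp add: \<phi>_def)
        also have "\<dots> \<le> D k / (\<eta> / 2)" using diff[OF i] \<eta> by (intro divide_right_mono) auto
        finally show "norm (ln (1 + \<eta> + c k \<bullet> v k i) - \<phi> (real i / real (N k))) \<le> D k * (2 / \<eta>)" by simp
      qed
      also have "\<dots> = real (N k) * (D k * (2 / \<eta>))" by simp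
      finally have "norm (\<Sum>i=1..N k. ln (1 + \<eta> + c k \<bullet> v k i) - \<phi> (real i / real (N k))) / real (N k) \<le> D k * (2 / \<eta>)"
        using elim(2) by (simp add: divide_le_eq mult.commute)
      also have "D k * (2 / \<eta>) \<le> norm (D k) * (2 / \<eta>)" using \<eta> by (intro mult_right_mono) auto
      finally show ?case by (simp add: sum_subtractf diff_divide_distrib flip: abs_divide)
        (simp add: abs_divide flip: diff_divide_distrib)?
    qed
  qed
  from tendsto_add[OF this lim] have "(\<lambda>k. (\<Sum>i=1..N k. ln (1 + \<eta> + c k \<bullet> v k i)) / real (N k)) \<longlonglongrightarrow> integral {0..1} \<phi>" by simp
  from tendsto_minus[OF this] show "(\<lambda>k. - (\<Sum>i=1..N k. ln (1 + \<eta> + c k \<bullet> v k i)) / real (N k)) \<longlonglongrightarrow> g_reg f \<eta> c0"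
    by (simp add: g_reg_def \<phi>_def[abs_def])
qed

end

text \<open>
  Upper bounds come from comparing the multiplier with \<open>y / (1 + \<eta>)\<close>, which is interior to the
  domain; lower bounds from \<open>ln x \<le> ln (x + \<eta>)\<close>.
\<close>

locale approximating_multipliers = approximating_points +
  fixes a :: "nat \<Rightarrow> real^'n" and y :: "real^'n" and m :: real
  assumes mult: "\<forall>\<^sub>F k in sequentially. lagrange_solution (N k) (v k) (a k)"
    and y: "is_g_minimizer f y" and m: "g_fun f y = ereal m"
begin

definition obj :: "nat \<Rightarrow> real" where
  "obj k = - (\<Sum>i=1..N k. ln (1 + a k \<bullet> v k i)) / real (N k)"

lemma y_in_K: "y \<in> K_bar f" using y by (rule is_g_minimizerD)

lemma obj_upper:
  assumes "\<epsilon> > 0"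
  shows "\<forall>\<^sub>F k in sequentially. obj k < m + \<epsilon>"
proof -
  \<comment> \<open>One half of \<epsilon> is spent on the convergence of the sums, the other on
    \<open>ln (1 + \<eta>) \<le> \<eta>\<close>.\<close>
  define \<eta> where "\<eta> = \<epsilon> / 2"
  have \<eta>: "\<eta> > 0" using assms by (simp add: \<eta>_def)
  note lim = log_sum_tendsto[OF tendsto_const y_in_K \<eta>]
  have "g_reg f \<eta> y \<le> m" using g_reg_le_g_fun[OF cont y_in_K \<eta>] by (simp add: m)
  then have "g_reg f \<eta> y < m + \<epsilon> / 2" using assms by simp
  from order_tendstoD(2)[OF lim(2) this] lim(1) eventually_N_ge[of 1] mult
  show ?thesis
  proof eventually_elim
    case (elim k)
    define b where "b = (1 / (1 + \<eta>)) *\<^sub>R y"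
    have b: "1 + b \<bullet> v k i = (1 + \<eta> + y \<bullet> v k i) / (1 + \<eta>)" for i
      using \<eta> by (simp add: b_def divide_simps)
    have "(\<Sum>i=1..N k. ln (1 + \<eta> + y \<bullet> v k i)) - real (N k) * ln (1 + \<eta>) = (\<Sum>i=1..N k. ln (1 + \<eta> + y \<bullet> v k i) - ln (1 + \<eta>))"
      by (simp add: sum_subtractf)
    also have "\<dots> = (\<Sum>i=1..N k. ln (1 + b \<bullet> v k i))"
    proof (rule sum.cong[OF refl])
      fix i assume "i \<in> {1..N k}"
      then have "0 < 1 + \<eta> + y \<bullet> v k i" using elim(2) by blast
      then show "ln (1 + \<eta> + y \<bullet> v k i) - ln (1 + \<eta>) = ln (1 + b \<bullet> v k i)"
        using \<eta> unfolding b by (simp add: ln_div)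
    qed
    also have "\<dots> \<le> (\<Sum>i=1..N k. ln (1 + a k \<bullet> v k i))"
      using elim(2) \<eta> by (intro lagrange_solution_maximal[OF elim(4)]) (auto simp: b)
    finally have "obj k \<le> (- (\<Sum>i=1..N k. ln (1 + \<eta> + y \<bullet> v k i)) + real (N k) * ln (1 + \<eta>)) / real (N k)"
      unfolding obj_def by (intro divide_right_mono) auto
    also have "\<dots> = - (\<Sum>i=1..N k. ln (1 + \<eta> + y \<bullet> v k i)) / real (N k) + ln (1 + \<eta>)"
      using elim(3) by (simp add: add_divide_distrib diff_divide_distrib)
    also have "\<dots> < m + \<epsilon> / 2 + \<eta>"
      using elim(1) ln_add_one_self_le_self[of \<eta>] \<eta> by (intro add_less_le_mono) auto
    finally show ?case by (simp add: \<eta>_def)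
  qed
qed

lemma obj_lower:
  assumes "a \<longlonglongrightarrow> l" "l \<in> K_bar f" "\<eta> > 0" "r < g_reg f \<eta> l"
  shows "\<forall>\<^sub>F k in sequentially. r < obj k"
  using order_tendstoD(1)[OF log_sum_tendsto(2)[OF assms(1-3)] assms(4)] mult
proof eventually_elim
  case (elim k)
  have "(\<Sum>i=1..N k. ln (1 + a k \<bullet> v k i)) \<le> (\<Sum>i=1..N k. ln (1 + \<eta> + a k \<bullet> v k i))"
  proof (rule sum_mono)
    fix i assume "i \<in> {1..N k}"
    then have "0 < 1 + a k \<bullet> v k i" using elim(2) by (simp add: lagrange_solution_def)
    then show "ln (1 + a k \<bullet> v k i) \<le> ln (1 + \<eta> + a k \<bullet> v k i)" using assms(3) by simp
  qed
  then have "- (\<Sum>i=1..N k. ln (1 + \<eta> + a k \<bullet> v k i)) / real (N k) \<le> obj k"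
    unfolding obj_def by (intro divide_right_mono) auto
  then show ?case using elim(1) by linarith
qed

text \<open>The discrete constraints hold only at the points \<open>v k i\<close>. Every
  \<open>f t\<close> has such points within \<open>\<epsilon> / A\<close> for large
  \<open>k\<close>, where \<open>A\<close> bounds the multipliers, so its constraint is violated by
  at most \<epsilon>.\<close>

lemma limit_in_K_bar:
  assumes l: "a \<longlonglongrightarrow> l"
  shows "l \<in> K_bar f"
  unfolding K_bar_def
proof (intro CollectI ballI)
  fix t :: real assume t: "t \<in> {0..1}"
  obtain A where A: "A > 0" "\<And>k. norm (a k) \<le> A"
    using l by (meson Bseq_def convergentI convergent_imp_Bseq)
  show "0 \<le> 1 + l \<bullet> f t"
  proof (rule field_le_epsilon)
    fix \<epsilon> :: real assume \<epsilon>: "\<epsilon> > 0"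
    have "(\<lambda>k. 1 + a k \<bullet> f t) \<longlonglongrightarrow> 1 + l \<bullet> f t" by (intro tendsto_intros l)
    moreover have "\<forall>\<^sub>F k in sequentially. - \<epsilon> \<le> 1 + a k \<bullet> f t"
      using eventually_close[of "\<epsilon> / A", OF divide_pos_pos[OF \<epsilon> A(1)]] mult
    proof eventually_elim
      case (elim k)
      then obtain i where i: "i \<in> {1..N k}" "norm (v k i - f t) < \<epsilon> / A" using t by blast
      have "a k \<bullet> (v k i - f t) \<le> norm (a k) * norm (v k i - f t)" by (rule norm_cauchy_schwarz)
      also have "\<dots> \<le> A * (\<epsilon> / A)" using A(2)[of k] A(1) i(2) by (intro mult_mono) auto
      finally have "a k \<bullet> (v k i - f t) \<le> \<epsilon>" using A(1) by simp
      moreover have "0 < 1 + a k \<bullet> v k i" using elim(2) i(1) by (simp add: lagrange_solution_def)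
      ultimately show ?case by (simp add: inner_diff_right)
    qed
    ultimately have "- \<epsilon> \<le> 1 + l \<bullet> f t" by (intro tendsto_lowerbound) auto
    then show "0 \<le> 1 + l \<bullet> f t + \<epsilon>" by simp
  qed
qed

text \<open>For each fixed \<eta> the objective is eventually above any number below
  \<open>g_reg f \<eta> l\<close> and eventually below any number above \<open>m\<close>. Hence
  every regularisation at \<open>l\<close> is at most \<open>m\<close>, so \<open>l\<close> is a
  minimiser and uniqueness applies.\<close>

lemma limit_eq_minimizer:
  assumes l: "a \<longlonglongrightarrow> l"
  shows "l = y"
proof -
  note lK = limit_in_K_bar[OF l]
  have "g_reg f \<eta> l \<le> m" if "\<eta> > 0" for \<eta>
  proof (rule ccontr)
    assume "\<not> ?thesis"
    then obtain r where r: "m < r" "r < g_reg f \<eta> l" using dense by (meson not_le)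
    have "\<forall>\<^sub>F k in sequentially. r < obj k \<and> obj k < m + (r - m)"
      by (intro eventually_conj obj_lower[OF l lK that r(2)] obj_upper) (use r in simp)
    then obtain k where "r < obj k \<and> obj k < m + (r - m)" by (auto simp: eventually_sequentially)
    then show False by linarith
  qed
  then have "g_fun f l \<le> g_fun f y" by (simp add: m g_fun_le_iff[OF cont lK])
  then have "is_g_minimizer f l"
    using lK is_g_minimizerD[OF y] by (auto simp: is_g_minimizer_def is_arg_min_def not_less intro: order_trans)
  then show ?thesis using y by (rule g_minimizer_unique[OF cont span])
qed

lemma eventually_bounded: obtains R where "\<forall>\<^sub>F k in sequentially. norm (a k) \<le> R"
proof -
  obtain \<epsilon> where \<epsilon>: "\<epsilon> > 0"
    "\<forall>\<^sub>F k in sequentially. \<forall>a. a \<noteq> 0 \<longrightarrow> (\<exists>i\<in>{1..N k}. a \<bullet> v k i < - \<epsilon> * norm a)"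
    by (rule eventually_negative_direction)
  from \<epsilon>(2) mult have "\<forall>\<^sub>F k in sequentially. norm (a k) \<le> 1 / \<epsilon>"
  proof eventually_elim
    case (elim k)
    show ?case
    proof (cases "a k = 0")
      case False
      then obtain i where "i \<in> {1..N k}" "a k \<bullet> v k i < - \<epsilon> * norm (a k)" using elim(1) by blast
      moreover from this have "0 < 1 + a k \<bullet> v k i" using elim(2) by (simp add: lagrange_solution_def)
      ultimately have "\<epsilon> * norm (a k) \<le> 1" by linarith
      then show ?thesis using \<epsilon>(1) by (simp add: field_simps)
    qed (use \<epsilon> in simp)
  qed
  then show thesis by (rule that)
qed

text \<open>A subsequence staying away from \<open>y\<close> is bounded, hence has a convergent
  further subsequence. Instantiating the locale along it identifies the limit as \<open>y\<close>, a
  contradiction.\<close>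

lemma multipliers_tendsto: "a \<longlonglongrightarrow> y"
proof (rule ccontr)
  assume "\<not> ?thesis"
  then obtain d where d: "d > 0" "\<not> (\<forall>\<^sub>F k in sequentially. dist (a k) y < d)"
    by (auto simp: tendsto_iff)
  obtain R where R: "\<forall>\<^sub>F k in sequentially. norm (a k) \<le> R" using eventually_bounded by metis
  then obtain k0 where k0: "\<And>k. k \<ge> k0 \<Longrightarrow> norm (a k) \<le> R" by (auto simp: eventually_sequentially)
  have "infinite {k. k \<ge> k0 \<and> d \<le> dist (a k) y}"
    unfolding infinite_nat_iff_unbounded_le
  proof
    fix j
    obtain k where "k \<ge> max j k0" "\<not> dist (a k) y < d" using d(2) unfolding eventually_sequentially by blast
    then show "\<exists>n\<ge>j. n \<in> {k. k \<ge> k0 \<and> d \<le> dist (a k) y}" by (intro exI[of _ k]) auto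
  qed
  from infinite_enumerate[OF this]
  obtain r :: "nat \<Rightarrow> nat" where "strict_mono r \<and> (\<forall>n. r n \<in> {k. k \<ge> k0 \<and> d \<le> dist (a k) y})" ..
  then have r: "strict_mono r" "r n \<ge> k0" "d \<le> dist (a (r n)) y" for n by simp_all
  have "\<forall>n. (a \<circ> r) n \<in> cball 0 R" using r(2) k0 by simp
  then obtain l s where s: "strict_mono s" "((a \<circ> r) \<circ> s) \<longlonglongrightarrow> l"
    using compact_cball[of "0::real^'n" R] unfolding compact_def by metis
  have rs: "strict_mono (r \<circ> s)" using r(1) s(1) by (rule strict_mono_o)
  interpret sub: approximating_points f "N \<circ> (r \<circ> s)" "v \<circ> (r \<circ> s)" "e \<circ> (r \<circ> s)" by (rule subseq[OF rs])
  interpret sub: approximating_multipliers f "N \<circ> (r \<circ> s)" "v \<circ> (r \<circ> s)" "e \<circ> (r \<circ> s)" "a \<circ> (r \<circ> s)" y m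
  proof
    show "\<forall>\<^sub>F k in sequentially. lagrange_solution ((N \<circ> (r \<circ> s)) k) ((v \<circ> (r \<circ> s)) k) ((a \<circ> (r \<circ> s)) k)"
      using eventually_subseq[OF rs mult] by simp
  qed (fact y m)+
  have "(a \<circ> (r \<circ> s)) \<longlonglongrightarrow> l" using s(2) by (simp add: o_assoc)
  then have "(a \<circ> (r \<circ> s)) \<longlonglongrightarrow> y" using sub.limit_eq_minimizer by simp
  then have "(\<lambda>n. dist ((a \<circ> (r \<circ> s)) n) y) \<longlonglongrightarrow> 0" by (rule tendsto_dist_iff[THEN iffD1])
  then have "d \<le> 0" by (rule tendsto_lowerbound) (use r(3) in auto)
  then show False using d(1) by simp
qed

lemma obj_tendsto: "obj \<longlonglongrightarrow> m"
proof (rule order_tendstoI)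
  fix r assume "m < r"
  then show "\<forall>\<^sub>F k in sequentially. obj k < r" using obj_upper[of "r - m"] by simp
next
  fix r assume r: "r < m"
  have "\<not> g_fun f y \<le> ereal r" using r by (simp add: m)
  then obtain \<eta> where "\<eta> > 0" "r < g_reg f \<eta> y"
    unfolding g_fun_le_iff[OF cont y_in_K] by (auto simp: not_le)
  then show "\<forall>\<^sub>F k in sequentially. r < obj k"
    by (rule obj_lower[OF multipliers_tendsto y_in_K])
qed

end

section \<open>The empirical likelihood and its multiplier\<close>

text \<open>The uniform margin \<epsilon> is the radius of a ball inside the hull: a hyperplane
  separating a point of the ball from the hull would have a normal along which every point of
  \<open>P\<close> stays above that margin.\<close>

lemma zero_in_interior_convex_hull:
  fixes P :: "'a::euclidean_space set"
  assumes P: "finite P" and neg: "\<And>a. a \<noteq> 0 \<Longrightarrow> \<exists>p\<in>P. a \<bullet> p < 0"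
  shows "0 \<in> interior (convex hull P)"
proof -
  obtain \<epsilon> where \<epsilon>: "\<epsilon> > 0" "\<And>a. a \<noteq> 0 \<Longrightarrow> \<exists>p\<in>P. a \<bullet> p < - \<epsilon> * norm a"
    using negative_direction_uniform[OF neg] by metis
  have "ball 0 \<epsilon> \<subseteq> convex hull P"
  proof
    fix z :: 'a assume z: "z \<in> ball 0 \<epsilon>"
    show "z \<in> convex hull P"
    proof (rule ccontr)
      assume "z \<notin> convex hull P"
      moreover have "closed (convex hull P)"
        using P by (intro compact_imp_closed compact_convex_hull finite_imp_compact)
      ultimately obtain a b where ab: "a \<bullet> z < b" "\<forall>x\<in>convex hull P. b < a \<bullet> x"
        using separating_hyperplane_closed_point[OF convex_convex_hull] by blast
      show False
      proof (cases "a = 0")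
        \<comment> \<open>A zero normal would only separate from an empty hull, so a point of
          \<open>P\<close> has to be produced.\<close>
        case True
        obtain w :: 'a where "w \<noteq> 0" using nonzero_Basis nonempty_Basis by (metis ex_in_conv)
        then obtain p where "p \<in> P" using neg by blast
        then have "p \<in> convex hull P" by (rule hull_inc)
        then show False using ab True by fastforce
      next
        case False
        then obtain p where p: "p \<in> P" "a \<bullet> p < - \<epsilon> * norm a" using \<epsilon>(2) by blast
        have "b < a \<bullet> p" using ab(2) hull_inc[OF p(1)] by blast
        moreover have "- (norm a * \<epsilon>) \<le> a \<bullet> z"
          using Cauchy_Schwarz_ineq2[of a z] mult_left_mono[of "norm z" \<epsilon> "norm a"] z by (simp add: abs_le_iff)
        ultimately show False using ab(1) p(2) by (simp add: mult.commute)
      qed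
    qed
  qed
  then show ?thesis using \<epsilon>(1) by (intro interiorI[of "ball 0 \<epsilon>"]) auto
qed

lemma sum_ln_eq_ln_prod:
  assumes "finite A" "\<And>i. i \<in> A \<Longrightarrow> 0 < (q i :: real)"
  shows "(\<Sum>i\<in>A. ln (q i)) = ln (\<Prod>i\<in>A. q i)"
proof (rule ln_prod[symmetric])
  show "q i \<noteq> 0" if "i \<in> A" for i using assms(2)[OF that] by simp
qed (fact assms(1))

text \<open>Lagrange duality: for competing weights \<open>q\<close>,
  \<open>\<Sum>i. ln (q i / p i)\<close> is at most \<open>\<Sum>i. (q i / p i - 1)\<close>, and the
  two constraints on \<open>q\<close> make that sum 0.\<close>

lemma ebel_L_eq_prod:
  fixes x :: "nat \<Rightarrow> real^'n"
  assumes n: "n \<ge> 1" and l: "lagrange_solution n (ebel_T w n x \<mu>) l"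
  shows "ebel_L w n x \<mu> = (\<Prod>i=1..n. 1 / (real n * (1 + l \<bullet> ebel_T w n x \<mu> i)))"
proof -
  define T where "T = ebel_T w n x \<mu>"
  define p where "p i = 1 / (real n * (1 + l \<bullet> T i))" for i
  have pos: "0 < 1 + l \<bullet> T i" if "i \<in> {1..n}" for i using l that by (simp add: lagrange_solution_def T_def)
  have p0: "0 < p i" if "i \<in> {1..n}" for i using pos[OF that] n by (simp add: p_def)
  have pT: "(\<Sum>i=1..n. p i *\<^sub>R T i) = 0"
  proof -
    have "(\<Sum>i=1..n. p i *\<^sub>R T i) = (1 / real n) *\<^sub>R (\<Sum>i=1..n. (1 / (1 + l \<bullet> T i)) *\<^sub>R T i)"
      by (simp add: scaleR_sum_right p_def)
    also have "(\<Sum>i=1..n. (1 / (1 + l \<bullet> T i)) *\<^sub>R T i) = 0"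
      using l by (simp add: lagrange_solution_def T_def)
    finally show ?thesis by simp
  qed
  \<comment> \<open>Normalisation follows from the multiplier equation:
    \<open>p i * (1 + l \<bullet> T i) = 1 / n\<close>, and the weighted sum of the
    \<open>T i\<close> vanishes.\<close>
  have "(\<Sum>i=1..n. p i) + l \<bullet> (\<Sum>i=1..n. p i *\<^sub>R T i) = (\<Sum>i=1..n. p i * (1 + l \<bullet> T i))"
    by (simp add: inner_sum_right sum.distrib distrib_left)
  also have "\<dots> = (\<Sum>i=1..n. 1 / real n)"
    by (intro sum.cong refl) (use pos n in \<open>auto simp: p_def less_imp_neq[symmetric]\<close>)
  also have "\<dots> = 1" using n by simp
  finally have p1: "(\<Sum>i=1..n. p i) = 1" by (simp only: pT inner_zero_right add_0_right)
  have pW: "p \<in> ebel_weights w n x \<mu>"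
    using p0 p1 pT by (simp add: ebel_weights_def T_def less_imp_le)
  have "(\<Prod>i=1..n. q i) \<le> (\<Prod>i=1..n. p i)" if q: "q \<in> ebel_weights w n x \<mu>" for q
  proof (cases "\<forall>i\<in>{1..n}. 0 < q i")
    case True
    have "(\<Sum>i=1..n. ln (q i) - ln (p i)) \<le> (\<Sum>i=1..n. real n * (q i * (1 + l \<bullet> T i)) - 1)"
    proof (rule sum_mono)
      fix i assume i: "i \<in> {1..n}"
      have qp: "0 < q i" "0 < p i" using True p0 i by blast+
      then have "ln (q i) - ln (p i) = ln (q i / p i)" by (simp add: ln_div)
      also have "\<dots> \<le> q i / p i - 1" using qp by (intro ln_le_minus_one) simp
      also have "q i / p i = real n * (q i * (1 + l \<bullet> T i))" by (simp add: p_def)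
      finally show "ln (q i) - ln (p i) \<le> real n * (q i * (1 + l \<bullet> T i)) - 1" .
    qed
    also have "\<dots> = real n * ((\<Sum>i=1..n. q i) + l \<bullet> (\<Sum>i=1..n. q i *\<^sub>R T i)) - real n"
      by (simp add: inner_sum_right sum.distrib sum_subtractf distrib_left sum_distrib_left)
    also have "\<dots> = 0" using q by (simp add: ebel_weights_def T_def)
    finally have "ln (\<Prod>i=1..n. q i) \<le> ln (\<Prod>i=1..n. p i)"
      using True p0 by (simp only: sum_subtractf sum_ln_eq_ln_prod finite_atLeastAtMost)
    moreover have "0 < (\<Prod>i=1..n. q i)" "0 < (\<Prod>i=1..n. p i)"
      using True p0 by (intro prod_pos; blast)+
    ultimately show ?thesis by simp
  next
    case False
    then obtain i where i: "i \<in> {1..n}" "\<not> 0 < q i" by blast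
    moreover have "0 \<le> q i" using q i(1) by (simp add: ebel_weights_def)
    ultimately have "q i = 0" by linarith
    then have "\<exists>i\<in>{1..n}. q i = 0" using i(1) by blast
    then have "(\<Prod>i=1..n. q i) = 0" by (intro prod_zero) auto
    also have "\<dots> \<le> (\<Prod>i=1..n. p i)" using p0 by (intro prod_nonneg) (auto intro: less_imp_le)
    finally show ?thesis .
  qed
  then have "(SUP q\<in>ebel_weights w n x \<mu>. \<Prod>i=1..n. q i) = (\<Prod>i=1..n. p i)"
    using pW by (intro cSup_eq_maximum) auto
  then show ?thesis using pW by (auto simp: ebel_L_def p_def T_def)
qed

lemma neg_log_ebel_R:
  fixes x :: "nat \<Rightarrow> real^'n"
  assumes n: "n \<ge> 1" and l: "lagrange_solution n (ebel_T w n x \<mu>) l"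
  shows "- (ereal (1 / real n) * elog (ebel_R w n x \<mu>)) =
    ereal ((\<Sum>i=1..n. ln (1 + l \<bullet> ebel_T w n x \<mu> i)) / real n)"
proof -
  have pos: "0 < 1 + l \<bullet> ebel_T w n x \<mu> i" if "i \<in> {1..n}" for i
    using l that by (simp add: lagrange_solution_def)
  have "ebel_R w n x \<mu> = (\<Prod>i=1..n. real n) * (\<Prod>i=1..n. 1 / (real n * (1 + l \<bullet> ebel_T w n x \<mu> i)))"
    unfolding ebel_R_def ebel_L_eq_prod[OF n l] by simp
  also have "\<dots> = (\<Prod>i=1..n. inverse (1 + l \<bullet> ebel_T w n x \<mu> i))"
    unfolding prod.distrib[symmetric] using n by (intro prod.cong refl) (simp add: divide_simps)
  finally have R: "ebel_R w n x \<mu> = (\<Prod>i=1..n. inverse (1 + l \<bullet> ebel_T w n x \<mu> i))" .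
  have R0: "0 < ebel_R w n x \<mu>" unfolding R using pos by (intro prod_pos) auto
  have "ln (ebel_R w n x \<mu>) = (\<Sum>i=1..n. ln (inverse (1 + l \<bullet> ebel_T w n x \<mu> i)))"
    unfolding R using pos by (intro sum_ln_eq_ln_prod[symmetric]) auto
  also have "\<dots> = (\<Sum>i=1..n. - ln (1 + l \<bullet> ebel_T w n x \<mu> i))"
    by (simp add: ln_inverse)
  finally show ?thesis using R0 by (simp add: elog_def sum_negf)
qed

lemma ebel_multiplier_lagrange:
  fixes x :: "nat \<Rightarrow> real^'n"
  assumes n: "n \<ge> 1" and m: "ebel_multiplier w n x \<mu> l"
    and neg: "\<And>a. a \<noteq> 0 \<Longrightarrow> \<exists>i\<in>{1..n}. a \<bullet> ebel_T w n x \<mu> i < 0"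
  shows "lagrange_solution n (ebel_T w n x \<mu>) l"
proof -
  have "0 \<in> interior (convex hull (ebel_T w n x \<mu> ` {1..n}))"
    by (rule zero_in_interior_convex_hull) (use neg in auto)
  then have *: "\<And>i. i \<in> {1..n} \<Longrightarrow> 0 < 1 / (real n * (1 + l \<bullet> ebel_T w n x \<mu> i))"
    "(\<Sum>i=1..n. (1 / (real n * (1 + l \<bullet> ebel_T w n x \<mu> i))) *\<^sub>R ebel_T w n x \<mu> i) = 0"
    using m by (auto simp: ebel_multiplier_def)
  have "(1 / real n) *\<^sub>R (\<Sum>i=1..n. (1 / (1 + l \<bullet> ebel_T w n x \<mu> i)) *\<^sub>R ebel_T w n x \<mu> i) = 0"
    using *(2) by (simp add: scaleR_sum_right)
  then show ?thesis
    using *(1) n by (auto simp: lagrange_solution_def zero_less_divide_iff zero_less_mult_iff)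
qed

section \<open>Measurability and path continuity\<close>

lemma ebel_weights_le_one:
  assumes "p \<in> ebel_weights w n x \<mu>" "i \<in> {1..n}"
  shows "p i \<le> 1"
proof -
  have "p i \<le> (\<Sum>i=1..n. p i)"
    using assms by (intro member_le_sum) (auto simp: ebel_weights_def)
  then show ?thesis using assms(1) by (simp add: ebel_weights_def)
qed

lemma bdd_above_ebel_prod: "bdd_above ((\<lambda>p. \<Prod>i=1..n. p i) ` ebel_weights w n x \<mu>)"
proof (rule bdd_aboveI2)
  fix p assume p: "p \<in> ebel_weights w n x \<mu>"
  show "(\<Prod>i=1..n. p i) \<le> 1"
    using p ebel_weights_le_one[OF p] by (intro prod_le_1) (auto simp: ebel_weights_def)
qed

lemma ebel_L_nonneg: "0 \<le> ebel_L w n x \<mu>"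
proof (cases "ebel_weights w n x \<mu> = {}")
  case False
  then obtain p where p: "p \<in> ebel_weights w n x \<mu>" by blast
  have "0 \<le> (\<Prod>i=1..n. p i)" using p by (intro prod_nonneg) (auto simp: ebel_weights_def)
  also have "\<dots> \<le> (SUP p\<in>ebel_weights w n x \<mu>. \<Prod>i=1..n. p i)"
    by (rule cSUP_upper[OF p bdd_above_ebel_prod])
  finally show ?thesis using False by (simp add: ebel_L_def)
qed (simp add: ebel_L_def)

lemma tendsto_fun_component:
  fixes x :: "nat \<Rightarrow> 'i::countable \<Rightarrow> 'b::metric_space"
  assumes "x \<longlonglongrightarrow> l" shows "(\<lambda>k. x k i) \<longlonglongrightarrow> l i"
  using continuous_on_tendsto_compose[of UNIV "\<lambda>x. x i", OF continuous_on_product_coordinates assms] by simp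

text \<open>
  \<open>ebel_L\<close> is upper semicontinuous in the data, by compactness of the simplex of weights.
\<close>

lemma closed_ebel_L_ge:
  fixes \<mu> :: "real^'n"
  assumes c: "c > 0"
  shows "closed {x :: nat \<Rightarrow> real^'n. c \<le> ebel_L w n x \<mu>}"
  unfolding closed_sequential_limits
proof (intro allI impI, elim conjE)
  fix x :: "nat \<Rightarrow> nat \<Rightarrow> real^'n" and l
  assume x: "\<forall>k. x k \<in> {x. c \<le> ebel_L w n x \<mu>}" and lim: "x \<longlonglongrightarrow> l"
  \<comment> \<open>Admissible weights are unrestricted off \<open>{1..n}\<close>. Fixing them to 0
    there leaves a compact product without changing the objective.\<close>
  define K where "K = PiE UNIV (\<lambda>i. if i \<in> {1..n} then {0..1::real} else {0})"
  have "compactin (product_topology (\<lambda>_. euclidean) UNIV) K"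
    unfolding K_def compactin_PiE by (auto simp: compact_Icc)
  then have cK: "compact K" by (simp add: euclidean_product_topology)
  have "\<exists>p\<in>K \<inter> ebel_weights w n (x k) \<mu>. c - inverse (real (Suc k)) < (\<Prod>i=1..n. p i)" for k
  proof -
    have ne: "ebel_weights w n (x k) \<mu> \<noteq> {}" and ge: "c \<le> (SUP p\<in>ebel_weights w n (x k) \<mu>. \<Prod>i=1..n. p i)"
      using x[rule_format, of k] c by (auto simp: ebel_L_def split: if_splits)
    have "c - inverse (real (Suc k)) < c" by simp
    also note ge
    finally obtain p where p: "p \<in> ebel_weights w n (x k) \<mu>" "c - inverse (real (Suc k)) < (\<Prod>i=1..n. p i)"
      unfolding less_cSUP_iff[OF ne bdd_above_ebel_prod] by blast
    define q where "q i = (if i \<in> {1..n} then p i else 0)" for i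
    have "q \<in> ebel_weights w n (x k) \<mu>" using p(1) by (simp add: ebel_weights_def q_def)
    moreover have "(\<Prod>i=1..n. q i) = (\<Prod>i=1..n. p i)" by (simp add: q_def)
    moreover have "q \<in> K" using p(1) ebel_weights_le_one[OF p(1)] by (auto simp: K_def q_def ebel_weights_def)
    ultimately show ?thesis using p(2) by (intro bexI[of _ q]) auto
  qed
  then obtain p where p: "\<And>k. p k \<in> K" "\<And>k. p k \<in> ebel_weights w n (x k) \<mu>"
    "\<And>k. c - inverse (real (Suc k)) < (\<Prod>i=1..n. p k i)" by (metis IntE)
  obtain q r where q: "q \<in> K" "strict_mono r" "(p \<circ> r) \<longlonglongrightarrow> q"
    using cK p(1) unfolding compact_def by metis
  have plim: "(\<lambda>k. p (r k) i) \<longlonglongrightarrow> q i" for i using tendsto_fun_component[OF q(3), of i] by simp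
  have xlim: "(\<lambda>k. x (r k) i) \<longlonglongrightarrow> l i" for i
    using tendsto_fun_component[OF LIMSEQ_subseq_LIMSEQ[OF lim q(2)], of i] by simp
  have "q \<in> ebel_weights w n l \<mu>"
    unfolding ebel_weights_def
  proof (intro CollectI conjI ballI)
    show "0 \<le> q i" if "i \<in> {1..n}" for i
      by (rule LIMSEQ_le_const[OF plim]) (use p(2) that in \<open>auto simp: ebel_weights_def\<close>)
    have "(\<lambda>k. \<Sum>i=1..n. p (r k) i) \<longlonglongrightarrow> (\<Sum>i=1..n. q i)" by (intro tendsto_sum plim)
    moreover have "(\<Sum>i=1..n. p (r k) i) = 1" for k using p(2)[of "r k"] by (simp add: ebel_weights_def)
    ultimately show "(\<Sum>i=1..n. q i) = 1" by (simp add: LIMSEQ_const_iff)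
    have "(\<lambda>k. \<Sum>i=1..n. p (r k) i *\<^sub>R ebel_T w n (x (r k)) \<mu> i) \<longlonglongrightarrow> (\<Sum>i=1..n. q i *\<^sub>R ebel_T w n l \<mu> i)"
      unfolding ebel_T_def by (intro tendsto_intros plim xlim)
    moreover have "(\<Sum>i=1..n. p (r k) i *\<^sub>R ebel_T w n (x (r k)) \<mu> i) = 0" for k
      using p(2)[of "r k"] by (simp add: ebel_weights_def)
    ultimately show "(\<Sum>i=1..n. q i *\<^sub>R ebel_T w n l \<mu> i) = 0" by (simp add: LIMSEQ_const_iff)
  qed
  moreover have "c \<le> (\<Prod>i=1..n. q i)"
  proof (rule LIMSEQ_le)
    show "(\<lambda>k. \<Prod>i=1..n. p (r k) i) \<longlonglongrightarrow> (\<Prod>i=1..n. q i)" by (intro tendsto_prod plim)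
    have "(\<lambda>k. c - inverse (real (Suc k))) \<longlonglongrightarrow> c - 0" by (intro tendsto_intros LIMSEQ_inverse_real_of_nat)
    from LIMSEQ_subseq_LIMSEQ[OF this q(2)] show "(\<lambda>k. c - inverse (real (Suc (r k)))) \<longlonglongrightarrow> c" by (simp add: o_def)
  qed (use p(3) in \<open>auto intro: less_imp_le\<close>)
  ultimately show "l \<in> {x. c \<le> ebel_L w n x \<mu>}"
    using cSUP_upper[OF _ bdd_above_ebel_prod, of q w n l \<mu>] by (auto simp: ebel_L_def)
qed

text \<open>Superlevel sets at positive levels are closed. At levels \<open>c \<le> 0\<close> they
  are the whole space, since an empty constraint set has value 0.\<close>

lemma borel_measurable_ebel_R:
  fixes x :: "'a \<Rightarrow> nat \<Rightarrow> real^'n"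
  assumes "\<And>j. (\<lambda>\<omega>. x \<omega> j) \<in> borel_measurable M"
  shows "(\<lambda>\<omega>. ebel_R w n (x \<omega>) \<mu>) \<in> borel_measurable M"
proof -
  have "(\<lambda>x :: nat \<Rightarrow> real^'n. ebel_L w n x \<mu>) \<in> borel_measurable borel"
  proof (rule borel_measurableI_ge)
    fix c :: real
    show "{x :: nat \<Rightarrow> real^'n \<in> space borel. c \<le> ebel_L w n x \<mu>} \<in> sets borel"
    proof (cases "c > 0")
      case True
      from borel_closed[OF closed_ebel_L_ge[OF this]] show ?thesis by simp
    next
      case False
      then have "c \<le> ebel_L w n x \<mu>" for x :: "nat \<Rightarrow> real^'n"
        using ebel_L_nonneg[of w n x \<mu>] by linarith
      then show ?thesis by simp
    qed
  qed
  moreover have "x \<in> borel_measurable M"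
    by (rule measurable_coordinatewise_then_product[OF assms])
  ultimately have "(\<lambda>\<omega>. ebel_L w n (x \<omega>) \<mu>) \<in> borel_measurable M"
    by (rule measurable_compose[rotated])
  then show ?thesis unfolding ebel_R_def by (intro borel_measurable_times borel_measurable_const)
qed

text \<open>Freezing time at the preceding grid point gives a countable case distinction between
  single-time variables, and path continuity passes to the limit. Joint measurability is what makes
  the time integrals in \<open>g_fun\<close> measurable in the outcome. Time is clamped because
  nothing is known of \<open>B\<close> outside the interval.\<close>

lemma borel_measurable_joint:
  fixes B :: "real \<Rightarrow> 'b \<Rightarrow> 'c::{second_countable_topology, metric_space}"
  assumes meas: "\<And>t. t \<in> {0..1} \<Longrightarrow> B t \<in> borel_measurable N"
    and cont: "\<And>\<omega>. \<omega> \<in> space N \<Longrightarrow> continuous_on {0..1} (\<lambda>t. B t \<omega>)"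
  shows "(\<lambda>(\<omega>, t). B (max 0 (min 1 t)) \<omega>) \<in> borel_measurable (N \<Otimes>\<^sub>M borel)"
proof (rule borel_measurable_LIMSEQ_metric)
  define h where "h n i = min 1 (real i / real (Suc n))" for n i
  define ix where "ix n t = nat \<lfloor>real (Suc n) * max 0 (min 1 t)\<rfloor>" for n and t :: real
  have h01: "h n i \<in> {0..1}" for n i by (simp add: h_def)
  show "(\<lambda>(\<omega>, t). B (h n (ix n t)) \<omega>) \<in> borel_measurable (N \<Otimes>\<^sub>M borel)" for n
  proof -
    have "(\<lambda>p. B (h n i) (fst p)) \<in> borel_measurable (N \<Otimes>\<^sub>M borel)" for i
      by (rule measurable_compose[OF measurable_fst meas[OF h01]])
    moreover have "(\<lambda>p. ix n (snd p)) \<in> measurable (N \<Otimes>\<^sub>M borel) (count_space UNIV)"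
      unfolding ix_def by measurable
    ultimately have "(\<lambda>p. B (h n (ix n (snd p))) (fst p)) \<in> borel_measurable (N \<Otimes>\<^sub>M borel)"
      by (rule measurable_compose_countable[where f="\<lambda>i p. B (h n i) (fst p)"])
    then show ?thesis by (simp add: split_beta)
  qed
  fix p assume p: "p \<in> space (N \<Otimes>\<^sub>M (borel :: real measure))"
  then have \<omega>: "fst p \<in> space N" by (auto simp: space_pair_measure)
  define s where "s = max 0 (min 1 (snd p))"
  have s: "s \<in> {0..1}" by (simp add: s_def)
  have bound: "\<bar>h n (ix n (snd p)) - s\<bar> \<le> inverse (real (Suc n))" for n
  proof -
    define j where "j = ix n (snd p)"
    have "0 \<le> real (Suc n) * s" using s by simp
    then have j: "real j \<le> real (Suc n) * s" "real (Suc n) * s < real j + 1"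
      unfolding j_def ix_def s_def[symmetric] by linarith+
    have "real j / real (Suc n) \<le> s" "s < real j / real (Suc n) + inverse (real (Suc n))"
      using j by (simp_all add: divide_simps mult.commute del: of_nat_Suc) 
    then show ?thesis using s unfolding h_def j_def[symmetric] by auto
  qed
  have "(\<lambda>n. h n (ix n (snd p)) - s) \<longlonglongrightarrow> 0"
    by (rule Lim_null_comparison[OF _ LIMSEQ_inverse_real_of_nat]) (use bound in auto)
  then have "(\<lambda>n. h n (ix n (snd p))) \<longlonglongrightarrow> s" by (simp add: LIM_zero_iff)
  then have "(\<lambda>n. B (h n (ix n (snd p))) (fst p)) \<longlonglongrightarrow> B s (fst p)"
    by (rule continuous_on_tendsto_compose[OF cont[OF \<omega>]]) (use h01 s in auto)
  then show "(\<lambda>n. case p of (\<omega>, t) \<Rightarrow> B (h n (ix n t)) \<omega>) \<longlonglongrightarrow> (case p of (\<omega>, t) \<Rightarrow> B (max 0 (min 1 t)) \<omega>)"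
    by (simp add: split_beta s_def)
qed

lemma borel_measurable_g_fun:
  fixes f :: "'b \<Rightarrow> real \<Rightarrow> real^'n"
  assumes meas: "\<And>t. t \<in> {0..1} \<Longrightarrow> (\<lambda>\<omega>. f \<omega> t) \<in> borel_measurable N"
    and cont: "\<And>\<omega>. \<omega> \<in> space N \<Longrightarrow> continuous_on {0..1} (f \<omega>)"
    and Y [measurable]: "Y \<in> borel_measurable N"
  shows "(\<lambda>\<omega>. g_fun (f \<omega>) (Y \<omega>)) \<in> borel_measurable N"
proof -
  have [measurable]: "(\<lambda>(\<omega>, t). f \<omega> (max 0 (min 1 t))) \<in> borel_measurable (N \<Otimes>\<^sub>M lborel)"
    using borel_measurable_joint[of "\<lambda>t \<omega>. f \<omega> t" N, OF meas cont] by simp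
  have eq: "g_fun (f \<omega>) (Y \<omega>) =
     enn2ereal (\<integral>\<^sup>+t\<in>{0..1}. e2ennreal (- elog (1 + Y \<omega> \<bullet> f \<omega> (max 0 (min 1 t)))) \<partial>lborel) -
     enn2ereal (\<integral>\<^sup>+t\<in>{0..1}. e2ennreal (elog (1 + Y \<omega> \<bullet> f \<omega> (max 0 (min 1 t)))) \<partial>lborel)" for \<omega>
    unfolding g_fun_def
    by (intro arg_cong2[where f=minus] arg_cong[where f=enn2ereal] nn_integral_cong)
       (auto simp: indicator_def max_def min_def)
  show ?thesis unfolding eq by measurable
qed

section \<open>The interpolated partial sum path\<close>

lemma partial_sum_path_grid:
  assumes "n \<ge> 1"
  shows "partial_sum_path n x \<mu> (real i / real n) = (\<Sum>j=1..i. x j - \<mu>)"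
  using assms by (simp add: partial_sum_path_def Let_def)

text \<open>Clamped coefficients replace the floor and make continuity in \<open>t\<close> evident.
  The sum reaches \<open>Suc n\<close> because at \<open>t = 1\<close> the interpolation formula
  mentions \<open>x (Suc n)\<close>, with coefficient 0.\<close>

lemma partial_sum_path_eq_sum:
  assumes t: "t \<in> {0..1}"
  shows "partial_sum_path n x \<mu> t =
    (\<Sum>j=1..Suc n. max 0 (min 1 (real n * t - (real j - 1))) *\<^sub>R (x j - \<mu>))"
proof -
  define s where "s = real n * t"
  define k where "k = nat \<lfloor>s\<rfloor>"
  have s: "0 \<le> s" "s \<le> real n" using t by (auto simp: s_def mult_left_le)
  have k: "real k \<le> s" "s < real k + 1" "k \<le> n" using s unfolding k_def by linarith+
  have "(\<Sum>j=1..Suc n. max 0 (min 1 (s - (real j - 1))) *\<^sub>R (x j - \<mu>)) =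
      (\<Sum>j=1..Suc k. max 0 (min 1 (s - (real j - 1))) *\<^sub>R (x j - \<mu>))"
    using k by (intro sum.mono_neutral_right) auto
  also have "\<dots> = (\<Sum>j=1..k. max 0 (min 1 (s - (real j - 1))) *\<^sub>R (x j - \<mu>)) + (s - real k) *\<^sub>R (x (Suc k) - \<mu>)"
    using k by simp
  also have "(\<Sum>j=1..k. max 0 (min 1 (s - (real j - 1))) *\<^sub>R (x j - \<mu>)) = (\<Sum>j=1..k. x j - \<mu>)"
    using k(1) by (intro sum.cong refl) auto
  finally show ?thesis
    unfolding partial_sum_path_def Let_def s_def[symmetric] k_def[symmetric] by simp
qed

lemma continuous_on_partial_sum_path:
  fixes x :: "nat \<Rightarrow> 'c::real_normed_vector"
  shows "continuous_on {0..1} (partial_sum_path n x \<mu>)"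
proof -
  have "continuous_on {0..1} (\<lambda>t. \<Sum>j=1..Suc n. max 0 (min 1 (real n * t - (real j - 1))) *\<^sub>R (x j - \<mu>))"
    by (intro continuous_intros)
  then show ?thesis
    by (rule continuous_on_cong[THEN iffD2, rotated 2]) (auto simp: partial_sum_path_eq_sum simp del: sum.cl_ivl_Suc)
qed

section \<open>The limit theorem\<close>

lemma pos_def_inj: "pos_def S \<Longrightarrow> S *v x = 0 \<Longrightarrow> x = 0"
  unfolding pos_def_def by (metis inner_zero_right less_irrefl)

lemma pos_def_inverse:
  assumes "pos_def S"
  shows "S *v (matrix_inv S *v x) = x" "matrix_inv S *v (S *v x) = x"
proof -
  have "inj ((*v) S)"
    using pos_def_inj[OF assms] by (simp add: matrix_left_invertible_injective[symmetric] matrix_left_invertible_ker)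
  then have "invertible S"
    by (metis invertible_def matrix_left_invertible_injective matrix_left_right_inverse)
  then have "S ** matrix_inv S = mat 1 \<and> matrix_inv S ** S = mat 1"
    unfolding invertible_def matrix_inv_def by (rule someI_ex)
  then show "S *v (matrix_inv S *v x) = x" "matrix_inv S *v (S *v x) = x"
    by (simp_all add: matrix_vector_mul_assoc)
qed

text \<open>Since \<open>T j = sqrt n *\<^sub>R (S *v v j)\<close> and \<open>S\<close> is
  symmetric, the multiplier for \<open>T\<close> becomes, after scaling by \<open>sqrt n\<close> and
  applying \<open>S\<close>, a Lagrange solution for points \<open>v j\<close> that are uniformly
  close to \<open>f\<close> on the grid.\<close>

lemma ebel_limit:
  fixes S :: "real^'n^'n" and w :: "real \<Rightarrow> real" and b :: "real \<Rightarrow> real^'n" and x :: "nat \<Rightarrow> nat \<Rightarrow> real^'n"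
  defines "f \<equiv> \<lambda>t. w t *\<^sub>R b t"
  assumes S: "pos_def S" and w: "continuous_on {0..1} w" and b: "continuous_on {0..1} b"
    and span: "spans_all_directions f" and y: "is_g_minimizer f y"
    and k: "filterlim k at_top sequentially"
    and conv: "(\<lambda>i. path01 (\<lambda>t. (1 / sqrt (real (k i))) *\<^sub>R partial_sum_path (k i) (x i) \<mu> t))
        \<longlonglongrightarrow> path01 (\<lambda>t. S *v b t)"
    and l: "\<And>i. ebel_multiplier w (k i) (x i) \<mu> (l i)"
  shows "(\<lambda>i. sqrt (real (k i)) *\<^sub>R (S *v l i)) \<longlonglongrightarrow> y"
    and "(\<lambda>i. - (ereal (1 / real (k i)) * elog (ebel_R w (k i) (x i) \<mu>))) \<longlonglongrightarrow> - g_fun f y"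
proof -
  have symS: "(S *v u) \<bullet> z = u \<bullet> (S *v z)" for u z
    using S by (simp add: symmetric_matrix_inner pos_def_def)
  have f: "continuous_on {0..1} f" unfolding f_def by (intro continuous_intros w b)
  obtain m where m: "g_fun f y = ereal m" using g_minimizer_finite[OF f y] by metis
  define v where "v i j = w (real j / real (k i)) *\<^sub>R
      (matrix_inv S *v ((1 / sqrt (real (k i))) *\<^sub>R (\<Sum>j=1..j. x i j - \<mu>)))" for i j
  have "bounded (w ` {0..1})" by (intro compact_imp_bounded compact_continuous_image w compact_Icc)
  then obtain W where "\<forall>s\<in>w ` {0..1}. norm s \<le> W" unfolding bounded_iff ..
  then have W: "\<bar>w t\<bar> \<le> W" if "t \<in> {0..1}" for t using that by auto
  have W0: "0 \<le> W" using W[of 0] by simp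
  obtain L where L: "L > 0" "\<And>z. norm (matrix_inv S *v z) \<le> norm z * L"
    using bounded_linear.pos_bounded[OF matrix_vector_mul_bounded_linear[of "matrix_inv S"]] by metis
  define P where "P i t = (1 / sqrt (real (k i))) *\<^sub>R partial_sum_path (k i) (x i) \<mu> t" for i t
  \<comment> \<open>\<open>W\<close> bounds the weight and \<open>L\<close> the operator norm of the
    inverse of \<open>S\<close>, so this dominates the error at all grid points at once.\<close>
  define e where "e i = W * (dist (path01 (P i)) (path01 (\<lambda>t. S *v b t)) * L)" for i
  have Pc: "continuous_on {0..1} (P i)" for i
    unfolding P_def by (intro continuous_intros continuous_on_partial_sum_path)
  have Sbc: "continuous_on {0..1} (\<lambda>t. S *v b t)"
    by (rule bounded_linear.continuous_on[OF matrix_vector_mul_bounded_linear b])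
  interpret approximating_points f k v e
  proof
    have "(\<lambda>i. dist (path01 (P i)) (path01 (\<lambda>t. S *v b t))) \<longlonglongrightarrow> 0"
      using conv unfolding P_def by (rule tendsto_dist_iff[THEN iffD1])
    then have "e \<longlonglongrightarrow> W * (0 * L)" unfolding e_def by (intro tendsto_intros)
    then show "e \<longlonglongrightarrow> 0" by simp
    fix i j assume j: "j \<in> {1..k i}"
    then have ki: "k i \<ge> 1" by simp
    let ?t = "real j / real (k i)"
    have t: "?t \<in> {0..1}" using j by (auto simp: divide_simps)
    have v: "v i j = w ?t *\<^sub>R (matrix_inv S *v P i ?t)"
      by (simp add: v_def P_def partial_sum_path_grid[OF ki])
    have d: "norm (P i ?t - S *v b ?t) \<le> dist (path01 (P i)) (path01 (\<lambda>t. S *v b t))"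
      using dist_path01_le_iff[OF Pc[of i] Sbc] t unfolding dist_norm[symmetric] by blast
    have "f ?t = w ?t *\<^sub>R (matrix_inv S *v (S *v b ?t))"
      by (simp add: f_def pos_def_inverse[OF S])
    then have "v i j - f ?t = w ?t *\<^sub>R (matrix_inv S *v (P i ?t - S *v b ?t))"
      by (simp add: v matrix_vector_mult_diff_distrib scaleR_diff_right)
    then have "norm (v i j - f ?t) = \<bar>w ?t\<bar> * norm (matrix_inv S *v (P i ?t - S *v b ?t))" by simp
    also have "\<dots> \<le> W * (norm (P i ?t - S *v b ?t) * L)"
      using W[OF t] L(2) W0 by (intro mult_mono) auto
    also have "\<dots> \<le> e i"
      unfolding e_def using W0 L(1) d by (intro mult_left_mono mult_right_mono) auto
    finally show "norm (v i j - f ?t) \<le> e i" .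
  qed (fact f span k)+
  define a where "a i = sqrt (real (k i)) *\<^sub>R (S *v l i)" for i
  have T: "ebel_T w (k i) (x i) \<mu> j = sqrt (real (k i)) *\<^sub>R (S *v v i j)" if "k i \<ge> 1" for i j
    using that by (simp add: ebel_T_def v_def matrix_vector_mult_scaleR pos_def_inverse[OF S])
  have lT: "l i \<bullet> ebel_T w (k i) (x i) \<mu> j = a i \<bullet> v i j" if "k i \<ge> 1" for i j
    by (simp add: T[OF that] a_def symS)
  obtain \<epsilon> where \<epsilon>: "\<epsilon> > 0"
    "\<forall>\<^sub>F i in sequentially. \<forall>a. a \<noteq> 0 \<longrightarrow> (\<exists>j\<in>{1..k i}. a \<bullet> v i j < - \<epsilon> * norm a)"
    by (rule eventually_negative_direction)
  from \<epsilon>(2) eventually_N_ge[of 1]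
  \<comment> \<open>The multiplier equation is available only once 0 is interior to the hull, which
    holds for all large indices; the earlier ones do not influence the limits.\<close>
  have lagr: "\<forall>\<^sub>F i in sequentially. 1 \<le> k i \<and> lagrange_solution (k i) (ebel_T w (k i) (x i) \<mu>) (l i)"
  proof eventually_elim
    case (elim i)
    have "\<exists>j\<in>{1..k i}. c \<bullet> ebel_T w (k i) (x i) \<mu> j < 0" if "c \<noteq> 0" for c
    proof -
      have "S *v c \<noteq> 0" using pos_def_inj[OF S] that by blast
      then obtain j where j: "j \<in> {1..k i}" "(S *v c) \<bullet> v i j < - \<epsilon> * norm (S *v c)" using elim(1) by blast
      have "0 \<le> \<epsilon> * norm (S *v c)" using \<epsilon>(1) by simp
      then have "(S *v c) \<bullet> v i j < 0" using j(2) by linarith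
      then have "c \<bullet> ebel_T w (k i) (x i) \<mu> j < 0"
        using elim(2) by (simp add: T[OF elim(2)] symS mult_less_0_iff)
      then show ?thesis using j(1) by blast
    qed
    from ebel_multiplier_lagrange[OF elim(2) l this] elim(2) show ?case by blast
  qed
  interpret approximating_multipliers f k v e a y m
  proof
    show "\<forall>\<^sub>F i in sequentially. lagrange_solution (k i) (v i) (a i)"
      using lagr
    proof eventually_elim
      case (elim i)
      then have ki: "1 \<le> k i" and "lagrange_solution (k i) (ebel_T w (k i) (x i) \<mu>) (l i)" by auto
      then have pos: "\<forall>j\<in>{1..k i}. 0 < 1 + a i \<bullet> v i j"
        and sum0: "(\<Sum>j=1..k i. (1 / (1 + a i \<bullet> v i j)) *\<^sub>R ebel_T w (k i) (x i) \<mu> j) = 0"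
        by (simp_all add: lagrange_solution_def lT)
      have "(\<Sum>j=1..k i. (1 / (1 + a i \<bullet> v i j)) *\<^sub>R ebel_T w (k i) (x i) \<mu> j) =
          S *v (sqrt (real (k i)) *\<^sub>R (\<Sum>j=1..k i. (1 / (1 + a i \<bullet> v i j)) *\<^sub>R v i j))"
        by (simp add: T[OF ki] matrix_vector_mult_scaleR linear_sum[OF matrix_vector_mul_linear] scaleR_sum_right mult.commute)
      from pos_def_inj[OF S trans[OF this[symmetric] sum0]]
      have "sqrt (real (k i)) *\<^sub>R (\<Sum>j=1..k i. (1 / (1 + a i \<bullet> v i j)) *\<^sub>R v i j) = 0"
        .
      then show ?case using ki pos by (simp add: lagrange_solution_def)
    qed
  qed (fact y m)+
  show "(\<lambda>i. sqrt (real (k i)) *\<^sub>R (S *v l i)) \<longlonglongrightarrow> y"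
    using multipliers_tendsto unfolding a_def .
  have "(\<lambda>i. ereal (- obj i)) \<longlonglongrightarrow> ereal (- m)"
    using tendsto_minus[OF obj_tendsto] by simp
  then have "(\<lambda>i. ereal (- obj i)) \<longlonglongrightarrow> - g_fun f y" by (simp add: m)
  then show "(\<lambda>i. - (ereal (1 / real (k i)) * elog (ebel_R w (k i) (x i) \<mu>))) \<longlonglongrightarrow> - g_fun f y"
  proof (rule Lim_transform_eventually)
    show "\<forall>\<^sub>F i in sequentially. ereal (- obj i) = - (ereal (1 / real (k i)) * elog (ebel_R w (k i) (x i) \<mu>))"
      using lagr
    proof eventually_elim
      case (elim i)
      then have ki: "1 \<le> k i" by simp
      show ?case
        unfolding neg_log_ebel_R[OF ki conjunct2[OF elim]] obj_def lT[OF ki] by simp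
    qed
  qed
qed

text \<open>There are finitely many sign patterns, so almost surely all orthants are visited while
  the weight is positive. For given \<open>a\<close>, the orthant with signs opposite to those of
  \<open>a\<close> makes every term of the inner product nonpositive and one of them
  negative.\<close>

lemma weighted_bm_spans_all_directions:
  fixes B :: "real \<Rightarrow> 'b \<Rightarrow> real^'d"
  assumes N: "prob_space N" and B: "standard_bm_vector N B" and w: "weight_function w"
  shows "AE \<omega> in N. spans_all_directions (\<lambda>t. w t *\<^sub>R B t \<omega>)"
proof -
  obtain c where c: "0 < c" "c \<le> 1" "\<And>t. t \<in> {0<..<c} \<Longrightarrow> 0 < w t"
    using w by (auto simp: weight_function_def)
  define sg where "sg s k = (if s k then 1 else - 1 :: real)" for s :: "'d \<Rightarrow> bool" and k
  have "AE \<omega> in N. \<forall>s. \<exists>t\<in>{0<..<c}. \<forall>k. 0 < sg s k * (B t \<omega> $ k)"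
    unfolding AE_all_countable
    by (intro allI standard_bm_vector_visits_orthant[OF N B c(1,2)]) (simp add: sg_def)
  then show ?thesis
  proof eventually_elim
    case (elim \<omega>)
    show ?case
      unfolding spans_all_directions_def
    proof (intro allI impI)
      fix a :: "real^'d" assume "a \<noteq> 0"
      then obtain k0 where k0: "a $ k0 \<noteq> 0" by (auto simp: vec_eq_iff)
      obtain t where t: "t \<in> {0<..<c}" "\<And>k. 0 < sg (\<lambda>k. a $ k < 0) k * (B t \<omega> $ k)"
        using elim by blast
      have le: "a $ k * B t \<omega> $ k \<le> 0" for k
        using t(2)[of k] by (auto simp: sg_def mult_le_0_iff split: if_splits)
      have less: "a $ k0 * B t \<omega> $ k0 < 0"
        using t(2)[of k0] k0 by (auto simp: sg_def mult_less_0_iff split: if_splits)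
      have "a \<bullet> B t \<omega> = (\<Sum>k\<in>UNIV. a $ k * B t \<omega> $ k)" by (simp add: inner_vec_def)
      also have "\<dots> < (\<Sum>k\<in>(UNIV :: 'd set). 0)"
        by (rule sum_strict_mono_ex1) (use le less in auto)
      finally have "a \<bullet> (w t *\<^sub>R B t \<omega>) < 0"
        using c(3)[OF t(1)] by (simp add: mult_less_0_iff)
      then show "\<exists>t\<in>{0..1}. a \<bullet> (w t *\<^sub>R B t \<omega>) < 0" using t(1) c(2) by (intro bexI[of _ t]) auto
    qed
  qed
qed

theorem theorem2:
  fixes M :: "'a measure" and N :: "'b measure"
    and X :: "int \<Rightarrow> 'a \<Rightarrow> real^'d" and \<mu>0 :: "real^'d" and \<Sigma> :: "real^'d^'d"
    and w :: "real \<Rightarrow> real"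
    and B :: "real \<Rightarrow> 'b \<Rightarrow> real^'d"
    and lam :: "nat \<Rightarrow> 'a \<Rightarrow> real^'d"
  defines "xs \<equiv> (\<lambda>\<omega> (j::nat). X (int j) \<omega>)"
    and "f \<equiv> (\<lambda>\<omega> t. w t *\<^sub>R B t \<omega>)"
  assumes "prob_space M" and "prob_space N"
    and "strictly_stationary M X"
    and "\<And>t. integrable M (X t)" and "\<And>t. (\<integral>\<omega>. X t \<omega> \<partial>M) = \<mu>0"
    and "weight_function w"
    and "\<And>t. integrable M (\<lambda>\<omega>. (norm (X t \<omega>))\<^sup>2)"
    and "(\<lambda>m::nat. \<Sum>j\<in>{- int m..int m}. cov_matrix M (X 0) (X j)) \<longlonglongrightarrow> \<Sigma>"
    and "pos_def \<Sigma>"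
    and "standard_bm_vector N B"
    and "conv_in_distr
           M (\<lambda>n \<omega>. path01 (\<lambda>t. (1 / sqrt (real n)) *\<^sub>R partial_sum_path n (xs \<omega>) \<mu>0 t))
           N (\<lambda>\<omega>. path01 (\<lambda>t. mat_sqrt \<Sigma> *v B t \<omega>))"
    and "\<And>n. lam n \<in> borel_measurable M"
    and "\<And>n \<omega>. \<omega> \<in> space M \<Longrightarrow> ebel_multiplier w n (xs \<omega>) \<mu>0 (lam n \<omega>)"
  shows "(AE \<omega> in N. \<exists>!y. is_g_minimizer (f \<omega>) y) \<and>
    (\<forall>Y :: 'b \<Rightarrow> real^'d.
       Y \<in> borel_measurable N \<longrightarrow> (AE \<omega> in N. is_g_minimizer (f \<omega>) (Y \<omega>)) \<longrightarrow>
         conv_in_distr M (\<lambda>n \<omega>. sqrt (real n) *\<^sub>R (mat_sqrt \<Sigma> *v lam n \<omega>)) N Y \<and>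
         conv_in_distr
           M (\<lambda>n \<omega>. - (ereal (1 / real n) * elog (ebel_R w n (xs \<omega>) \<mu>0)))
           N (\<lambda>\<omega>. - g_fun (f \<omega>) (Y \<omega>)))"
proof -
  note M = \<open>prob_space M\<close> and N = \<open>prob_space N\<close> and B = \<open>standard_bm_vector N B\<close>
    and lam [measurable] = \<open>\<And>n. lam n \<in> borel_measurable M\<close>
    and mult = \<open>\<And>n \<omega>. \<omega> \<in> space M \<Longrightarrow> ebel_multiplier w n (xs \<omega>) \<mu>0 (lam n \<omega>)\<close>
    and conv = \<open>conv_in_distr
           M (\<lambda>n \<omega>. path01 (\<lambda>t. (1 / sqrt (real n)) *\<^sub>R partial_sum_path n (xs \<omega>) \<mu>0 t))
           N (\<lambda>\<omega>. path01 (\<lambda>t. mat_sqrt \<Sigma> *v B t \<omega>))\<close>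
  note S = pos_def_mat_sqrt[OF \<open>pos_def \<Sigma>\<close>]
  have w: "continuous_on {0..1} w" using \<open>weight_function w\<close> by (simp add: weight_function_def)
  have B_comp: "continuous_on {0..1} (\<lambda>t. B t \<omega> $ k)" if "\<omega> \<in> space N" for \<omega> k
    using B that by (simp add: standard_bm_vector_def standard_bm_def)
  have Bc: "continuous_on {0..1} (\<lambda>t. B t \<omega>)" if "\<omega> \<in> space N" for \<omega>
    using B_comp[OF that] unfolding continuous_on_def by (blast intro: vec_tendstoI)
  have Bm: "B t \<in> borel_measurable N" if "t \<in> {0..1}" for t
  proof (subst borel_measurable_euclidean_space, rule ballI)
    fix i :: "real^'d" assume "i \<in> Basis"
    then obtain k where k: "i = axis k 1" by (auto simp: Basis_vec_def)
    show "(\<lambda>\<omega>. B t \<omega> \<bullet> i) \<in> borel_measurable N"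
      using B that by (simp add: k inner_axis standard_bm_vector_def standard_bm_def)
  qed
  have fc: "continuous_on {0..1} (f \<omega>)" if "\<omega> \<in> space N" for \<omega>
    unfolding f_def by (intro continuous_intros w Bc that)
  have fm: "(\<lambda>\<omega>. f \<omega> t) \<in> borel_measurable N" if "t \<in> {0..1}" for t
    unfolding f_def by (intro borel_measurable_scaleR borel_measurable_const Bm that)
  have span: "AE \<omega> in N. spans_all_directions (f \<omega>)"
    unfolding f_def by (rule weighted_bm_spans_all_directions[OF N B \<open>weight_function w\<close>])
  have Xm: "(\<lambda>\<omega>. xs \<omega> j) \<in> borel_measurable M" for j
    unfolding xs_def using \<open>strictly_stationary M X\<close> by (simp add: strictly_stationary_def)
  have unique: "AE \<omega> in N. \<exists>!y. is_g_minimizer (f \<omega>) y"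
    using span AE_space
  proof eventually_elim
    case (elim \<omega>)
    then show ?case using g_minimizer_exists[OF fc] g_minimizer_unique[OF fc] by blast
  qed
  moreover have "conv_in_distr M (\<lambda>n \<omega>. sqrt (real n) *\<^sub>R (mat_sqrt \<Sigma> *v lam n \<omega>)) N Y \<and>
         conv_in_distr M (\<lambda>n \<omega>. - (ereal (1 / real n) * elog (ebel_R w n (xs \<omega>) \<mu>0)))
           N (\<lambda>\<omega>. - g_fun (f \<omega>) (Y \<omega>))"
    if Y: "Y \<in> borel_measurable N" "AE \<omega> in N. is_g_minimizer (f \<omega>) (Y \<omega>)" for Y
  proof
    show "conv_in_distr M (\<lambda>n \<omega>. sqrt (real n) *\<^sub>R (mat_sqrt \<Sigma> *v lam n \<omega>)) N Y"
    proof (rule conv_in_distr_mapping[OF M N conv _ Y(1)])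
      show "(\<lambda>\<omega>. sqrt (real n) *\<^sub>R (mat_sqrt \<Sigma> *v lam n \<omega>)) \<in> borel_measurable M" for n
        by (intro borel_measurable_scaleR borel_measurable_const measurable_compose[OF lam]
            borel_measurable_continuous_onI linear_continuous_on matrix_vector_mul_bounded_linear)
      \<comment> \<open>The exceptional set consists of the limit outcomes at which \<open>f\<close>
        fails to span or \<open>Y\<close> fails to minimise; at all others the deterministic limit
        applies to every convergent sequence of paths.\<close>
      show "AE \<omega>' in N. \<forall>k \<omega>. filterlim k at_top sequentially \<longrightarrow> (\<forall>i::nat. \<omega> i \<in> space M) \<longrightarrow>
          (\<lambda>i. path01 (\<lambda>t. (1 / sqrt (real (k i))) *\<^sub>R partial_sum_path (k i) (xs (\<omega> i)) \<mu>0 t))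
            \<longlonglongrightarrow> path01 (\<lambda>t. mat_sqrt \<Sigma> *v B t \<omega>') \<longrightarrow>
          (\<lambda>i. sqrt (real (k i)) *\<^sub>R (mat_sqrt \<Sigma> *v lam (k i) (\<omega> i))) \<longlonglongrightarrow> Y \<omega>'"
        using span Y(2) AE_space
      proof eventually_elim
        case (elim \<omega>')
        show ?case
          by (intro allI impI ebel_limit(1)[OF S w Bc[OF elim(3)] elim(1)[unfolded f_def] elim(2)[unfolded f_def]])
            (auto intro: mult)
      qed
    qed
    show "conv_in_distr M (\<lambda>n \<omega>. - (ereal (1 / real n) * elog (ebel_R w n (xs \<omega>) \<mu>0)))
           N (\<lambda>\<omega>. - g_fun (f \<omega>) (Y \<omega>))"
    proof (rule conv_in_distr_mapping[OF M N conv])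
      have [measurable]: "(\<lambda>\<omega>. ebel_R w n (xs \<omega>) \<mu>0) \<in> borel_measurable M" for n
        by (rule borel_measurable_ebel_R[OF Xm])
      show "(\<lambda>\<omega>. - (ereal (1 / real n) * elog (ebel_R w n (xs \<omega>) \<mu>0))) \<in> borel_measurable M" for n
        by measurable
      show "(\<lambda>\<omega>. - g_fun (f \<omega>) (Y \<omega>)) \<in> borel_measurable N"
        by (intro borel_measurable_uminus_ereal borel_measurable_g_fun fm fc Y(1))
      show "AE \<omega>' in N. \<forall>k \<omega>. filterlim k at_top sequentially \<longrightarrow> (\<forall>i::nat. \<omega> i \<in> space M) \<longrightarrow>
          (\<lambda>i. path01 (\<lambda>t. (1 / sqrt (real (k i))) *\<^sub>R partial_sum_path (k i) (xs (\<omega> i)) \<mu>0 t))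
            \<longlonglongrightarrow> path01 (\<lambda>t. mat_sqrt \<Sigma> *v B t \<omega>') \<longrightarrow>
          (\<lambda>i. - (ereal (1 / real (k i)) * elog (ebel_R w (k i) (xs (\<omega> i)) \<mu>0))) \<longlonglongrightarrow> - g_fun (f \<omega>') (Y \<omega>')"
        using span Y(2) AE_space
      proof eventually_elim
        case (elim \<omega>')
        show ?case
          unfolding f_def
          by (intro allI impI ebel_limit(2)[OF S w Bc[OF elim(3)] elim(1)[unfolded f_def] elim(2)[unfolded f_def]])
            (auto intro: mult)
      qed
    qed
  qed
  ultimately show ?thesis by blast
qed

end
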